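(* Let $G$ be any 4-colorable maximal planar graph of order $n\ge 8$. Then $G$ can be obtained from some maximal planar graph of order $n-1$, $n-2$ or $n-3$ by one of the following operations or combinations of operations: extending 3-wheel; extending 4-wheel; extending 5-wheel; extending 3-wheel followed by extending 5-wheel; extending 2-wheel followed by extending 5-wheel; extending 2-wheel followed by extending 4-wheel.
   Context: A maximal planar graph is a plane graph all of whose faces (including the infinite one) are triangles; graphs are simple, except that graphs containing a 2-wheel (a degree-2 vertex in a region bounded by a pair of parallel edges, joined to both of their ends) are allowed. Extending operations: - Extending 2-wheel: double an edge to form a 2-cycle, add a new vertex in the face bounded by the 2-cycle, and join it to both vertices of the 2-cycle. - Extending 3-wheel: add a new vertex in a triangular face and join it to the three vertices of the face. - Extending 4-wheel on a path $xuy$ of length 2: split $u$ into two vertices $u,u'$ and the edges $xu,uy$ into pairs $xu,xu'$ and $uy,u'y$, so that the path is replaced by a 4-cycle $xuyu'x$ bounding a new face, where the edges at $u$ on one side of the path stay at $u$ and those on the other side go to $u'$; then add a new vertex in this face joined to $x,u,y,u'$. - Extending 5-wheel on a funnel (a vertex $s$, the stem, joined to a vertex $t$, the top, and to two adjacent vertices $b_1,b_2$, the bottoms, with $s b_1 b_2$ a face): split $s$ into two vertices $s_1,s_2$, doubling the edge $st$ into $s_1t,s_2t$, where $s_1$ receives $b_1$ and the edges at $s$ between $t$ and $b_1$, and $s_2$ receives $b_2$ and the edges at $s$ between $t$ and $b_2$, so that a 5-cycle $t s_1 b_1 b_2 s_2 t$ bounds a new face; then add a new vertex in this face joined to all five of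 its vertices.
   Formalization: The given graph G is additionally assumed simple (it contains no 2-wheel), since the claim fails for K4 with extending 2-wheel applied to each of its six edges (order 10, all degrees 2 or 9); the source graph may still contain 2-wheels. *)

theory Defs
  imports "Graph_Theory.Graph_Theory" "HOL-Combinatorics.Orbits"
begin

text \<open>
  Plane graphs are represented, as usual, by rotation systems.  The underlying graph is a symmetric
  directed multigraph in which every edge consists of two opposite arcs, interchanged by
  \<open>opp\<close>; \<open>rot\<close> sends an arc to the next arc in counterclockwise order around its tail.
\<close>

record ('a, 'b) embedded_graph =
  skel :: "('a, 'b) pre_digraph"
  opp :: "'b \<Rightarrow> 'b"
  rot :: "'b \<Rightarrow> 'b"

abbreviation vs :: "('a, 'b) embedded_graph \<Rightarrow> 'a set" where
  "vs M \<equiv> verts (skel M)"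

abbreviation darts :: "('a, 'b) embedded_graph \<Rightarrow> 'b set" where
  "darts M \<equiv> arcs (skel M)"

abbreviation src :: "('a, 'b) embedded_graph \<Rightarrow> 'b \<Rightarrow> 'a" where
  "src M \<equiv> tail (skel M)"

abbreviation dst :: "('a, 'b) embedded_graph \<Rightarrow> 'b \<Rightarrow> 'a" where
  "dst M \<equiv> head (skel M)"

text \<open>
  \<open>face_step M d\<close> follows \<open>d\<close> on the boundary of the face to the right of \<open>d\<close>; faces are
  represented by the sets of arcs on their boundary walks.
\<close>

definition face_step :: "('a, 'b) embedded_graph \<Rightarrow> 'b \<Rightarrow> 'b" where
  "face_step M d = rot M (opp M d)"

definition face :: "('a, 'b) embedded_graph \<Rightarrow> 'b \<Rightarrow> 'b set" where
  "face M d = orbit (face_step M) d"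

definition faces :: "('a, 'b) embedded_graph \<Rightarrow> 'b set set" where
  "faces M = face M ` darts M"

text \<open>Planarity is expressed by Euler's formula (genus \<open>0\<close>).\<close>

locale plane_graph =
  fin_digraph "skel M" + bidirected_digraph "skel M" "opp M" for M :: "('a, 'b) embedded_graph" +
  assumes rot_permutes: "rot M permutes darts M"
    and rot_cyclic: "v \<in> vs M \<Longrightarrow> cyclic_on (rot M) (out_arcs (skel M) v)"
    and connected: "connected (skel M)"
    and euler: "card (vs M) + card (faces M) = card (darts M) div 2 + 2"

definition order :: "('a, 'b) embedded_graph \<Rightarrow> nat" where
  "order M = card (vs M)"

definition four_colorable :: "('a, 'b) embedded_graph \<Rightarrow> bool" where
  "four_colorable M \<longleftrightarrow>
     (\<exists>c :: 'a \<Rightarrow> nat. (\<forall>v \<in> vs M. c v < 4) \<and> (\<forall>d \<in> darts M. c (src M d) \<noteq> c (dst M d)))"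

text \<open>
  For parallel arcs \<open>d\<close>, \<open>e\<close> from \<open>x\<close> to \<open>y\<close>: the region bounded by the two edges on the left of
  \<open>d\<close> and the right of \<open>e\<close> contains just a vertex of degree \<open>2\<close>, joined to \<open>x\<close> and \<open>y\<close>
  by the arcs \<open>f\<close> and \<open>g\<close>.
\<close>

definition bounds_2wheel :: "('a, 'b) embedded_graph \<Rightarrow> 'b \<Rightarrow> 'b \<Rightarrow> bool" where
  "bounds_2wheel M d e \<longleftrightarrow>
     (\<exists>f \<in> darts M. \<exists>g \<in> darts M.
        dst M f = dst M g \<and> out_degree (skel M) (dst M f) = 2 \<and>
        rot M d = f \<and> rot M f = e \<and> rot M (opp M e) = g \<and> rot M g = opp M d)"

text \<open>
  In a loopless graph a boundary walk of length \<open>3\<close> is a triangle.  Parallel edges are admitted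
  only as the boundary of a 2-wheel.
\<close>

definition maximal_planar :: "('a, 'b) embedded_graph \<Rightarrow> bool" where
  "maximal_planar M \<longleftrightarrow>
     plane_graph M \<and> loopfree_digraph (skel M) \<and> (\<forall>F \<in> faces M. card F = 3) \<and>
     (\<forall>d \<in> darts M. \<forall>e \<in> darts M.
        d \<noteq> e \<and> arc_to_ends (skel M) d = arc_to_ends (skel M) e \<longrightarrow>
        bounds_2wheel M d e \<or> bounds_2wheel M e d)"

definition simple :: "('a, 'b) embedded_graph \<Rightarrow> bool" where
  "simple M \<longleftrightarrow> loopfree_digraph (skel M) \<and> nomulti_digraph (skel M)"

text \<open>
  The operations below are relations between the old graph \<open>H\<close> and the new graph \<open>G\<close>, where
  \<open>G\<close> literally contains the vertices and arcs of \<open>H\<close> together with fresh ones.  No isomorphism is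
  needed: if \<open>G\<close> is isomorphic to an extension of some graph, then the old part of that extension can be
  renamed inside \<open>G\<close>.

  \<open>add_hub H F G\<close>: a new vertex \<open>w\<close> is placed in the face \<open>F\<close> and joined to the corners of \<open>F\<close>.
  For \<open>d \<in> F\<close>, the corner at the tail of \<open>d\<close> lies just before \<open>d\<close> in the rotation; \<open>s d\<close> is the
  new arc from that corner to \<open>w\<close> and \<open>h d\<close> is its opposite.
\<close>

definition add_hub ::
  "('a, 'b) embedded_graph \<Rightarrow> 'b set \<Rightarrow> ('a, 'b) embedded_graph \<Rightarrow> bool" where
  "add_hub H F G \<longleftrightarrow> F \<in> faces H \<and>
     (\<exists>w s h.
        w \<notin> vs H \<and> inj_on s F \<and> inj_on h F \<and> s ` F \<inter> h ` F = {} \<and>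
        (s ` F \<union> h ` F) \<inter> darts H = {} \<and>
        vs G = insert w (vs H) \<and> darts G = darts H \<union> s ` F \<union> h ` F \<and>
        (\<forall>d \<in> darts H. src G d = src H d \<and> dst G d = dst H d \<and> opp G d = opp H d \<and>
           rot G d = (if rot H d \<in> F then s (rot H d) else rot H d)) \<and>
        (\<forall>d \<in> F. src G (s d) = src H d \<and> dst G (s d) = w \<and> opp G (s d) = h d \<and> rot G (s d) = d) \<and>
        (\<forall>d \<in> F. src G (h d) = w \<and> dst G (h d) = src H d \<and> opp G (h d) = s d \<and>
           rot G (h (face_step H d)) = h d))"

text \<open>
  The edge of \<open>d\<close> is doubled by a new edge with arcs \<open>e\<close> (parallel to \<open>d\<close>, next to it on the left)
  and \<open>e'\<close>; the new 2-gonal face is \<open>{e, opp d}\<close>.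
\<close>

definition double_edge ::
  "('a, 'b) embedded_graph \<Rightarrow> 'b \<Rightarrow> 'b \<Rightarrow> ('a, 'b) embedded_graph \<Rightarrow> bool" where
  "double_edge H d e G \<longleftrightarrow> d \<in> darts H \<and>
     (\<exists>e'. e \<notin> darts H \<and> e' \<notin> darts H \<and> e \<noteq> e' \<and>
        vs G = vs H \<and> darts G = darts H \<union> {e, e'} \<and>
        (\<forall>c \<in> darts H. src G c = src H c \<and> dst G c = dst H c \<and> opp G c = opp H c \<and>
           rot G c = (if c = d then e else if rot H c = opp H d then e' else rot H c)) \<and>
        src G e = src H d \<and> dst G e = dst H d \<and> opp G e = e' \<and> rot G e = rot H d \<and>
        src G e' = dst H d \<and> dst G e' = src H d \<and> opp G e' = e \<and> rot G e' = opp H d)"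

text \<open>The arcs strictly after \<open>a\<close> and strictly before \<open>b\<close> in the rotation at their common tail.\<close>

definition between :: "('a, 'b) embedded_graph \<Rightarrow> 'b \<Rightarrow> 'b \<Rightarrow> 'b set" where
  "between M a b =
     {(rot M ^^ i) a | i. 0 < i \<and> (\<forall>j. 0 < j \<and> j \<le> i \<longrightarrow> (rot M ^^ j) a \<noteq> a \<and> (rot M ^^ j) a \<noteq> b)}"

text \<open>
  Splitting \<open>u\<close> along the path \<open>x u y\<close>, given by arcs \<open>a\<close> from \<open>u\<close> to \<open>x\<close> and \<open>b\<close> from \<open>u\<close> to
  \<open>y\<close>: the arcs at \<open>u\<close> after \<open>b\<close> and before \<open>a\<close> are moved to the new vertex \<open>u'\<close>.  The new edges
  \<open>u'x\<close> and \<open>u'y\<close> have the arcs \<open>a'\<close>, \<open>b'\<close> from \<open>u'\<close> and their opposites \<open>ra\<close>, \<open>rb\<close>.  The new face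
  is \<open>{a, ra, b', opp b}\<close>.
\<close>

definition split_path ::
  "('a, 'b) embedded_graph \<Rightarrow> 'b \<Rightarrow> 'b \<Rightarrow> ('a, 'b) embedded_graph \<Rightarrow> bool" where
  "split_path H a b G \<longleftrightarrow>
     a \<in> darts H \<and> b \<in> darts H \<and> src H a = src H b \<and>
     src H a \<noteq> dst H a \<and> src H b \<noteq> dst H b \<and> dst H a \<noteq> dst H b \<and>
     (\<exists>u' a' b' ra rb. let B = between H b a in
        u' \<notin> vs H \<and> distinct [a', b', ra, rb] \<and> {a', b', ra, rb} \<inter> darts H = {} \<and>
        vs G = insert u' (vs H) \<and> darts G = darts H \<union> {a', b', ra, rb} \<and>
        (\<forall>d \<in> darts H.
           src G d = (if d \<in> B then u' else src H d) \<and>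
           dst G d = (if opp H d \<in> B then u' else dst H d) \<and>
           opp G d = opp H d \<and>
           rot G d =
             (if d = b then a
              else if d = opp H a then ra
              else if rot H d = opp H b then rb
              else if d \<in> B \<and> rot H d = a then a'
              else rot H d)) \<and>
        src G a' = u' \<and> dst G a' = dst H a \<and> opp G a' = ra \<and> rot G a' = b' \<and>
        src G b' = u' \<and> dst G b' = dst H b \<and> opp G b' = rb \<and>
          rot G b' = (if rot H b = a then a' else rot H b) \<and>
        src G ra = dst H a \<and> dst G ra = u' \<and> opp G ra = a' \<and> rot G ra = rot H (opp H a) \<and>
        src G rb = dst H b \<and> dst G rb = u' \<and> opp G rb = b' \<and> rot G rb = opp H b)"

text \<open>
  A funnel with stem \<open>s\<close> is given by the arcs \<open>a\<close>, \<open>b1\<close>, \<open>b2\<close> from \<open>s\<close> to the top and to the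
  bottoms, which are named such that \<open>b2\<close> follows \<open>b1\<close> in the rotation at \<open>s\<close>; then the face
  \<open>s b1 b2\<close> lies to the right of \<open>b2\<close>.
\<close>

definition funnel :: "('a, 'b) embedded_graph \<Rightarrow> 'b \<Rightarrow> 'b \<Rightarrow> 'b \<Rightarrow> bool" where
  "funnel M a b1 b2 \<longleftrightarrow>
     a \<in> darts M \<and> b1 \<in> darts M \<and> b2 \<in> darts M \<and> src M a = src M b1 \<and> src M b2 = src M b1 \<and>
     distinct [src M a, dst M a, dst M b1, dst M b2] \<and>
     rot M b1 = b2 \<and> face_step M (face_step M b2) = opp M b1"

text \<open>
  Splitting the stem: the old stem plays the role of \<open>s\<^sub>1\<close>, keeping \<open>a\<close>, \<open>b1\<close> and the arcs between
  them, whereas \<open>b2\<close> and the arcs between \<open>b2\<close> and \<open>a\<close> are moved to the new vertex \<open>s2\<close>, which is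
  joined to the top by a new edge with arcs \<open>a'\<close> and \<open>ra\<close>.  The new face is the one of \<open>a\<close>, with
  vertices \<open>s\<^sub>1\<close>, top, \<open>s2\<close>, and the two bottoms.
\<close>

definition split_funnel ::
  "('a, 'b) embedded_graph \<Rightarrow> 'b \<Rightarrow> 'b \<Rightarrow> 'b \<Rightarrow> ('a, 'b) embedded_graph \<Rightarrow> bool" where
  "split_funnel H a b1 b2 G \<longleftrightarrow> funnel H a b1 b2 \<and>
     (\<exists>s2 a' ra. let B = between H b1 a in
        s2 \<notin> vs H \<and> a' \<noteq> ra \<and> {a', ra} \<inter> darts H = {} \<and>
        vs G = insert s2 (vs H) \<and> darts G = darts H \<union> {a', ra} \<and>
        (\<forall>d \<in> darts H.
           src G d = (if d \<in> B then s2 else src H d) \<and>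
           dst G d = (if opp H d \<in> B then s2 else dst H d) \<and>
           opp G d = opp H d \<and>
           rot G d =
             (if d = b1 then a
              else if d = opp H a then ra
              else if d \<in> B \<and> rot H d = a then a'
              else rot H d)) \<and>
        src G a' = s2 \<and> dst G a' = dst H a \<and> opp G a' = ra \<and> rot G a' = b2 \<and>
        src G ra = dst H a \<and> dst G ra = s2 \<and> opp G ra = a' \<and> rot G ra = rot H (opp H a))"

definition extend_2wheel :: "('a, 'b) embedded_graph \<Rightarrow> ('a, 'b) embedded_graph \<Rightarrow> bool" where
  "extend_2wheel H G \<longleftrightarrow> (\<exists>d e K. double_edge H d e K \<and> add_hub K (face K e) G)"

definition extend_3wheel :: "('a, 'b) embedded_graph \<Rightarrow> ('a, 'b) embedded_graph \<Rightarrow> bool" where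
  "extend_3wheel H G \<longleftrightarrow> (\<exists>F \<in> faces H. card F = 3 \<and> add_hub H F G)"

definition extend_4wheel :: "('a, 'b) embedded_graph \<Rightarrow> ('a, 'b) embedded_graph \<Rightarrow> bool" where
  "extend_4wheel H G \<longleftrightarrow> (\<exists>a b K. split_path H a b K \<and> add_hub K (face K a) G)"

definition extend_5wheel :: "('a, 'b) embedded_graph \<Rightarrow> ('a, 'b) embedded_graph \<Rightarrow> bool" where
  "extend_5wheel H G \<longleftrightarrow> (\<exists>a b1 b2 K. split_funnel H a b1 b2 K \<and> add_hub K (face K a) G)"

end

theory Submission
  imports Defs
begin

text \<open>
  Contracting two spokes \<open>w s\<^sub>1\<close> and \<open>w s\<^sub>2\<close> of a wheel with hub \<open>w\<close> of degree \<open>4\<close> or \<open>5\<close> inverts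
  the extension by a 4-wheel or 5-wheel, and contracting one spoke of a 3-wheel deletes its hub.  The
  contraction is again a triangulation; it fails to be maximal planar only if \<open>s\<^sub>1\<close> and \<open>s\<^sub>2\<close> are adjacent
  or have a further common neighbour.

  By Euler's formula, counting dimensions over \<open>GF(2)\<close> shows that every edge set of even degrees is the
  boundary of a set of faces, which serves as a Jordan curve theorem for cycles of length \<open>3\<close> and \<open>4\<close>.
  It implies that all pairs of spokes are bad only if some vertex \<open>z\<close> is adjacent to the whole rim.
  To rule this out, take a minimal side of a triangle which is not just a face.  Its interior contains
  a vertex \<open>v\<close> of degree at most \<open>5\<close>, again by Euler's formula.  If \<open>z\<close> is adjacent to the whole rim of
  \<open>v\<close>, then minimality forces two consecutive triangles \<open>z x\<^sub>i x\<^sub>i\<^sub>+\<^sub>1\<close> to be faces, and their common rim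
  vertex has degree \<open>4\<close>.  If the degree of \<open>v\<close> is \<open>5\<close>, pass to that vertex; if it is \<open>4\<close>, then contracting
  the neighbours of that vertex on the rim creates parallel edges, but these just bound a 2-wheel.
  Hence the extensions by a 3-wheel, 4-wheel or 5-wheel suffice.
\<close>

section \<open>Cyclic lists and triangulations\<close>

text \<open>A rotation system has no inside and outside, so a side of a cycle is a set of darts
  closed under \<open>face_step\<close> that changes across an edge only along the cycle. What
  replaces topology for nested regions is \<open>side_connected\<close>: a side of a triangle cannot
  be broken up without crossing an edge inside it. The obstacle is that a triangle on
  \<open>z\<close> and a rim edge of \<open>v\<close> need not be a face, and minimality speaks only
  about sides within the minimal region \<open>S\<close>. The side of such a triangle away from
  \<open>v\<close> lies within \<open>S\<close> or contains the whole complement of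
  \<open>S\<close>. For two triangles with disjoint rim edges these sides are disjoint, so at least
  one lies within \<open>S\<close> and is a face. In degree 4 this gives a face from each of the two
  opposite pairs, hence two consecutive faces. In degree 5 the non-faces contain no two disjoint rim
  edges, so there are at most two of them, and three faces on a 5-cycle include two consecutive
  ones. The vertex \<open>v\<close> must be interior to \<open>S\<close>, so Euler's formula is
  needed for one side of a triangle. The dimension count yields an inequality for each side, and the
  two inequalities add up to the global formula.\<close>

definition cyc :: "('b \<Rightarrow> 'b) \<Rightarrow> 'b list \<Rightarrow> bool" where
  "cyc f xs \<longleftrightarrow> xs \<noteq> [] \<and> distinct xs \<and> successively (\<lambda>a b. f a = b) xs \<and> f (last xs) = hd xs"

lemma cyc_image: "cyc f xs \<Longrightarrow> f ` set xs \<subseteq> set xs"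
proof
  fix y assume c: "cyc f xs" and "y \<in> f ` set xs"
  then obtain x where x: "x \<in> set xs" "y = f x" by auto
  then obtain us vs where xs: "xs = us @ x # vs" by (metis split_list)
  show "y \<in> set xs"
    using c x xs by (cases vs) (auto simp: cyc_def successively_append_iff hd_append split: if_splits)
qed

text \<open>Iteration starts at \<open>last xs\<close>, so that every entry is reached with a
  positive exponent, as \<open>orbit\<close> demands.\<close>

lemma cyc_nth:
  assumes "cyc f xs" "i < length xs"
  shows "(f ^^ Suc i) (last xs) = xs ! i"
  using assms(2)
proof (induction i)
  case 0
  then show ?case using assms(1) by (simp add: cyc_def hd_conv_nth)
next
  case (Suc i)
  then have "f (xs ! i) = xs ! Suc i"
    using assms(1) by (simp add: cyc_def successively_conv_nth)
  then show ?case using Suc by simp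
qed

text \<open>Together with its converse \<open>cyclic_on_imp_cyc\<close> this allows rotations to be
  cut and spliced as lists, which \<open>cyclic_on\<close> alone, being about sets, does not
  support.\<close>

lemma cyc_imp_cyclic_on:
  assumes "cyc f xs"
  shows "cyclic_on f (set xs)"
proof -
  have ne: "xs \<noteq> []" using assms by (simp add: cyc_def)
  have "set xs \<subseteq> orbit f (last xs)"
  proof
    fix y assume "y \<in> set xs"
    then obtain i where "i < length xs" "y = xs ! i" by (metis in_set_conv_nth)
    then show "y \<in> orbit f (last xs)"
      unfolding orbit_altdef using cyc_nth[OF assms, of i] by (metis (mono_tags, lifting) mem_Collect_eq zero_less_Suc)
  qed
  moreover have "y \<in> orbit f (last xs) \<Longrightarrow> y \<in> set xs" for y
    by (induction rule: orbit.induct) (use cyc_image[OF assms] ne in auto)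
  ultimately show ?thesis unfolding cyclic_on_def
    using ne by (intro bexI[of _ "last xs"]) auto
qed

lemma cyclic_on_imp_cyc:
  assumes "cyclic_on f S" "x \<in> S"
  obtains xs where "cyc f (x # xs)" "set (x # xs) = S"
proof -
  have S: "S = orbit f x" using assms by (simp add: orbit_cyclic_eq3)
  then have self: "x \<in> orbit f x" using assms by simp
  define n where "n = funpow_dist1 f x x"
  have n: "(f ^^ n) x = x" "n > 0" unfolding n_def using funpow_dist1_prop[OF self] by auto
  define ys where "ys = map (\<lambda>i. (f ^^ i) x) [0..<n]"
  have "set ys = S"
    unfolding ys_def S orbit_conv_funpow_dist1[OF self] by (simp add: n_def del: upt_Suc)
  moreover have "cyc f ys" unfolding cyc_def
  proof (intro conjI)
    show "ys \<noteq> []" using n by (simp add: ys_def)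
    show "distinct ys" using inj_on_funpow_dist1[OF self]
      by (simp add: ys_def distinct_map n_def lessThan_atLeast0 del: upt_Suc)
    show "successively (\<lambda>a b. f a = b) ys" by (auto simp: successively_conv_nth ys_def)
    have "last ys = (f ^^ (n - 1)) x" using n by (simp add: ys_def last_map)
    then have "f (last ys) = (f ^^ Suc (n - 1)) x" by simp
    also have "\<dots> = hd ys" using n by (cases n) (simp_all add: ys_def hd_map del: upt_Suc)
    finally show "f (last ys) = hd ys" .
  qed
  moreover have "ys = x # tl ys" using n
    by (metis (no_types, lifting) calculation(2) cyc_def funpow_0 hd_map list.collapse upt_conv_Cons ys_def map_is_Nil_conv list.sel(1))
  ultimately show thesis using that[of "tl ys"] by metis
qed

lemma cyc_rotate: "cyc f (xs @ ys) \<Longrightarrow> cyc f (ys @ xs)"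
  by (cases "xs = []"; cases "ys = []")
    (auto simp: cyc_def successively_append_iff hd_append last_append)

lemma cyc_cong: "cyc f xs \<Longrightarrow> (\<And>x. x \<in> set xs \<Longrightarrow> g x = f x) \<Longrightarrow> cyc g xs"
  unfolding cyc_def by (auto cong: successively_cong)

text \<open>Evaluates \<open>between\<close>, which is defined by iterates, on a listed rotation.
  This is how the darts moved by a vertex split are identified.\<close>

lemma between_eq:
  assumes "successively (\<lambda>a b. rot M a = b) (b # Bs @ [a])" "distinct (b # Bs @ [a])"
  shows "between M b a = set Bs"
proof -
  let ?l = "b # Bs @ [a]"
  have nth: "(rot M ^^ i) b = ?l ! i" if "i < length ?l" for i
    using that
  proof (induction i)
    case (Suc i)
    then have "rot M (?l ! i) = ?l ! Suc i"
      using assms(1) by (simp only: successively_conv_nth)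
    then show ?case using Suc by simp
  qed simp
  have neq: "(rot M ^^ i) b \<noteq> b \<and> (rot M ^^ i) b \<noteq> a" if "0 < i" "i < Suc (length Bs)" for i
  proof -
    have "(rot M ^^ i) b = Bs ! (i - 1)" using nth[of i] that by (auto simp: nth_Cons' nth_append)
    then have "(rot M ^^ i) b \<in> set Bs" using that by auto
    then show ?thesis using assms(2) by auto
  qed
  have last: "(rot M ^^ (Suc (length Bs))) b = a" using nth[of "Suc (length Bs)"] by (simp add: nth_append)
  show ?thesis
  proof (intro set_eqI iffI)
    fix x assume "x \<in> between M b a"
    then obtain i where i: "x = (rot M ^^ i) b" "0 < i"
       "\<And>j. 0 < j \<Longrightarrow> j \<le> i \<Longrightarrow> (rot M ^^ j) b \<noteq> b \<and> (rot M ^^ j) b \<noteq> a"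
      unfolding between_def by auto
    then have "i < Suc (length Bs)" using last by (metis not_less zero_less_Suc)
    then have "x = Bs ! (i - 1)" "i - 1 < length Bs" using nth[of i] i by (auto simp: nth_Cons' nth_append)
    then show "x \<in> set Bs" by auto
  next
    fix x assume "x \<in> set Bs"
    then obtain k where k: "x = Bs ! k" "k < length Bs" by (metis in_set_conv_nth)
    then have "x = (rot M ^^ (Suc k)) b" using nth[of "Suc k"] by (simp add: nth_append)
    moreover have "(rot M ^^ j) b \<noteq> b \<and> (rot M ^^ j) b \<noteq> a" if "0 < j" "j \<le> Suc k" for j
      using neq[of j] that k by simp
    ultimately show "x \<in> between M b a" unfolding between_def by blast
  qed
qed

text \<open>These axioms can be checked for a contracted graph without recounting its faces.
  \<open>euler6\<close> is Euler's formula after inserting 3F = 2E and 2E for the number of darts;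
  \<open>face_triangle\<close> replaces the size of a face orbit.\<close>

locale triangulation =
  fixes M :: "('a, 'b) embedded_graph"
  assumes finite_vs: "finite (vs M)" and finite_darts: "finite (darts M)"
    and vs_nonempty: "vs M \<noteq> {}"
    and src_in: "d \<in> darts M \<Longrightarrow> src M d \<in> vs M"
    and opp_in: "d \<in> darts M \<Longrightarrow> opp M d \<in> darts M"
    and opp_outside: "d \<notin> darts M \<Longrightarrow> opp M d = d"
    and opp_opp [simp]: "opp M (opp M d) = d"
    and src_opp: "d \<in> darts M \<Longrightarrow> src M (opp M d) = dst M d"
    and no_loop: "d \<in> darts M \<Longrightarrow> src M d \<noteq> dst M d"
    and rot_permutes: "rot M permutes darts M"
    and rot_cyclic: "v \<in> vs M \<Longrightarrow> cyclic_on (rot M) (out_arcs (skel M) v)"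
    and connected: "\<lbrakk>U \<subseteq> vs M; U \<noteq> {}; \<And>d. d \<in> darts M \<Longrightarrow> src M d \<in> U \<Longrightarrow> dst M d \<in> U\<rbrakk> \<Longrightarrow> U = vs M"
    and face_triangle: "d \<in> darts M \<Longrightarrow> face_step M (face_step M (face_step M d)) = d"
    and euler6: "6 * card (vs M) = card (darts M) + 12"

lemma triangulationI:
  assumes "plane_graph M" "loopfree_digraph (skel M)" "\<forall>F \<in> faces M. card F = 3"
  shows "triangulation M"
proof -
  interpret plane_graph M by fact
  interpret loopfree_digraph "skel M" by fact
  have fin: "finite (darts M)" by simp
  have rin: "rot M d \<in> darts M \<longleftrightarrow> d \<in> darts M" for d using permutes_in_image[OF rot_permutes] .
  have phi_perm: "face_step M permutes darts M"
    using permutes_compose[OF arev_permutes_arcs rot_permutes] by (simp add: face_step_def[abs_def] o_def)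
  then have perm: "permutation (face_step M)" using fin permutation_permutes by blast
  have face3: "face_step M (face_step M (face_step M d)) = d" if d: "d \<in> darts M" for d
  proof -
    let ?f = "face_step M"
    have self: "d \<in> orbit ?f d" using permutation_self_in_orbit[OF perm] .
    have "card (orbit ?f d) = funpow_dist1 ?f d d"
      unfolding orbit_conv_funpow_dist1[OF self]
      using card_image[OF inj_on_funpow_dist1[OF self]] by (simp del: upt_Suc)
    moreover have "card (orbit ?f d) = 3"
      using assms(3) d by (auto simp: faces_def face_def)
    ultimately have "(?f ^^ 3) d = d" using funpow_dist1_prop[OF self] by simp
    then show ?thesis by (simp add: numeral_3_eq_3)
  qed
  have partition: "\<Union>(faces M) = darts M"
  proof -
    have "orbit (face_step M) d \<subseteq> darts M" if "d \<in> darts M" for d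
      using permutes_orbit_subset[OF phi_perm that] .
    moreover have "d \<in> orbit (face_step M) d" for d
      by (rule permutation_self_in_orbit) (rule perm)
    ultimately show ?thesis by (fastforce simp: faces_def face_def)
  qed
  have disj: "F \<inter> F' = {}" if FF: "F \<in> faces M" "F' \<in> faces M" "F \<noteq> F'" for F F'
  proof -
    obtain d d' where F: "F = orbit (face_step M) d" "F' = orbit (face_step M) d'"
      using FF by (auto simp: faces_def face_def)
    have cyc: "cyclic_on (face_step M) F" "cyclic_on (face_step M) F'"
      unfolding F by (rule cyclic_on_orbit'[OF perm])+
    then show ?thesis using FF(3) orbit_cyclic_eq3[OF cyc(1)] orbit_cyclic_eq3[OF cyc(2)] by blast
  qed
  have "3 * card (faces M) = card (\<Union>(faces M))"
    by (rule card_partition) (use fin disj assms(3) partition in \<open>auto simp: faces_def\<close>)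
  then have faces: "3 * card (faces M) = card (darts M)" using partition by simp
  \<comment> \<open>Needed to get rid of \<open>div 2\<close> in Euler's formula.\<close>
  have even: "even (card (darts M))"
  proof -
    let ?E = "(\<lambda>d. {d, opp M d}) ` darts M"
    have "2 * card ?E = card (\<Union>?E)"
    proof (rule card_partition)
      show "finite ?E" "finite (\<Union>?E)" using fin by auto
      show "card c = 2" if "c \<in> ?E" for c using that arev_neq by (force simp: card_2_iff)
      show "c1 \<inter> c2 = {}" if "c1 \<in> ?E" "c2 \<in> ?E" "c1 \<noteq> c2" for c1 c2
        using that by (auto simp: doubleton_eq_iff) (metis arev_arev)+
    qed
    moreover have "\<Union>?E = darts M" by auto
    ultimately show ?thesis by (metis dvd_triv_left)
  qed
  show ?thesis
  proof
    show "U = vs M" if U: "U \<subseteq> vs M" "U \<noteq> {}"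
      and step: "\<And>d. d \<in> darts M \<Longrightarrow> src M d \<in> U \<Longrightarrow> dst M d \<in> U" for U
    proof -
      obtain u where u: "u \<in> U" using U by auto
      have "v \<in> U" if v: "v \<in> vs M" for v
      proof -
        have "(u, v) \<in> rtrancl_on (vs M) ((arcs_ends (skel M))\<^sup>s)"
          using connected v u U unfolding connected_conv by blast
        then show ?thesis
        proof (induction rule: rtrancl_on_induct)
          case (step a b)
          then consider d where "d \<in> darts M" "src M d = a" "dst M d = b"
            | d where "d \<in> darts M" "src M d = b" "dst M d = a"
            by (auto simp: symcl_def arcs_ends_conv)
          then show ?case
          proof cases
            case 1 then show ?thesis using \<open>a \<in> U\<close> \<open>\<And>d. d \<in> darts M \<Longrightarrow> src M d \<in> U \<Longrightarrow> dst M d \<in> U\<close> by auto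
          next
            case 2 then show ?thesis using \<open>a \<in> U\<close> that \<open>\<And>d. d \<in> darts M \<Longrightarrow> src M d \<in> U \<Longrightarrow> dst M d \<in> U\<close>[of "opp M d"] by auto
          qed
        qed (use u in auto)
      qed
      then show ?thesis using U by auto
    qed
    show "6 * card (vs M) = card (darts M) + 12"
      using euler faces even by presburger
    show "vs M \<noteq> {}" using connected by (simp add: connected_conv)
  qed (use face3 no_loops rot_permutes rot_cyclic arev_eq in auto)
qed

context triangulation
begin

lemma dst_opp: "d \<in> darts M \<Longrightarrow> dst M (opp M d) = src M d"
  using src_opp[of "opp M d"] opp_in by simp

lemma dst_in: "d \<in> darts M \<Longrightarrow> dst M d \<in> vs M"
  using src_in[OF opp_in, of d] src_opp[of d] by simp

lemma opp_in_iff [simp]: "opp M d \<in> darts M \<longleftrightarrow> d \<in> darts M"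
  by (cases "d \<in> darts M") (auto simp: opp_in opp_outside)

lemma rot_in_iff [simp]: "rot M d \<in> darts M \<longleftrightarrow> d \<in> darts M"
  using permutes_in_image[OF rot_permutes] .

lemma rot_inj [simp]: "rot M d = rot M e \<longleftrightarrow> d = e"
  using permutes_inj[OF rot_permutes] by (auto dest: injD)

lemma opp_inj [simp]: "opp M d = opp M e \<longleftrightarrow> d = e"
  by (metis opp_opp)

lemma opp_neq: "d \<in> darts M \<Longrightarrow> opp M d \<noteq> d"
  using no_loop[of d] src_opp[of d] by auto

lemma src_rot [simp]: "src M (rot M d) = src M d"
proof (cases "d \<in> darts M")
  case True
  then have "d \<in> out_arcs (skel M) (src M d)" by simp
  then have "rot M d \<in> out_arcs (skel M) (src M d)"
    by (rule cyclic_on_inI[OF rot_cyclic[OF src_in[OF True]]])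
  then show ?thesis by simp
next
  case False
  then show ?thesis using permutes_not_in[OF rot_permutes] by simp
qed

lemma face_step_in_iff [simp]: "face_step M d \<in> darts M \<longleftrightarrow> d \<in> darts M"
  by (simp add: face_step_def)

lemma face_step_inj [simp]: "face_step M d = face_step M e \<longleftrightarrow> d = e"
  by (simp add: face_step_def)

lemma src_face_step: "d \<in> darts M \<Longrightarrow> src M (face_step M d) = dst M d"
  by (simp add: face_step_def src_opp)

lemma face_step_opp: "face_step M (opp M d) = rot M d"
  by (simp add: face_step_def)

lemma dst_face_step2: "d \<in> darts M \<Longrightarrow> dst M (face_step M (face_step M d)) = src M d"
  using src_face_step[of "face_step M (face_step M d)"] by (simp add: face_triangle)

lemma face_step_neq: "d \<in> darts M \<Longrightarrow> face_step M d \<noteq> d"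
  using src_face_step[of d] no_loop[of d] by auto

lemma face_step2_neq: "d \<in> darts M \<Longrightarrow> face_step M (face_step M d) \<noteq> d"
  using face_step_neq[of d] face_triangle[of d] by auto

lemma face_step_distinct:
  "d \<in> darts M \<Longrightarrow> distinct [d, face_step M d, face_step M (face_step M d)]"
  using face_step_neq[of d] face_step2_neq[of d] face_step_neq[of d, THEN not_sym] face_step2_neq[of d, THEN not_sym]
  by simp

lemma face_eq:
  assumes "d \<in> darts M"
  shows "face M d = {d, face_step M d, face_step M (face_step M d)}"
proof -
  let ?f = "face_step M"
  have "cyc ?f [d, ?f d, ?f (?f d)]"
    using face_triangle[OF assms] face_step_distinct[OF assms] unfolding cyc_def by simp
  from cyc_imp_cyclic_on[OF this] have "orbit ?f d = set [d, ?f d, ?f (?f d)]"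
    by (rule orbit_cyclic_eq3) simp
  then show ?thesis unfolding face_def list.set .
qed

lemma card_face:
  assumes "F \<in> faces M"
  shows "card F = 3"
proof -
  obtain d where d: "d \<in> darts M" "F = face M d" using assms by (auto simp: faces_def)
  show ?thesis
    unfolding d(2) face_eq[OF d(1)]
    using face_step_distinct[OF d(1)] by simp
qed

lemma face_eqI: "d \<in> darts M \<Longrightarrow> e \<in> face M d \<Longrightarrow> face M e = face M d"
  by (auto simp: face_eq face_triangle)

text \<open>The way back from the axioms, since a graph obtained by contraction has to satisfy
  \<open>maximal_planar\<close>.\<close>

lemma plane_graph: "plane_graph M" and loopfree: "loopfree_digraph (skel M)"
proof -
  interpret bidirected_digraph "skel M" "opp M"
    by unfold_locales (use src_in dst_in opp_outside opp_neq src_opp in auto)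
  interpret fin_digraph "skel M" by unfold_locales (use finite_vs finite_darts in auto)
  show "loopfree_digraph (skel M)" by unfold_locales (use no_loop in auto)
  have Un: "\<Union>(faces M) = darts M"
    unfolding faces_def by (auto simp: face_eq)
  have "3 * card (faces M) = card (\<Union>(faces M))"
  proof (rule card_partition)
    show "finite (faces M)" "finite (\<Union>(faces M))"
      using finite_darts Un by (auto simp: faces_def)
    show "card c = 3" if "c \<in> faces M" for c using that by (rule card_face)
    show "c1 \<inter> c2 = {}" if "c1 \<in> faces M" "c2 \<in> faces M" "c1 \<noteq> c2" for c1 c2
    proof (rule ccontr)
      assume "c1 \<inter> c2 \<noteq> {}"
      then obtain x where x: "x \<in> c1" "x \<in> c2" by auto
      have "c = face M x" if "c \<in> faces M" "x \<in> c" for c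
        using that face_eqI unfolding faces_def by blast
      then show False using x that by blast
    qed
  qed
  then have f: "3 * card (faces M) = card (darts M)" using Un by simp
  have con: "Digraph_Component.connected (skel M)"
    unfolding connected_conv
  proof (intro conjI ballI vs_nonempty)
    fix u v assume u: "u \<in> vs M" and v: "v \<in> vs M"
    let ?R = "rtrancl_on (vs M) ((arcs_ends (skel M))\<^sup>s)"
    have "{v \<in> vs M. (u, v) \<in> ?R} = vs M"
    proof (rule connected)
      fix d assume d: "d \<in> darts M" "src M d \<in> {v \<in> vs M. (u, v) \<in> ?R}"
      then have "(src M d, dst M d) \<in> (arcs_ends (skel M))\<^sup>s" by (auto simp: symcl_def arcs_ends_conv)
      then show "dst M d \<in> {v \<in> vs M. (u, v) \<in> ?R}" using d dst_in by (auto intro: rtrancl_on_into_rtrancl_on)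
    qed (use u in auto)
    then show "(u, v) \<in> ?R" using v by blast
  qed
  show "plane_graph M"
  proof
    show "card (vs M) + card (faces M) = card (darts M) div 2 + 2"
      using f euler6 by linarith
  qed (use rot_permutes rot_cyclic con in auto)
qed

end

section \<open>Even edge sets bound unions of faces\<close>

text \<open>Rank and nullity over GF(2), stated by cardinalities: every nonempty fibre is a
  translate of the kernel \<open>fiber {}\<close>.\<close>

lemma card_kernel_times_image:
  fixes f :: "'e set \<Rightarrow> 'v set"
  assumes fin: "finite A"
    and hom: "\<And>X Y. X \<subseteq> A \<Longrightarrow> Y \<subseteq> A \<Longrightarrow> f (sym_diff X Y) = sym_diff (f X) (f Y)"
  shows "card {X. X \<subseteq> A \<and> f X = {}} * card (f ` Pow A) = 2 ^ card A"
proof -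
  define fiber where "fiber y = {X. X \<subseteq> A \<and> f X = y}" for y
  have "card (fiber {}) * card (fiber ` f ` Pow A) = card (\<Union>(fiber ` f ` Pow A))"
  proof (rule card_partition)
    show "finite (fiber ` f ` Pow A)" using fin by simp
    show "finite (\<Union>(fiber ` f ` Pow A))"
      by (rule finite_subset[of _ "Pow A"]) (auto simp: fiber_def fin)
    show "c1 \<inter> c2 = {}" if "c1 \<in> fiber ` f ` Pow A" "c2 \<in> fiber ` f ` Pow A" "c1 \<noteq> c2" for c1 c2
      using that by (auto simp: fiber_def)
    fix c assume "c \<in> fiber ` f ` Pow A"
    then obtain X where X: "X \<subseteq> A" "c = fiber (f X)" by auto
    have "bij_betw (\<lambda>Y. sym_diff Y X) (fiber {}) c"
    proof (rule bij_betw_byWitness[where f' = "\<lambda>Y. sym_diff Y X"])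
      show "(\<lambda>Y. sym_diff Y X) ` fiber {} \<subseteq> c"
        using X hom by (auto simp: fiber_def)
      show "(\<lambda>Y. sym_diff Y X) ` c \<subseteq> fiber {}"
        using X hom by (auto simp: fiber_def)
    qed auto
    then show "card c = card (fiber {})" by (simp add: bij_betw_same_card)
  qed
  moreover have "\<Union>(fiber ` f ` Pow A) = Pow A" by (auto simp: fiber_def)
  moreover have "card (fiber ` f ` Pow A) = card (f ` Pow A)"
    by (rule card_image) (auto simp: inj_on_def fiber_def)
  ultimately show ?thesis using fin by (simp add: fiber_def card_Pow)
qed

lemma odd_card_sym_diff:
  assumes "finite A" "finite B"
  shows "odd (card (sym_diff A B)) \<longleftrightarrow> odd (card A) \<noteq> odd (card B)"
proof -
  have "(A - B) \<union> (A \<inter> B) = A" "(B - A) \<union> (A \<inter> B) = B" by auto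
  then have "card A = card (A - B) + card (A \<inter> B)" "card B = card (B - A) + card (A \<inter> B)"
    using assms card_Un_disjoint[of "A - B" "A \<inter> B"] card_Un_disjoint[of "B - A" "A \<inter> B"]
    by fastforce+
  moreover have "card (sym_diff A B) = card (A - B) + card (B - A)"
    using assms by (intro card_Un_disjoint) auto
  ultimately show ?thesis by presburger
qed

text \<open>Along a permutation, a property is gained as often as it is lost. Applied to
  \<open>rot\<close> at a vertex, this makes boundaries even.\<close>

lemma even_card_changes:
  fixes f :: "'b \<Rightarrow> 'b" and P :: "'b \<Rightarrow> bool"
  assumes "finite A" "f ` A = A"
  shows "even (card {x \<in> A. P x \<noteq> P (f x)})"
proof -
  have inj: "inj_on f A" using assms by (simp add: eq_card_imp_inj_on)
  have "f ` {x \<in> A. P (f x)} = {x \<in> f ` A. P x}" by auto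
  then have "card {x \<in> A. P x} = card (f ` {x \<in> A. P (f x)})" by (simp only: assms(2))
  also have "\<dots> = card {x \<in> A. P (f x)}" by (rule card_image[OF inj_on_subset[OF inj]]) simp
  finally have "card {x \<in> A. P x} = card {x \<in> A. P (f x)}" .
  moreover have "{x \<in> A. P x \<noteq> P (f x)} = sym_diff {x \<in> A. P x} {x \<in> A. P (f x)}" by auto
  ultimately show ?thesis
    using odd_card_sym_diff[of "{x \<in> A. P x}" "{x \<in> A. P (f x)}"] assms(1) by simp
qed

context triangulation
begin

definition out :: "'a \<Rightarrow> 'b set" where
  "out v = out_arcs (skel M) v"

definition closed_faces :: "'b set \<Rightarrow> bool" where
  "closed_faces U \<longleftrightarrow> U \<subseteq> darts M \<and> (\<forall>d \<in> U. face_step M d \<in> U)"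

lemma in_out [simp]: "d \<in> out v \<longleftrightarrow> d \<in> darts M \<and> src M d = v"
  by (simp add: out_def)

lemma finite_out [simp]: "finite (out v)"
  using finite_darts by (auto intro: finite_subset[of _ "darts M"])

lemma finite_closed_faces: "closed_faces U \<Longrightarrow> finite U"
  unfolding closed_faces_def using finite_darts finite_subset by blast

lemma rot_image_out: "rot M ` out v = out v"
  by (rule card_subset_eq) (auto simp: card_image inj_on_def)

text \<open>The rotation is transitive on the darts at a vertex. Later this serves to list all darts
  at a given vertex.\<close>

lemma closed_rot_out:
  assumes "\<And>d. d \<in> U \<Longrightarrow> rot M d \<in> U" "d \<in> U" "d \<in> darts M" "e \<in> darts M" "src M e = src M d"
  shows "e \<in> U"
proof -
  have "orbit (rot M) d = out (src M d)"
    unfolding out_def by (rule orbit_cyclic_eq3[OF rot_cyclic]) (use assms src_in in auto)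
  then have "e \<in> orbit (rot M) d" using assms by simp
  then show ?thesis by induction (use assms in auto)
qed

lemma closed_faces_iff:
  "closed_faces U \<Longrightarrow> face_step M d \<in> U \<longleftrightarrow> d \<in> U"
  unfolding closed_faces_def by (metis face_step_in_iff face_triangle subsetD)

text \<open>On a face boundary \<open>opp M d\<close> is followed by \<open>rot M d\<close>. So
  membership changes from \<open>d\<close> to \<open>rot M d\<close> exactly if the two sides of the
  edge of \<open>d\<close> differ.\<close>

lemma closed_faces_rot: "closed_faces U \<Longrightarrow> rot M d \<in> U \<longleftrightarrow> opp M d \<in> U"
  using closed_faces_iff[of U "opp M d"] by (simp add: face_step_opp)

lemma closed_faces_darts: "closed_faces (darts M)"
  by (simp add: closed_faces_def)

lemma closed_faces_Diff: "closed_faces U \<Longrightarrow> closed_faces W \<Longrightarrow> closed_faces (U - W)"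
  using closed_faces_iff[of W] by (auto simp: closed_faces_def)

lemma closed_faces_Int: "closed_faces U \<Longrightarrow> closed_faces W \<Longrightarrow> closed_faces (U \<inter> W)"
  by (auto simp: closed_faces_def)

lemma closed_faces_face: "d \<in> darts M \<Longrightarrow> closed_faces (face M d)"
  by (auto simp: closed_faces_def face_eq face_triangle)

lemma face_subset: "closed_faces U \<Longrightarrow> d \<in> U \<Longrightarrow> face M d \<subseteq> U"
  by (auto simp: closed_faces_def face_eq subset_iff)

text \<open>Connectedness of the dual graph. Closure under \<open>face_step\<close> and
  \<open>opp\<close> implies closure under \<open>rot\<close>, so the tails of \<open>U\<close> form
  a set of vertices without outgoing edges.\<close>

lemma closed_faces_opp_trivial:
  assumes U: "closed_faces U" and opp: "\<And>d. d \<in> darts M \<Longrightarrow> opp M d \<in> U \<longleftrightarrow> d \<in> U"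
  shows "U = {} \<or> U = darts M"
proof (rule disjCI)
  assume "U \<noteq> darts M"
  show "U = {}"
  proof (rule ccontr)
    assume ne: "U \<noteq> {}"
    have sub: "U \<subseteq> darts M" using U by (simp add: closed_faces_def)
    have all: "e \<in> U" if "d \<in> U" "e \<in> darts M" "src M e = src M d" for d e
      by (rule closed_rot_out[of U d]) (use that closed_faces_rot[OF U] opp sub in auto)
    have "src M ` U = vs M"
    proof (rule connected)
      show "src M ` U \<subseteq> vs M" using sub src_in by auto
      show "src M ` U \<noteq> {}" using ne by auto
      fix d assume d: "d \<in> darts M" "src M d \<in> src M ` U"
      then have "opp M d \<in> U" using all opp by (metis imageE)
      then show "dst M d \<in> src M ` U" using src_opp[OF d(1)] by force
    qed
    then have "darts M \<subseteq> U" using all src_in by (metis imageE subsetI)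
    then show False using \<open>U \<noteq> darts M\<close> sub by blast
  qed
qed

section \<open>The mod 2 chain complex of a region\<close>

definition edge :: "'b \<Rightarrow> 'b set" where
  "edge d = {d, opp M d}"

text \<open>Edges on the border of \<open>R\<close> are left out, so parity can be tested only at
  vertices all of whose edges are inner.\<close>

definition inner_edges :: "'b set \<Rightarrow> 'b set set" where
  "inner_edges R = edge ` {d \<in> R. opp M d \<in> R}"

definition inner_faces :: "'b set \<Rightarrow> 'b set set" where
  "inner_faces R = {F \<in> faces M. F \<subseteq> R}"

text \<open>The boundary map from faces to edges, mod 2.\<close>

definition bd :: "'b set \<Rightarrow> 'b set set \<Rightarrow> 'b set set" where
  "bd R T = {e \<in> inner_edges R. \<exists>d \<in> e. d \<in> \<Union>T \<and> opp M d \<notin> \<Union>T}"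

text \<open>The boundary map from edges to vertices, mod 2, restricted to \<open>I\<close>.\<close>

definition odd_vertices :: "'a set \<Rightarrow> 'b set set \<Rightarrow> 'a set" where
  "odd_vertices I X = {v \<in> I. odd (card {d \<in> out v. edge d \<in> X})}"

lemma edge_eq_iff: "edge d = edge e \<longleftrightarrow> d = e \<or> d = opp M e"
  unfolding edge_def by (metis doubleton_eq_iff opp_opp)

lemma edge_in_inner: "R \<subseteq> darts M \<Longrightarrow> edge d \<in> inner_edges R \<longleftrightarrow> d \<in> R \<and> opp M d \<in> R"
  by (auto simp: inner_edges_def edge_eq_iff)

lemma finite_inner_edges: "R \<subseteq> darts M \<Longrightarrow> finite (inner_edges R)"
  using finite_darts finite_subset[of R] by (simp add: inner_edges_def)

lemma finite_inner_faces: "finite (inner_faces R)"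
  using finite_darts by (simp add: inner_faces_def faces_def)

lemma card_inner_edges:
  assumes "R \<subseteq> darts M"
  shows "2 * card (inner_edges R) = card {d \<in> R. opp M d \<in> R}"
proof -
  have "2 * card (inner_edges R) = card (\<Union>(inner_edges R))"
  proof (rule card_partition)
    show "finite (inner_edges R)" by (rule finite_inner_edges[OF assms])
    then show "finite (\<Union>(inner_edges R))" by (auto simp: inner_edges_def edge_def)
    show "card e = 2" if "e \<in> inner_edges R" for e
      using that assms opp_neq by (auto simp: inner_edges_def edge_def card_2_iff)
    show "e1 \<inter> e2 = {}" if "e1 \<in> inner_edges R" "e2 \<in> inner_edges R" "e1 \<noteq> e2" for e1 e2
      using that by (auto simp: inner_edges_def edge_def)
  qed
  moreover have "\<Union>(inner_edges R) = {d \<in> R. opp M d \<in> R}"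
    by (auto simp: inner_edges_def edge_def)
  ultimately show ?thesis by simp
qed

lemma faces_disjoint: "F \<in> faces M \<Longrightarrow> F' \<in> faces M \<Longrightarrow> x \<in> F \<Longrightarrow> x \<in> F' \<Longrightarrow> F = F'"
  unfolding faces_def using face_eqI by blast

lemma in_face_self: "d \<in> face M d" if "d \<in> darts M"
  using that by (simp add: face_eq)

lemma face_nonempty: "F \<in> faces M \<Longrightarrow> \<exists>d. d \<in> F"
  using in_face_self by (auto simp: faces_def)

lemma Union_inner_faces:
  assumes "closed_faces R"
  shows "\<Union>(inner_faces R) = R"
proof
  show "R \<subseteq> \<Union>(inner_faces R)"
  proof
    fix d assume d: "d \<in> R"
    then have "d \<in> darts M" using assms by (auto simp: closed_faces_def)
    then have "face M d \<in> inner_faces R" "d \<in> face M d"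
      using face_subset[OF assms d] in_face_self by (auto simp: inner_faces_def faces_def)
    then show "d \<in> \<Union>(inner_faces R)" by blast
  qed
qed (auto simp: inner_faces_def)

lemma card_inner_faces:
  assumes "closed_faces R"
  shows "3 * card (inner_faces R) = card R"
proof -
  have "3 * card (inner_faces R) = card (\<Union>(inner_faces R))"
  proof (rule card_partition)
    show "finite (inner_faces R)" by (rule finite_inner_faces)
    show "finite (\<Union>(inner_faces R))"
      using finite_closed_faces[OF assms] Union_inner_faces[OF assms] by simp
    show "card F = 3" if "F \<in> inner_faces R" for F
      using that card_face by (simp add: inner_faces_def)
    show "F \<inter> F' = {}" if "F \<in> inner_faces R" "F' \<in> inner_faces R" "F \<noteq> F'" for F F'
      using that faces_disjoint by (auto simp: inner_faces_def)
  qed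
  then show ?thesis using Union_inner_faces[OF assms] by simp
qed

lemma closed_faces_Union:
  assumes "T \<subseteq> faces M"
  shows "closed_faces (\<Union>T)"
proof -
  have "closed_faces F" if "F \<in> T" for F
    using that assms closed_faces_face by (auto simp: faces_def)
  then show ?thesis unfolding closed_faces_def by blast
qed

lemma edge_in_bd:
  assumes "R \<subseteq> darts M"
  shows "edge d \<in> bd R T \<longleftrightarrow> d \<in> R \<and> opp M d \<in> R \<and> (d \<in> \<Union>T) \<noteq> (opp M d \<in> \<Union>T)"
proof -
  have "(\<exists>c \<in> edge d. c \<in> \<Union>T \<and> opp M c \<notin> \<Union>T) \<longleftrightarrow> (d \<in> \<Union>T) \<noteq> (opp M d \<in> \<Union>T)"
    by (auto simp: edge_def)
  then show ?thesis unfolding bd_def using edge_in_inner[OF assms] by simp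
qed

text \<open>Linearity rests on the disjointness of faces: a dart lies in at most one face, so
  membership in the union is additive mod 2.\<close>

lemma bd_sym_diff:
  assumes R: "R \<subseteq> darts M" and T: "T \<subseteq> faces M" "T' \<subseteq> faces M"
  shows "bd R (sym_diff T T') = sym_diff (bd R T) (bd R T')"
proof -
  have disj: "F = F'" if "F \<in> T \<union> T'" "F' \<in> T \<union> T'" "x \<in> F" "x \<in> F'" for F F' x
    using that T faces_disjoint[of F F' x] by blast
  have U: "x \<in> \<Union>(sym_diff T T') \<longleftrightarrow> (x \<in> \<Union>T) \<noteq> (x \<in> \<Union>T')" for x
  proof (cases "x \<in> \<Union>(T \<union> T')")
    case True
    then obtain F where F: "F \<in> T \<union> T'" "x \<in> F" by blast
    have mem: "x \<in> \<Union>W \<longleftrightarrow> F \<in> W" if "W \<subseteq> T \<union> T'" for W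
    proof
      assume "x \<in> \<Union>W"
      then obtain F' where "F' \<in> W" "x \<in> F'" by blast
      then show "F \<in> W" using disj[of F F' x] F that by blast
    qed (use F in blast)
    have "x \<in> \<Union>T \<longleftrightarrow> F \<in> T" "x \<in> \<Union>T' \<longleftrightarrow> F \<in> T'"
      "x \<in> \<Union>(sym_diff T T') \<longleftrightarrow> F \<in> sym_diff T T'" by (rule mem; blast)+
    then show ?thesis by (simp only: Un_iff Diff_iff) argo
  qed auto
  show ?thesis
  proof (rule set_eqI)
    fix e
    show "e \<in> bd R (sym_diff T T') \<longleftrightarrow> e \<in> sym_diff (bd R T) (bd R T')"
    proof (cases "e \<in> inner_edges R")
      case True
      then obtain d where e: "e = edge d" by (auto simp: inner_edges_def)
      show ?thesis unfolding e by (simp only: edge_in_bd[OF R] U Un_iff Diff_iff) argo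
    qed (auto simp: bd_def)
  qed
qed

lemma odd_vertices_sym_diff:
  "odd_vertices I (sym_diff X Y) = sym_diff (odd_vertices I X) (odd_vertices I Y)"
proof -
  have "{d \<in> out v. edge d \<in> sym_diff X Y} = sym_diff {d \<in> out v. edge d \<in> X} {d \<in> out v. edge d \<in> Y}" for v
    by auto
  moreover have "finite {d \<in> out v. edge d \<in> X}" for v and X :: "'b set set"
    by (rule finite_subset[OF _ finite_out[of v]]) auto
  ultimately have "odd (card {d \<in> out v. edge d \<in> sym_diff X Y}) \<longleftrightarrow>
      odd (card {d \<in> out v. edge d \<in> X}) \<noteq> odd (card {d \<in> out v. edge d \<in> Y})" for v
    by (simp only: odd_card_sym_diff)
  then show ?thesis unfolding odd_vertices_def by auto
qed

text \<open>The boundary of a boundary is zero.\<close>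

lemma even_bd:
  assumes "closed_faces U"
  shows "even (card {d \<in> out v. (d \<in> U) \<noteq> (opp M d \<in> U)})"
proof -
  have "{d \<in> out v. (d \<in> U) \<noteq> (opp M d \<in> U)} = {d \<in> out v. (d \<in> U) \<noteq> (rot M d \<in> U)}"
    using closed_faces_rot[OF assms] by simp
  then show ?thesis using even_card_changes[OF finite_out rot_image_out, of v "\<lambda>d. d \<in> U"] by simp
qed

lemma odd_vertices_edge:
  assumes d: "d \<in> darts M"
  shows "odd_vertices I {edge d} = {src M d, dst M d} \<inter> I"
proof -
  have "{c \<in> out v. edge c \<in> {edge d}} =
      (if v = src M d then {d} else if v = dst M d then {opp M d} else {})" for v
    using d src_opp[OF d] no_loop[OF d] by (auto simp: edge_eq_iff)
  then have "card {c \<in> out v. edge c \<in> {edge d}} = (if v \<in> {src M d, dst M d} then 1 else 0)" for v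
    by simp
  then show ?thesis unfolding odd_vertices_def by auto
qed

text \<open>A path from a vertex of \<open>I\<close> to a vertex outside \<open>I\<close> has only
  its first vertex as an odd vertex in \<open>I\<close>, and such singletons generate all subsets.
  Hence \<open>I\<close> must be a proper subset.\<close>

lemma odd_vertices_surj:
  assumes I: "I \<subset> vs M" and R: "R \<subseteq> darts M"
    and inc: "\<And>d. d \<in> darts M \<Longrightarrow> src M d \<in> I \<Longrightarrow> d \<in> R \<and> opp M d \<in> R"
  shows "odd_vertices I ` Pow (inner_edges R) = Pow I"
proof
  show "odd_vertices I ` Pow (inner_edges R) \<subseteq> Pow I" by (auto simp: odd_vertices_def)
  define reach where "reach Y \<longleftrightarrow> (\<exists>X \<subseteq> inner_edges R. odd_vertices I X = Y)" for Y
  have reach_sym_diff: "reach (sym_diff Y Z)" if YZ: "reach Y" "reach Z" for Y Z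
  proof -
    obtain X X' where "X \<subseteq> inner_edges R" "odd_vertices I X = Y" "X' \<subseteq> inner_edges R" "odd_vertices I X' = Z"
      using YZ unfolding reach_def by blast
    then have "odd_vertices I (sym_diff X X') = sym_diff Y Z" "sym_diff X X' \<subseteq> inner_edges R"
      unfolding odd_vertices_sym_diff by auto
    then show ?thesis unfolding reach_def by blast
  qed
  have single: "reach {v}" if v: "v \<in> I" for v
  proof -
    \<comment> \<open>The path is replaced by a set closed under adjacency, to which the axiom
      \<open>connected\<close> applies; it is nonempty because of the vertices outside
      \<open>I\<close>.\<close>
    define W where "W = {v \<in> vs M. v \<notin> I \<or> reach {v}}"
    have "W = vs M"
    proof (rule connected)
      show "W \<subseteq> vs M" "W \<noteq> {}" using I by (auto simp: W_def)
      fix d assume d: "d \<in> darts M" "src M d \<in> W"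
      show "dst M d \<in> W"
      proof (cases "dst M d \<in> I")
        case True
        have "edge d \<in> inner_edges R"
          using inc[of "opp M d"] d True by (simp add: edge_in_inner[OF R] src_opp)
        then have e: "reach ({src M d, dst M d} \<inter> I)"
          unfolding reach_def using odd_vertices_edge[OF d(1), of I] by (intro exI[of _ "{edge d}"]) simp
        have "reach {dst M d}"
        proof (cases "src M d \<in> I")
          case False
          then show ?thesis using e True by simp
        next
          case u: True
          then have "reach {src M d}" using d(2) by (simp add: W_def)
          from reach_sym_diff[OF this e] show ?thesis using u True no_loop[OF d(1)] by (simp add: insert_Diff_if)
        qed
        then show ?thesis using dst_in[OF d(1)] by (simp add: W_def)
      qed (use dst_in[OF d(1)] in \<open>simp add: W_def\<close>)
    qed
    then show ?thesis using v I by (auto simp: W_def)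
  qed
  have all: "reach Y" if "finite Y" "Y \<subseteq> I" for Y
    using that
  proof (induction Y rule: finite_induct)
    case empty
    then show ?case unfolding reach_def by (intro exI[of _ "{}"]) (simp add: odd_vertices_def)
  next
    case (insert v Y)
    then have "reach (sym_diff Y {v})" using single by (intro reach_sym_diff) auto
    moreover have "sym_diff Y {v} = insert v Y" using insert.hyps by auto
    ultimately show ?case by simp
  qed
  have fin: "finite I" using I finite_vs by (meson finite_subset psubset_imp_subset)
  show "Pow I \<subseteq> odd_vertices I ` Pow (inner_edges R)"
  proof
    fix Y assume "Y \<in> Pow I"
    then have "reach Y" using all fin finite_subset[of Y I] by simp
    then show "Y \<in> odd_vertices I ` Pow (inner_edges R)" unfolding reach_def by auto
  qed
qed

section \<open>Dimension count, applied to the whole graph without one vertex and to one side of a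
  triangle\<close>

context
  fixes R :: "'b set" and I :: "'a set"
  assumes R: "closed_faces R" and I: "I \<subset> vs M"
    and inc: "\<And>d. d \<in> darts M \<Longrightarrow> src M d \<in> I \<Longrightarrow> d \<in> R"
    and dual_connected: "\<And>U. closed_faces U \<Longrightarrow> U \<subseteq> R \<Longrightarrow>
       (\<And>d. d \<in> R \<Longrightarrow> opp M d \<in> R \<Longrightarrow> d \<in> U \<longleftrightarrow> opp M d \<in> U) \<Longrightarrow> U = {} \<or> U = R"
begin

lemma region_darts: "R \<subseteq> darts M"
  using R by (simp add: closed_faces_def)

lemma incident_inner: "d \<in> darts M \<Longrightarrow> src M d \<in> I \<Longrightarrow> d \<in> R \<and> opp M d \<in> R"
  using inc[of d] inc[of "rot M d"] closed_faces_rot[OF R] by simp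

text \<open>
  The hypothesis \<open>dual_connected\<close> says that the kernel of \<open>bd R\<close> has at most two elements, so there are at
  least \<open>2 ^ (f - 1)\<close> boundaries among the \<open>2 ^ (e - \<bar>I\<bar>)\<close> edge sets which are even on \<open>I\<close>.
\<close>

lemma bd_image_subset:
  "bd R ` Pow (inner_faces R) \<subseteq> {X. X \<subseteq> inner_edges R \<and> odd_vertices I X = {}}"
proof -
  have "odd_vertices I (bd R T) = {}" if T: "T \<subseteq> inner_faces R" for T
  proof -
    have U: "closed_faces (\<Union>T)" using T by (intro closed_faces_Union) (auto simp: inner_faces_def)
    have "{d \<in> out v. edge d \<in> bd R T} = {d \<in> out v. (d \<in> \<Union>T) \<noteq> (opp M d \<in> \<Union>T)}" if "v \<in> I" for v
      using incident_inner that by (auto simp: edge_in_bd[OF region_darts])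
    then show ?thesis using even_bd[OF U] unfolding odd_vertices_def by auto
  qed
  then show ?thesis by (auto simp: bd_def)
qed

lemma bd_image_card: "2 ^ card (inner_faces R) \<le> 2 * card (bd R ` Pow (inner_faces R))"
proof -
  have "{T. T \<subseteq> inner_faces R \<and> bd R T = {}} \<subseteq> {{}, inner_faces R}"
  proof
    fix T assume "T \<in> {T. T \<subseteq> inner_faces R \<and> bd R T = {}}"
    then have T: "T \<subseteq> inner_faces R" "bd R T = {}" by auto
    have U: "closed_faces (\<Union>T)" using T by (intro closed_faces_Union) (auto simp: inner_faces_def)
    have TR: "\<Union>T \<subseteq> R" using T(1) by (auto simp: inner_faces_def)
    have "\<Union>T = {} \<or> \<Union>T = R"
    proof (rule dual_connected[OF U TR])
      fix d assume "d \<in> R" "opp M d \<in> R"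
      moreover have "edge d \<notin> bd R T" using T(2) by simp
      ultimately show "d \<in> \<Union>T \<longleftrightarrow> opp M d \<in> \<Union>T" unfolding edge_in_bd[OF region_darts] by blast
    qed
    then show "T \<in> {{}, inner_faces R}"
    proof
      assume "\<Union>T = {}"
      have "T = {}"
      proof (rule ccontr)
        assume "T \<noteq> {}"
        then obtain F where F: "F \<in> T" by auto
        then obtain d where "d \<in> F" using face_nonempty[of F] T(1) by (auto simp: inner_faces_def)
        then show False using F \<open>\<Union>T = {}\<close> by auto
      qed
      then show ?thesis by simp
    next
      assume eq: "\<Union>T = R"
      have "inner_faces R \<subseteq> T"
      proof
        fix F assume F: "F \<in> inner_faces R"
        then obtain d where d: "d \<in> F" using face_nonempty[of F] by (auto simp: inner_faces_def)
        then have "d \<in> \<Union>T" unfolding eq using F by (auto simp: inner_faces_def)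
        then obtain F' where F': "F' \<in> T" "d \<in> F'" by blast
        have "F \<in> faces M" "F' \<in> faces M" using F F'(1) T(1) by (auto simp: inner_faces_def)
        then have "F = F'" using d F'(2) by (rule faces_disjoint)
        then show "F \<in> T" using F'(1) by simp
      qed
      then show ?thesis using T(1) by auto
    qed
  qed
  then have "card {T. T \<subseteq> inner_faces R \<and> bd R T = {}} \<le> card {{}, inner_faces R}"
    by (rule card_mono[rotated]) simp
  also have "\<dots> \<le> 2" by (simp add: card_insert_if)
  finally have "card {T. T \<subseteq> inner_faces R \<and> bd R T = {}} * card (bd R ` Pow (inner_faces R))
      \<le> 2 * card (bd R ` Pow (inner_faces R))" by (rule mult_le_mono1)
  moreover have "card {T. T \<subseteq> inner_faces R \<and> bd R T = {}} * card (bd R ` Pow (inner_faces R))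
      = 2 ^ card (inner_faces R)"
  proof (rule card_kernel_times_image[OF finite_inner_faces])
    fix T T' assume "T \<subseteq> inner_faces R" "T' \<subseteq> inner_faces R"
    then have "T \<subseteq> faces M" "T' \<subseteq> faces M" by (auto simp: inner_faces_def)
    then show "bd R (sym_diff T T') = sym_diff (bd R T) (bd R T')" by (rule bd_sym_diff[OF region_darts])
  qed
  ultimately show ?thesis by simp
qed

lemma even_sets_card:
  "card {X. X \<subseteq> inner_edges R \<and> odd_vertices I X = {}} * 2 ^ card I = 2 ^ card (inner_edges R)"
proof -
  have "finite I" by (rule finite_subset[OF psubset_imp_subset[OF I] finite_vs])
  moreover have "odd_vertices I ` Pow (inner_edges R) = Pow I"
    by (rule odd_vertices_surj[OF I region_darts]) (rule incident_inner)
  ultimately have "card (odd_vertices I ` Pow (inner_edges R)) = 2 ^ card I"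
    by (simp only: card_Pow)
  then show ?thesis
    using card_kernel_times_image[of "inner_edges R" "odd_vertices I", OF finite_inner_edges[OF region_darts] odd_vertices_sym_diff]
    by simp
qed

text \<open>Boundaries are even sets, so the exponents satisfy f - 1 <= e - |I|.\<close>

lemma inner_euler_le: "card (inner_faces R) + card I \<le> card (inner_edges R) + 1"
proof -
  have "finite {X. X \<subseteq> inner_edges R \<and> odd_vertices I X = {}}"
    using finite_inner_edges[OF region_darts] by simp
  from card_mono[OF this bd_image_subset]
  have "2 ^ card (inner_faces R) \<le> 2 * card {X. X \<subseteq> inner_edges R \<and> odd_vertices I X = {}}"
    using bd_image_card by linarith
  then have "2 ^ card (inner_faces R) * 2 ^ card I \<le>
      2 * (card {X. X \<subseteq> inner_edges R \<and> odd_vertices I X = {}} * 2 ^ card I)" by simp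
  then have "(2::nat) ^ (card (inner_faces R) + card I) \<le> 2 ^ (card (inner_edges R) + 1)"
    unfolding even_sets_card by (simp add: power_add)
  then show ?thesis by (rule power_le_imp_le_exp[rotated]) simp
qed

text \<open>In case of equality there are as many boundaries as even sets, so they coincide.\<close>

lemma even_set_is_boundary:
  assumes eq: "card (inner_faces R) + card I = card (inner_edges R) + 1"
    and X: "X \<subseteq> inner_edges R" "odd_vertices I X = {}"
  obtains T where "T \<subseteq> inner_faces R" "bd R T = X"
proof -
  let ?Z = "{X. X \<subseteq> inner_edges R \<and> odd_vertices I X = {}}"
  have "2 * card ?Z * 2 ^ card I = 2 ^ (card (inner_faces R) + card I)"
    unfolding eq using even_sets_card by simp
  then have "2 * card ?Z = 2 ^ card (inner_faces R)" by (simp add: power_add)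
  then have "card ?Z \<le> card (bd R ` Pow (inner_faces R))" using bd_image_card by simp
  then have "bd R ` Pow (inner_faces R) = ?Z"
    using bd_image_subset finite_inner_edges[OF region_darts] by (intro card_seteq) auto
  then have "X \<in> bd R ` Pow (inner_faces R)" using X by simp
  then show thesis using that by auto
qed

end

text \<open>The combinatorial Jordan curve theorem. \<open>C\<close> marks an edge set with even
  degrees, and \<open>S\<close> is one of the two parts into which it divides the faces.\<close>

lemma even_darts_bound_region:
  assumes C: "\<And>d. d \<in> darts M \<Longrightarrow> C (opp M d) \<longleftrightarrow> C d"
    and even: "\<And>v. v \<in> vs M \<Longrightarrow> even (card {d \<in> out v. C d})"
  obtains S where "closed_faces S" "\<And>d. d \<in> darts M \<Longrightarrow> (d \<in> S) \<noteq> (opp M d \<in> S) \<longleftrightarrow> C d"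
proof -
  obtain v0 where v0: "v0 \<in> vs M" using vs_nonempty by auto
  \<comment> \<open>One vertex is dropped because the number of odd vertices is always even. With
    |V| - 1 vertices Euler's formula is exactly the equality required by
    \<open>even_set_is_boundary\<close>.\<close>
  let ?I = "vs M - {v0}"
  have I: "?I \<subset> vs M" using v0 by auto
  have dc: "U = {} \<or> U = darts M" if "closed_faces U" "U \<subseteq> darts M"
     "\<And>d. d \<in> darts M \<Longrightarrow> opp M d \<in> darts M \<Longrightarrow> d \<in> U \<longleftrightarrow> opp M d \<in> U" for U
    by (rule closed_faces_opp_trivial[OF that(1)]) (use that(3) opp_in in blast)
  have card: "card (inner_faces (darts M)) + card ?I = card (inner_edges (darts M)) + 1"
  proof -
    have "{d \<in> darts M. opp M d \<in> darts M} = darts M" by auto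
    then have "2 * card (inner_edges (darts M)) = card (darts M)" using card_inner_edges[of "darts M"] by simp
    moreover have "card ?I + 1 = card (vs M)" using card.remove[OF finite_vs v0] by simp
    ultimately show ?thesis using card_inner_faces[OF closed_faces_darts] euler6 by linarith
  qed
  let ?X = "edge ` {d \<in> darts M. C d}"
  have X: "edge d \<in> ?X \<longleftrightarrow> C d" if d: "d \<in> darts M" for d
  proof
    assume "edge d \<in> ?X"
    then obtain e where "e \<in> darts M" "C e" "edge d = edge e" by auto
    then show "C d" using C by (auto simp: edge_eq_iff)
  qed (use d in auto)
  have "{d \<in> out v. edge d \<in> ?X} = {d \<in> out v. C d}" for v
    by (rule Collect_cong) (use X in \<open>auto simp del: image_iff\<close>)
  then have odd: "odd_vertices ?I ?X = {}" using even unfolding odd_vertices_def by simp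
  have inner: "?X \<subseteq> inner_edges (darts M)" by (auto simp: inner_edges_def)
  have "\<exists>T. T \<subseteq> inner_faces (darts M) \<and> bd (darts M) T = ?X"
  proof (rule even_set_is_boundary[OF closed_faces_darts I _ dc card inner odd])
    fix T assume "T \<subseteq> inner_faces (darts M)" "bd (darts M) T = ?X"
    then show ?thesis by blast
  qed
  then obtain T where T: "T \<subseteq> inner_faces (darts M)" "bd (darts M) T = ?X" by blast
  show thesis
  proof
    show "closed_faces (\<Union>T)" using T(1) by (intro closed_faces_Union) (auto simp: inner_faces_def)
    fix d assume d: "d \<in> darts M"
    then show "(d \<in> \<Union>T) \<noteq> (opp M d \<in> \<Union>T) \<longleftrightarrow> C d"
      using edge_in_bd[of "darts M" d T] X[OF d] T(2) by simp
  qed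
qed

end

section \<open>Contracting an edge of a triangulation\<close>

text \<open>
  Contracting \<open>d\<close> keeps its head and removes its tail.  The two triangles at \<open>d\<close> become digons, of
  which the edges at the head survive.  As \<open>swp\<close> exchanges the sides of these edges that lie in the two
  triangles with the outer sides of the removed ones, the new face permutation is the old one
  conjugated by \<open>swp\<close>.
\<close>

definition contract :: "('a, 'b) embedded_graph \<Rightarrow> 'b \<Rightarrow> ('a, 'b) embedded_graph" where
  "contract M d =
    (let a = face_step M d; p' = face_step M a;
         q = face_step M (opp M d); g = face_step M q;
         D = darts M - {d, opp M d, opp M p', p', q, opp M q};
         swp = transpose (opp M p') a \<circ> transpose (opp M q) g;
         proj = (\<lambda>v. if v = src M d then dst M d else v)
     in \<lparr> skel = \<lparr> verts = vs M - {src M d}, arcs = D,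
                   tail = \<lambda>e. proj (src M e), head = \<lambda>e. proj (dst M e) \<rparr>,
          opp = \<lambda>e. if e \<in> D then opp M e else e,
          rot = \<lambda>e. if e \<in> D then swp (face_step M (swp (opp M e))) else e \<rparr>)"

lemma successively_cong_butlast:
  "successively (\<lambda>x y. f x = y) xs \<Longrightarrow> (\<And>x. x \<in> set (butlast xs) \<Longrightarrow> g x = f x) \<Longrightarrow>
   successively (\<lambda>x y. g x = y) xs"
  by (induction xs rule: induct_list012) auto

lemma distinct_butlast_neq_last: "distinct xs \<Longrightarrow> x \<in> set (butlast xs) \<Longrightarrow> x \<noteq> last xs"
  by (induction xs) auto

lemma (in triangulation) rot_neq: "src M e \<noteq> src M f \<Longrightarrow> rot M e \<noteq> f"
  by auto

text \<open>\<open>unique\<close> keeps other edges from becoming loops, and \<open>corners\<close>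
  keeps the two collapsing triangles apart. Parallel edges may arise, so the result is a
  \<open>triangulation\<close> which need not be simple.\<close>

locale contraction = triangulation +
  fixes d
  assumes d: "d \<in> darts M"
    and corners: "distinct [src M d, dst M d, dst M (face_step M d), dst M (face_step M (opp M d))]"
    and unique: "\<And>e. e \<in> darts M \<Longrightarrow> src M e = src M d \<Longrightarrow> dst M e = dst M d \<Longrightarrow> e = d"
begin

definition "w = src M d"
definition "s = dst M d"
definition "x = dst M (face_step M d)"
definition "y = dst M (face_step M (opp M d))"
definition "d' = opp M d"
definition "a = face_step M d"
definition "p' = face_step M a"
definition "p = opp M p'"
definition "q = face_step M d'"
definition "g = face_step M q"
definition "q' = opp M q"
definition "r = opp M g"
definition "X = {d, d', p, p', q, q'}"
definition "swp = transpose p a \<circ> transpose q' g"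

lemma in_darts: "d \<in> darts M" "d' \<in> darts M" "a \<in> darts M" "p' \<in> darts M" "p \<in> darts M"
  "q \<in> darts M" "g \<in> darts M" "q' \<in> darts M" "r \<in> darts M"
  using d by (simp_all add: d'_def a_def p'_def p_def q_def g_def q'_def r_def)

lemma ends:
  "src M d = w" "dst M d = s" "src M d' = s" "dst M d' = w" "src M a = s" "dst M a = x"
  "src M p' = x" "dst M p' = w" "src M p = w" "dst M p = x" "src M q = w" "dst M q = y"
  "src M g = y" "dst M g = s" "src M q' = y" "dst M q' = w" "src M r = s" "dst M r = y"
  "src M (opp M a) = x" "dst M (opp M a) = s"
proof -
  show 1: "src M d = w" "dst M d = s" by (simp_all add: w_def s_def)
  show 2: "src M d' = s" "dst M d' = w" using d by (simp_all add: w_def s_def d'_def src_opp dst_opp)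
  show 3: "src M a = s" "dst M a = x" using d by (simp_all add: a_def s_def x_def src_face_step)
  show 4: "src M p' = x" using in_darts 3 by (simp add: p'_def src_face_step)
  show 5: "dst M p' = w" using d 1 dst_face_step2[OF d] by (simp add: p'_def a_def)
  show 6: "src M p = w" "dst M p = x" using in_darts 4 5 by (simp_all add: p_def src_opp dst_opp)
  show 7: "src M q = w" "dst M q = y" using in_darts 2 by (simp_all add: q_def src_face_step y_def d'_def)
  show 8: "src M g = y" using in_darts 7 by (simp add: g_def src_face_step)
  show 9: "dst M g = s" using in_darts 2 dst_face_step2[of d'] by (simp add: g_def q_def)
  show "src M q' = y" "dst M q' = w" using in_darts 7 by (simp_all add: q'_def src_opp dst_opp)
  show "src M r = s" "dst M r = y" using in_darts 8 9 by (simp_all add: r_def src_opp dst_opp)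
  show "src M (opp M a) = x" "dst M (opp M a) = s" using in_darts 3 by (simp_all add: src_opp dst_opp)
qed

lemma neq: "w \<noteq> s" "w \<noteq> x" "w \<noteq> y" "s \<noteq> x" "s \<noteq> y" "x \<noteq> y"
  using corners by (auto simp: w_def s_def x_def y_def)

lemmas neqs = neq neq[symmetric]

lemma rots: "rot M d' = a" "rot M (opp M a) = p'" "rot M p = d" "rot M d = q" "rot M q' = g" "rot M r = d'"
proof -
  show "rot M d' = a" "rot M d = q" "rot M (opp M a) = p'" "rot M q' = g"
    by (simp_all add: d'_def a_def q_def face_step_def p'_def q'_def g_def)
  have "rot M p = face_step M p'" "rot M r = face_step M g" by (simp_all add: p_def r_def face_step_def)
  then show "rot M p = d" "rot M r = d'"
    using face_triangle[OF d] face_triangle[OF in_darts(2)] by (simp_all add: p'_def a_def g_def q_def)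
qed

lemma opps: "opp M d = d'" "opp M d' = d" "opp M p = p'" "opp M p' = p" "opp M q = q'" "opp M q' = q"
  "opp M g = r" "opp M r = g"
  by (simp_all add: d'_def p_def q'_def r_def)

lemma distinct_darts: "distinct [d, d', p, p', q, q', a, g, r, opp M a]"
  using ends neqs by (auto)

lemma X_sub: "X \<subseteq> darts M"
  using in_darts by (auto simp: X_def)

lemma card_X: "card X = 6"
  using distinct_darts by (simp add: X_def)

lemma opp_X: "opp M e \<in> X \<longleftrightarrow> e \<in> X"
proof -
  have "opp M ` X \<subseteq> X" by (auto simp: X_def opps)
  then show ?thesis by (metis image_subset_iff opp_opp)
qed

lemma swp_simps [simp]: "swp p = a" "swp a = p" "swp q' = g" "swp g = q'"
  using distinct_darts by (auto simp: swp_def transpose_def)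

lemma swp_other: "e \<noteq> p \<Longrightarrow> e \<noteq> a \<Longrightarrow> e \<noteq> q' \<Longrightarrow> e \<noteq> g \<Longrightarrow> swp e = e"
  by (simp add: swp_def transpose_def)

lemma swp_swp [simp]: "swp (swp e) = e"
  by (cases "e \<in> {p, a, q', g}") (auto simp: swp_other)

lemma swp_inj [simp]: "swp e = swp f \<longleftrightarrow> e = f"
  by (metis swp_swp)

lemma swp_in_iff [simp]: "swp e \<in> darts M \<longleftrightarrow> e \<in> darts M"
  by (cases "e \<in> {p, a, q', g}") (auto simp: swp_other in_darts)

definition "F = {d, a, p', d', q, g}"

lemma face_step_F: "face_step M e \<in> F \<longleftrightarrow> e \<in> F"
proof -
  have "face_step M p' = d" "face_step M g = d'"
    using face_triangle[OF d] face_triangle[of d'] in_darts by (simp_all add: p'_def a_def g_def q_def)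
  then have 1: "e \<in> F \<Longrightarrow> face_step M e \<in> F" for e
    by (auto simp: F_def a_def p'_def q_def g_def)
  show ?thesis
  proof (cases "e \<in> darts M")
    case True
    then show ?thesis using 1[of e] 1[of "face_step M e"] 1[of "face_step M (face_step M e)"]
      by (auto simp: face_triangle)
  next
    case False
    moreover have "F \<subseteq> darts M" using in_darts by (auto simp: F_def)
    ultimately show ?thesis by (metis face_step_in_iff subsetD)
  qed
qed

text \<open>This makes the conjugation work: \<open>swp\<close> carries the six removed darts to the
  six darts of the two vanishing triangles. The latter form a union of faces, so the conjugated
  permutation preserves the surviving darts.\<close>

lemma swp_F: "swp e \<in> F \<longleftrightarrow> e \<in> X"
proof (cases "e \<in> {p, a, q', g}")
  case True
  then show ?thesis using distinct_darts by (auto simp: F_def X_def)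
next
  case False
  then show ?thesis using swp_other[of e] by (auto simp: F_def X_def)
qed

abbreviation "N \<equiv> contract M d"
definition "D' = darts M - X"
definition "proj v = (if v = w then s else v)"

lemma contract_simps:
  "vs N = vs M - {w}" "darts N = D'" "src N e = proj (src M e)" "dst N e = proj (dst M e)"
  "opp N e = (if e \<in> D' then opp M e else e)"
  "rot N e = (if e \<in> D' then swp (face_step M (swp (opp M e))) else e)"
proof -
  have D': "D' = darts M - {d, opp M d, opp M p', p', q, opp M q}"
    by (simp add: D'_def X_def d'_def p_def q'_def)
  show "vs N = vs M - {w}" by (simp add: contract_def Let_def w_def)
  show "darts N = D'" "src N e = proj (src M e)" "dst N e = proj (dst M e)"
    "opp N e = (if e \<in> D' then opp M e else e)"
    unfolding D'
    by (simp_all add: contract_def Let_def proj_def w_def s_def p'_def a_def q_def d'_def)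
  show "rot N e = (if e \<in> D' then swp (face_step M (swp (opp M e))) else e)"
    unfolding D' by (simp add: contract_def Let_def swp_def p_def p'_def a_def q'_def g_def q_def d'_def)
qed

lemma D'_sub: "e \<in> D' \<Longrightarrow> e \<in> darts M"
  by (simp add: D'_def)

lemma opp_D' [simp]: "opp M e \<in> D' \<longleftrightarrow> e \<in> D'"
  by (simp add: D'_def opp_X)

lemma a_g_in: "a \<in> D'" "opp M a \<in> D'" "g \<in> D'" "r \<in> D'"
  using distinct_darts in_darts by (auto simp: D'_def X_def)

lemma face_step_D': "e \<in> D' \<Longrightarrow> swp (face_step M (swp e)) \<in> D'"
  unfolding D'_def using swp_F[of "swp (face_step M (swp e))"] swp_F[of e] face_step_F[of "swp e"] by simp

lemma face_step_contract: "e \<in> D' \<Longrightarrow> face_step N e = swp (face_step M (swp e))"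
  unfolding face_step_def[of N] contract_simps by simp

text \<open>\<open>z\<close> skips a removed successor: \<open>p'\<close> after
  \<open>opp M a\<close>, and \<open>d'\<close> after \<open>r\<close>, where the darts of
  \<open>w\<close> that follow \<open>q\<close> are inserted. Then the removed darts
  \<open>p\<close> and \<open>q'\<close> are replaced by \<open>a\<close> and \<open>g\<close>, to
  which they become parallel.\<close>

lemma rot_contract:
  assumes "e \<in> D'"
  shows "rot N e = (let z = (if e = opp M a then rot M p' else if e = r then rot M q else rot M e)
    in if z = p then a else if z = q' then g else z)"
proof -
  have e: "e \<noteq> d'" "e \<noteq> q'" "e \<noteq> p'" "e \<noteq> q" "e \<in> darts M" using assms by (auto simp: D'_def X_def)
  define z where "z = (if e = opp M a then rot M p' else if e = r then rot M q else rot M e)"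
  have "face_step M (swp (opp M e)) = z"
  proof (cases "opp M e \<in> {p, a, q', g}")
    case True
    then have "opp M e = a \<or> opp M e = g" using e by (metis empty_iff insert_iff opp_opp opps(3,6))
    then have "e = opp M a \<or> e = r" by (metis opp_opp r_def)
    then show ?thesis using distinct_darts unfolding z_def by (auto simp: opps face_step_def)
  next
    case False
    then have "e \<noteq> opp M a" "e \<noteq> r" using opps by auto
    then show ?thesis using False swp_other[of "opp M e"] unfolding z_def by (simp add: face_step_opp)
  qed
  moreover have "z \<noteq> a"
  proof -
    have "rot M p' \<noteq> a" "rot M q \<noteq> a" using rot_neq[of p'] rot_neq[of q] ends neqs by auto
    moreover have "rot M e \<noteq> a" using rots(1) e(1) rot_inj[of e d'] by simp
    ultimately show ?thesis by (simp add: z_def)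
  qed
  moreover have "z \<noteq> g"
  proof -
    have "rot M p' \<noteq> g" "rot M q \<noteq> g" using rot_neq[of p'] rot_neq[of q] ends neqs by auto
    moreover have "rot M e \<noteq> g" using rots(5) e(2) rot_inj[of e q'] by simp
    ultimately show ?thesis by (simp add: z_def)
  qed
  ultimately have "rot N e = (if z = p then a else if z = q' then g else z)"
    using assms by (auto simp: contract_simps swp_other)
  then show ?thesis by (simp add: z_def Let_def)
qed

lemma rot_contract_same:
  assumes "e \<in> D'" "e \<noteq> opp M a" "e \<noteq> r" "rot M e \<noteq> p" "rot M e \<noteq> q'"
  shows "rot N e = rot M e"
  unfolding rot_contract[OF assms(1)] using assms by (simp add: Let_def)

lemma out_contract: 
  "v \<noteq> s \<Longrightarrow> v \<in> vs N \<Longrightarrow> out_arcs (skel N) v = out v - X"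
  "out_arcs (skel N) s = (out s - {d'}) \<union> (out w - {d, p, q})"
proof -
  show "v \<noteq> s \<Longrightarrow> v \<in> vs N \<Longrightarrow> out_arcs (skel N) v = out v - X"
    by (auto simp: contract_simps proj_def D'_def)
  show "out_arcs (skel N) s = (out s - {d'}) \<union> (out w - {d, p, q})"
    using neqs ends by (auto simp: contract_simps proj_def D'_def X_def)
qed

lemma cyc_out:
  assumes "e \<in> darts M"
  obtains xs where "cyc (rot M) (e # xs)" "set (e # xs) = out (src M e)"
  by (rule cyclic_on_imp_cyc[OF rot_cyclic[OF src_in[OF assms]], of e]) (use assms that in \<open>auto simp: out_def\<close>)

text \<open>The rotation at \<open>w\<close> is cut open at \<open>d\<close>, loses \<open>p\<close>
  and \<open>q\<close>, and fills the gap that \<open>d'\<close> leaves at \<open>s\<close>. The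
  list \<open>A\<close> begins with \<open>a\<close> and ends with \<open>r\<close>.\<close>

lemma cyc_merged:
  assumes A: "cyc (rot M) (d' # A)" "set (d' # A) = out s"
    and B: "cyc (rot M) (d # q # B @ [p])" "set (d # q # B @ [p]) = out w"
  shows "cyc (rot N) (A @ B)" "set (A @ B) = out_arcs (skel N) s"
proof -
  have dA: "distinct (d' # A)" and dB: "distinct (d # q # B @ [p])" using A B by (auto simp: cyc_def)
  have "set A = out s - {d'}" using A(2) dA by auto
  moreover have "set B = out w - {d, p, q}" using B(2) dB by auto
  ultimately show set: "set (A @ B) = out_arcs (skel N) s" unfolding out_contract by simp
  have in_D': "e \<in> D'" if "e \<in> set A \<or> e \<in> set B" for e
    using that set contract_simps(2) by (auto dest!: equalityD1[THEN subsetD, of "set (A @ B)" _ e])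
  have srcA: "src M e = s" if "e \<in> set A" for e using that A(2) by auto
  have srcB: "src M e = w" if "e \<in> set B" for e using that B(2) by auto
  have "a \<in> set (d' # A)" unfolding A(2) using in_darts ends by simp
  then have Ane: "A \<noteq> []" using distinct_darts by auto
  have hdA: "hd A = a" using A(1) Ane rots by (cases A) (auto simp: cyc_def)
  have lastA: "last A = r"
  proof -
    have "rot M (last A) = d'" using A(1) Ane by (simp add: cyc_def)
    then show ?thesis using rots(6) rot_inj by metis
  qed
  have 1: "successively (\<lambda>x y. rot N x = y) A"
  proof (rule successively_cong_butlast)
    show "successively (\<lambda>x y. rot M x = y) A" using A(1) by (cases A) (auto simp: cyc_def)
    fix e assume e: "e \<in> set (butlast A)"
    then have eA: "e \<in> set A" by (rule in_set_butlastD)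
    show "rot N e = rot M e"
    proof (rule rot_contract_same)
      show "e \<in> D'" using in_D' eA by blast
      show "e \<noteq> opp M a" using srcA[OF eA] ends neqs by auto
      show "e \<noteq> r" using distinct_butlast_neq_last[of A e] dA e lastA by auto
      show "rot M e \<noteq> p" "rot M e \<noteq> q'" using rot_neq[of e] srcA[OF eA] ends neqs by auto
    qed
  qed
  have Bs: "successively (\<lambda>x y. rot M x = y) (q # B @ [p])" using B(1) by (auto simp: cyc_def)
  have 2: "successively (\<lambda>x y. rot N x = y) B"
  proof (rule successively_cong_butlast)
    show "successively (\<lambda>x y. rot M x = y) B" using Bs by (auto simp: successively_Cons successively_append_iff)
    fix e assume e: "e \<in> set (butlast B)"
    then have eB: "e \<in> set B" by (rule in_set_butlastD)
    then have Bne: "B \<noteq> []" by auto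
    show "rot N e = rot M e"
    proof (rule rot_contract_same)
      show "e \<in> D'" using in_D' eB by blast
      show "e \<noteq> opp M a" "e \<noteq> r" using srcB[OF eB] ends neqs by auto
      have "rot M (last B) = p" using Bs Bne by (auto simp: successively_Cons successively_append_iff)
      moreover have "e \<noteq> last B" using distinct_butlast_neq_last[of B e] dB e by auto
      ultimately show "rot M e \<noteq> p" using rot_inj by metis
      show "rot M e \<noteq> q'" using rot_neq[of e] srcB[OF eB] ends neqs by auto
    qed
  qed
  have rD': "r \<in> D'" by (rule a_g_in)
  \<comment> \<open>If \<open>w\<close> has degree 3, then \<open>B\<close> is empty:
    \<open>q\<close> is followed by \<open>p\<close>, whose substitute is \<open>a\<close>.\<close>
  have r: "rot N r = (if B = [] then a else hd B)"
  proof -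
    have "rot M q = (if B = [] then p else hd B)" using Bs by (cases B) auto
    moreover have "hd B \<noteq> p \<and> hd B \<noteq> q'" if "B \<noteq> []"
      using that srcB[of "hd B"] dB ends neqs by (cases B) auto
    ultimately show ?thesis unfolding rot_contract[OF rD'] using distinct_darts by (auto simp: Let_def)
  qed
  have last: "rot N (last B) = a" if "B \<noteq> []"
  proof -
    have l: "last B \<in> set B" using that by simp
    have "rot M (last B) = p" using Bs that by (auto simp: successively_Cons successively_append_iff)
    moreover have "last B \<in> D'" using in_D' l by blast
    ultimately show ?thesis
      using srcB[OF l] ends neqs by (auto simp: rot_contract Let_def)
  qed
  have "e \<notin> set B" if "e \<in> set A" for e using srcA[OF that] srcB[of e] neq(1) by auto
  then have "distinct (A @ B)" using dA dB by auto
  then show "cyc (rot N) (A @ B)"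
    unfolding cyc_def using 1 2 r last lastA hdA Ane by (auto simp: successively_append_iff)
qed

lemma rot_list_at_d: obtains B where "cyc (rot M) (d # q # B @ [p])" "set (d # q # B @ [p]) = out w"
proof -
  obtain xs where xs: "cyc (rot M) (d # xs)" "set (d # xs) = out w"
    using cyc_out[OF d] ends by metis
  have "p \<in> set (d # xs)" unfolding xs(2) using in_darts ends by simp
  then have "p \<in> set xs" using distinct_darts by auto
  then obtain ys where ys: "xs = q # ys"
    using xs(1) rots by (cases xs) (auto simp: cyc_def)
  have "ys \<noteq> []" using \<open>p \<in> set xs\<close> ys distinct_darts by auto
  moreover have "last ys = p"
  proof -
    have "rot M (last ys) = d" using xs(1) ys \<open>ys \<noteq> []\<close> by (simp add: cyc_def)
    then show ?thesis using rots rot_inj by metis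
  qed
  ultimately obtain B where B: "ys = B @ [p]" by (metis append_butlast_last_id)
  show thesis using that[of B] xs unfolding ys B by simp
qed

text \<open>These are the darts that a split of the merged vertex has to hand back to
  \<open>w\<close> in order to undo the contraction.\<close>

lemma between_contract: "between N r a = out w - {d, p, q}"
proof -
  obtain A where A: "cyc (rot M) (d' # A)" "set (d' # A) = out s"
    using cyc_out[OF in_darts(2)] ends by metis
  obtain B where B: "cyc (rot M) (d # q # B @ [p])" "set (d # q # B @ [p]) = out w"
    by (rule rot_list_at_d)
  have "a \<in> set (d' # A)" "r \<in> set (d' # A)" unfolding A(2) using in_darts ends by simp_all
  then have "a \<in> set A" "r \<in> set A" using distinct_darts by auto
  then obtain A' where A': "A = a # A'" using A(1) rots by (cases A) (auto simp: cyc_def)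
  then have "A' \<noteq> []" using \<open>r \<in> set A\<close> distinct_darts by auto
  moreover have "last A' = r"
  proof -
    have "rot M (last A') = d'" using A(1) A' \<open>A' \<noteq> []\<close> by (simp add: cyc_def)
    then show ?thesis using rots(6) rot_inj by metis
  qed
  ultimately obtain A'' where A'': "A' = A'' @ [r]" by (metis append_butlast_last_id)
  have "cyc (rot N) ((a # A'') @ (r # B))" using cyc_merged(1)[OF A B] A' A'' by simp
  from cyc_rotate[OF this] have "cyc (rot N) ((r # B @ [a]) @ A'')" by simp
  then have "successively (\<lambda>x y. rot N x = y) (r # B @ [a])" "distinct (r # B @ [a])"
    unfolding cyc_def by (auto simp: successively_append_iff successively_Cons hd_append)
  then have "between N r a = set B" by (rule between_eq)
  moreover have "set B = out w - {d, p, q}" using B by (auto simp: cyc_def)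
  ultimately show ?thesis by simp
qed

lemma rot_cyclic_contract:
  assumes "v \<in> vs N"
  shows "cyclic_on (rot N) (out_arcs (skel N) v)"
proof -
  have v: "v \<in> vs M" "v \<noteq> w" using assms by (auto simp: contract_simps)
  \<comment> \<open>Only these three rotations change: \<open>s\<close> receives the darts of
    \<open>w\<close>, while \<open>x\<close> just loses \<open>p'\<close> and \<open>y\<close> just
    loses \<open>q'\<close>.\<close>
  consider "v = s" | "v = x" | "v = y" | "v \<noteq> s" "v \<noteq> x" "v \<noteq> y" by blast
  then show ?thesis
  proof cases
    case 1
    obtain A where A: "cyc (rot M) (d' # A)" "set (d' # A) = out s"
      using cyc_out[OF in_darts(2)] ends by metis
    obtain B where B: "cyc (rot M) (d # q # B @ [p])" "set (d # q # B @ [p]) = out w"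
      by (rule rot_list_at_d)
    show ?thesis using cyc_imp_cyclic_on[OF cyc_merged(1)[OF A B]] cyc_merged(2)[OF A B] 1 by simp
  next
    case 2
    obtain Xs where Xs: "cyc (rot M) (p' # Xs)" "set (p' # Xs) = out x"
      using cyc_out[OF in_darts(4)] ends by metis
    have dX: "distinct (p' # Xs)" using Xs by (simp add: cyc_def)
    have "set Xs = out x - {p'}" unfolding Xs(2)[symmetric] using dX by auto
    moreover have "out_arcs (skel N) v = out v - X" using out_contract(1)[of v] assms 2 neqs by simp
    moreover have "out x \<inter> X = {p'}" using ends neqs in_darts by (auto simp: X_def)
    ultimately have set: "set Xs = out_arcs (skel N) v" using 2 by blast
    have in_D': "e \<in> D'" if "e \<in> set Xs" for e
      using that unfolding set by (simp add: contract_simps)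
    have src: "src M e = x" if "e \<in> set Xs" for e
    proof -
      have "e \<in> set (p' # Xs)" using that by simp
      then show ?thesis unfolding Xs(2) by simp
    qed
    have "opp M a \<in> set (p' # Xs)" unfolding Xs(2) using in_darts ends by simp
    then have ne: "Xs \<noteq> []" using distinct_darts by auto
    have last: "last Xs = opp M a"
    proof -
      have "rot M (last Xs) = p'" using Xs(1) ne by (simp add: cyc_def)
      then show ?thesis using rots(2) rot_inj by metis
    qed
    have hd: "rot M p' = hd Xs" using Xs(1) ne by (cases Xs) (auto simp: cyc_def)
    have "successively (\<lambda>x y. rot N x = y) Xs"
    proof (rule successively_cong_butlast)
      show "successively (\<lambda>x y. rot M x = y) Xs" using Xs(1) by (cases Xs) (auto simp: cyc_def)
      fix e assume e: "e \<in> set (butlast Xs)"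
      then have eX: "e \<in> set Xs" by (rule in_set_butlastD)
      show "rot N e = rot M e"
      proof (rule rot_contract_same)
        show "e \<in> D'" using in_D' eX by blast
        show "e \<noteq> opp M a" using distinct_butlast_neq_last[of Xs e] dX e last by auto
        show "e \<noteq> r" using src[OF eX] ends neqs by auto
        show "rot M e \<noteq> p" "rot M e \<noteq> q'" using rot_neq[of e] src[OF eX] ends neqs by auto
      qed
    qed
    moreover have "rot N (last Xs) = hd Xs"
    proof -
      have "rot M p' \<noteq> p" "rot M p' \<noteq> q'" using rot_neq[of p'] ends neqs by auto
      then show ?thesis unfolding last rot_contract[OF a_g_in(2)] using hd by (simp add: Let_def)
    qed
    ultimately have "cyc (rot N) Xs" using ne dX by (simp add: cyc_def)
    from cyc_imp_cyclic_on[OF this] show ?thesis using set by simp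
  next
    case 3
    obtain Ys where Ys: "cyc (rot M) (q' # Ys)" "set (q' # Ys) = out y"
      using cyc_out[OF in_darts(8)] ends by metis
    have dY: "distinct (q' # Ys)" using Ys by (simp add: cyc_def)
    have "set Ys = out y - {q'}" unfolding Ys(2)[symmetric] using dY by auto
    moreover have "out_arcs (skel N) v = out v - X" using out_contract(1)[of v] assms 3 neqs by simp
    moreover have "out y \<inter> X = {q'}" using ends neqs in_darts by (auto simp: X_def)
    ultimately have set: "set Ys = out_arcs (skel N) v" using 3 by blast
    have in_D': "e \<in> D'" if "e \<in> set Ys" for e
      using that unfolding set by (simp add: contract_simps)
    have src: "src M e = y" if "e \<in> set Ys" for e
    proof -
      have "e \<in> set (q' # Ys)" using that by simp
      then show ?thesis unfolding Ys(2) by simp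
    qed
    have "g \<in> set (q' # Ys)" unfolding Ys(2) using in_darts ends by simp
    then have ne: "Ys \<noteq> []" using distinct_darts by auto
    have last: "rot M (last Ys) = q'" using Ys(1) ne by (simp add: cyc_def)
    have hd: "hd Ys = g" using Ys(1) ne rots by (cases Ys) (auto simp: cyc_def)
    have "successively (\<lambda>x y. rot N x = y) Ys"
    proof (rule successively_cong_butlast)
      show "successively (\<lambda>x y. rot M x = y) Ys" using Ys(1) by (cases Ys) (auto simp: cyc_def)
      fix e assume e: "e \<in> set (butlast Ys)"
      then have eY: "e \<in> set Ys" by (rule in_set_butlastD)
      show "rot N e = rot M e"
      proof (rule rot_contract_same)
        show "e \<in> D'" using in_D' eY by blast
        have "e \<noteq> last Ys" using distinct_butlast_neq_last[of Ys e] dY e by auto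
        then show "rot M e \<noteq> q'" using rot_inj last by metis
        show "e \<noteq> opp M a" "e \<noteq> r" using src[OF eY] ends neqs by auto
        show "rot M e \<noteq> p" using rot_neq[of e] src[OF eY] ends neqs by auto
      qed
    qed
    moreover have "rot N (last Ys) = hd Ys"
    proof -
      have l: "last Ys \<in> set Ys" using ne by simp
      show ?thesis unfolding rot_contract[OF in_D'[OF l]] hd last
        using src[OF l] ends neqs by (auto simp: Let_def)
    qed
    ultimately have "cyc (rot N) Ys" using ne dY by (simp add: cyc_def)
    from cyc_imp_cyclic_on[OF this] show ?thesis using set by simp
  next
    case 4
    have set: "out_arcs (skel N) v = out v"
      using out_contract(1)[OF 4(1) assms] 4 v ends by (auto simp: X_def)
    have same: "rot N e = rot M e" if e: "e \<in> out v" for e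
    proof (rule rot_contract_same)
      show "e \<in> D'" using e set contract_simps(2) by auto
      show "e \<noteq> opp M a" "e \<noteq> r" using e 4 ends by auto
      show "rot M e \<noteq> p" "rot M e \<noteq> q'" using rot_neq[of e] e 4 v ends by auto
    qed
    have "cyclic_on (rot M) (out v)" using rot_cyclic[OF v(1)] by (simp add: out_def)
    then obtain e where "e \<in> out v" by (auto simp: cyclic_on_def)
    then obtain xs where "cyc (rot M) xs" "set xs = out v"
      using cyclic_on_imp_cyc[OF \<open>cyclic_on (rot M) (out v)\<close>] by metis
    then show ?thesis using cyc_imp_cyclic_on[OF cyc_cong[of "rot M" xs "rot N"]] same set by simp
  qed
qed

lemma contracted: "triangulation N"
proof
  show "finite (vs N)" "finite (darts N)"
    using finite_vs finite_darts by (simp_all add: contract_simps D'_def)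
  have s: "s \<in> vs M" using dst_in[OF d] ends by simp
  then show "vs N \<noteq> {}" using neqs by (auto simp: contract_simps)
  show "src N e \<in> vs N" if "e \<in> darts N" for e
    using that s src_in[of e] neqs by (auto simp: contract_simps proj_def D'_def)
  show "opp N e \<in> darts N" if "e \<in> darts N" for e using that by (simp add: contract_simps)
  show "opp N e = e" if "e \<notin> darts N" for e using that by (simp add: contract_simps)
  show "opp N (opp N e) = e" for e by (simp add: contract_simps)
  show "src N (opp N e) = dst N e" if "e \<in> darts N" for e
    using that D'_sub[of e] by (simp add: contract_simps src_opp)
  show "src N e \<noteq> dst N e" if "e \<in> darts N" for e
  proof
    assume "src N e = dst N e"
    then have eq: "proj (src M e) = proj (dst M e)" by (simp add: contract_simps)
    have e: "e \<in> darts M" "e \<notin> X" using that by (auto simp: contract_simps D'_def)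
    have "src M e = w \<and> dst M e = s \<or> src M e = s \<and> dst M e = w"
      using eq no_loop[OF e(1)] by (auto simp: proj_def split: if_splits)
    then have "e = d \<or> opp M e = d"
      using unique[of e] unique[of "opp M e"] e(1) by (auto simp: ends src_opp dst_opp)
    then show False using e(2) opp_X[of e] by (auto simp: X_def)
  qed
  show "rot N permutes darts N"
  proof (rule bij_imp_permutes)
    show "rot N e = e" if "e \<notin> darts N" for e using that by (simp add: contract_simps)
    have "inj_on (rot N) (darts N)" by (rule inj_onI) (simp add: contract_simps)
    moreover have "rot N ` darts N \<subseteq> darts N" using face_step_D' by (auto simp: contract_simps)
    moreover have "finite (darts N)" using finite_darts by (simp add: contract_simps D'_def)
    ultimately show "bij_betw (rot N) (darts N) (darts N)"
      unfolding bij_betw_def by (simp add: endo_inj_surj)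
  qed
  show "cyclic_on (rot N) (out_arcs (skel N) v)" if "v \<in> vs N" for v
    using that by (rule rot_cyclic_contract)
  show "face_step N (face_step N (face_step N e)) = e" if "e \<in> darts N" for e
  proof -
    have e: "e \<in> D'" using that by (simp add: contract_simps)
    then have e1: "swp (face_step M (swp e)) \<in> D'" by (rule face_step_D')
    then have e2: "swp (face_step M (face_step M (swp e))) \<in> D'" using face_step_D' by fastforce
    show ?thesis using face_triangle[of "swp e"] D'_sub[OF e] e e1 e2
      by (simp add: face_step_contract)
  qed
  \<comment> \<open>The loss of one vertex and six darts leaves \<open>euler6\<close>
    balanced.\<close>
  have "card (darts N) = card (darts M) - 6" "6 \<le> card (darts M)"
    using card_Diff_subset[OF _ X_sub] card_X card_mono[OF finite_darts X_sub] finite_subset[OF X_sub finite_darts]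
    by (simp_all add: contract_simps D'_def)
  moreover have "w \<in> vs M" using src_in[OF d] ends by simp
  then have "card (vs N) = card (vs M) - 1" "1 \<le> card (vs M)"
    using finite_vs by (auto simp: contract_simps card_gt_0_iff Suc_le_eq)
  ultimately show "6 * card (vs N) = card (darts N) + 12" using euler6 by linarith
  show "U = vs N" if U: "U \<subseteq> vs N" "U \<noteq> {}"
    and step: "\<And>e. e \<in> darts N \<Longrightarrow> src N e \<in> U \<Longrightarrow> dst N e \<in> U" for U
  proof -
    have st: "proj (dst M e) \<in> U" if "e \<in> D'" "proj (src M e) \<in> U" for e
      using step[of e] that by (simp add: contract_simps)
    have px: "proj x = x" "proj y = y" "proj s = s" "proj w = s" using neqs by (auto simp: proj_def)
    have xs: "x \<in> U \<longleftrightarrow> s \<in> U" using st[of a] st[of "opp M a"] a_g_in ends px by auto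
    have ys: "y \<in> U \<longleftrightarrow> s \<in> U" using st[of g] st[of r] a_g_in ends px by auto
    \<comment> \<open>The set is pulled back along \<open>proj\<close>. A removed dart does not
      break closure, since its ends are mapped into \<open>s\<close>, \<open>x\<close>,
      \<open>y\<close>, which are still joined by \<open>a\<close> and \<open>g\<close>.\<close>
    have "{v \<in> vs M. proj v \<in> U} = vs M"
    proof (rule connected)
      show "{v \<in> vs M. proj v \<in> U} \<noteq> {}" using U by (auto simp: contract_simps proj_def)
      fix e assume e: "e \<in> darts M" "src M e \<in> {v \<in> vs M. proj v \<in> U}"
      have "proj (dst M e) \<in> U"
      proof (cases "e \<in> X")
        case True
        then show ?thesis using e(2) xs ys ends px by (auto simp: X_def)
      next
        case False
        then show ?thesis using e st by (simp add: D'_def)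
      qed
      then show "dst M e \<in> {v \<in> vs M. proj v \<in> U}" using dst_in[OF e(1)] by simp
    qed auto
    then have pr: "proj v \<in> U" if "v \<in> vs M" for v using that by blast
    have "v \<in> U" if "v \<in> vs N" for v
      using pr[of v] that by (simp add: contract_simps proj_def)
    then show ?thesis using U(1) by blast
  qed
qed

end

section \<open>Deleting a vertex\<close>

text \<open>Skipping a single dart is enough in a triangulation: the successor of a dart into
  \<open>w\<close> is \<open>face_step\<close> of a spoke, which by \<open>rim_ends\<close> does not
  lead to \<open>w\<close>.\<close>

definition delete_vertex :: "('a, 'b) embedded_graph \<Rightarrow> 'a \<Rightarrow> ('a, 'b) embedded_graph" where
  "delete_vertex M w =
    \<lparr> skel = \<lparr> verts = vs M - {w}, arcs = {e \<in> darts M. src M e \<noteq> w \<and> dst M e \<noteq> w},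
        tail = src M, head = dst M \<rparr>,
      opp = opp M,
      rot = \<lambda>e. if dst M (rot M e) = w then rot M (rot M e) else rot M e \<rparr>"

context triangulation
begin

text \<open>A relation, because two constructions realize it: \<open>delete_vertex\<close>, and the
  contraction of a spoke of a 3-wheel, which is moreover known to be a triangulation.\<close>

definition deletes :: "'a \<Rightarrow> ('a, 'b) embedded_graph \<Rightarrow> bool" where
  "deletes w K \<longleftrightarrow> vs K = vs M - {w} \<and> darts K = {e \<in> darts M. src M e \<noteq> w \<and> dst M e \<noteq> w} \<and>
    (\<forall>e \<in> darts K. src K e = src M e \<and> dst K e = dst M e \<and> opp K e = opp M e \<and>
       rot K e = (if dst M (rot M e) = w then rot M (rot M e) else rot M e))"

lemma deletes_delete_vertex: "deletes w (delete_vertex M w)"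
  by (simp add: deletes_def delete_vertex_def)

lemma rim_ends:
  assumes "h \<in> out w"
  shows "src M (face_step M h) \<noteq> w" "dst M (face_step M h) \<noteq> w"
proof -
  have h: "h \<in> darts M" "src M h = w" using assms by auto
  show "src M (face_step M h) \<noteq> w" using src_face_step[OF h(1)] no_loop[OF h(1)] h(2) by simp
  have "dst M (face_step M h) = src M (face_step M (face_step M h))" using h by (simp add: src_face_step)
  moreover have "dst M (face_step M (face_step M h)) = w" using dst_face_step2[OF h(1)] h(2) by simp
  moreover have "src M (face_step M (face_step M h)) \<noteq> dst M (face_step M (face_step M h))"
    using h by (intro no_loop) simp
  ultimately show "dst M (face_step M h) \<noteq> w" by simp
qed

lemma face_step_rot: "h \<in> darts M \<Longrightarrow> face_step M (face_step M (rot M h)) = opp M h"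
  using face_triangle[of "opp M h"] by (simp add: face_step_opp)

text \<open>Undoing a hub: the rim darts \<open>face_step M h\<close>, one for each spoke
  \<open>h\<close>, become a single face, whatever the degree of \<open>w\<close>.\<close>

lemma hub_deleted:
  assumes K: "deletes w K" and h0: "h0 \<in> out w"
  shows "add_hub K (face K (face_step M h0)) M" "face K (face_step M h0) = face_step M ` out w"
proof -
  have vsK: "vs K = vs M - {w}" and DK: "darts K = {e \<in> darts M. src M e \<noteq> w \<and> dst M e \<noteq> w}"
    using K by (auto simp: deletes_def)
  have K': "src K e = src M e" "dst K e = dst M e" "opp K e = opp M e"
    "rot K e = (if dst M (rot M e) = w then rot M (rot M e) else rot M e)" if "e \<in> darts K" for e
    using K that unfolding deletes_def by blast+
  have oppK: "opp M e \<in> darts K" if "e \<in> darts K" for e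
    using that by (auto simp: DK src_opp dst_opp)
  have rimK: "face_step M h \<in> darts K" if "h \<in> out w" for h
    using rim_ends[OF that] that by (simp add: DK)
  have step: "face_step K (face_step M (rot M h)) = face_step M h" if h: "h \<in> out w" for h
  proof -
    have rh: "rot M h \<in> out w" using h by simp
    let ?e = "face_step M (rot M h)"
    have e: "?e \<in> darts K" by (rule rimK[OF rh])
    have "rot M (opp M ?e) = opp M h"
      using face_step_rot[of h] h by (simp add: face_step_def[of M ?e])
    moreover have "dst M (opp M h) = w" using h by (simp add: dst_opp)
    ultimately have "rot K (opp M ?e) = rot M (opp M h)" using K'(4)[OF oppK[OF e]] by simp
    then show ?thesis unfolding face_step_def[of K] K'(3)[OF e] by (simp add: face_step_def)
  qed
  have w: "w \<in> vs M" using h0 src_in by auto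
  obtain xs where xs: "cyc (rot M) (h0 # xs)" "set (h0 # xs) = out_arcs (skel M) w"
    by (rule cyclic_on_imp_cyc[OF rot_cyclic[OF w], of h0]) (use h0 in auto)
  let ?ys = "h0 # xs"
  have out: "h \<in> out w" if "h \<in> set ?ys" for h using that unfolding xs(2) out_def .
  have succ: "successively (\<lambda>a b. face_step K (face_step M b) = face_step M a) ?ys"
  proof (rule successively_mono)
    show "successively (\<lambda>a b. rot M a = b) ?ys" using xs(1) by (simp add: cyc_def)
    fix x y assume "x \<in> set ?ys" "y \<in> set ?ys" "rot M x = y"
    then show "face_step K (face_step M y) = face_step M x" using step[OF out] by auto
  qed
  \<comment> \<open>The new face traverses the rim against the rotation of the spokes, hence the
    reversed list.\<close>
  have "cyc (face_step K) (rev (map (face_step M) ?ys))"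
    unfolding cyc_def
  proof (intro conjI)
    show "distinct (rev (map (face_step M) ?ys))"
      unfolding distinct_rev distinct_map using xs(1) by (auto simp: cyc_def inj_on_def)
    show "successively (\<lambda>a b. face_step K a = b) (rev (map (face_step M) ?ys))"
      unfolding successively_rev successively_map by (rule succ)
    have "rot M (last ?ys) = h0" using xs(1) by (simp add: cyc_def)
    then have "face_step K (face_step M h0) = face_step M (last ?ys)"
      using step[OF out, of "last ?ys"] by simp
    moreover have "last (rev (map (face_step M) ?ys)) = face_step M h0" by simp
    moreover have "hd (rev (map (face_step M) ?ys)) = face_step M (last ?ys)"
      by (simp add: hd_rev last_map)
    ultimately show "face_step K (last (rev (map (face_step M) ?ys))) = hd (rev (map (face_step M) ?ys))"
      by simp
  qed simp
  from cyc_imp_cyclic_on[OF this]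
  have "orbit (face_step K) (face_step M h0) = set (rev (map (face_step M) ?ys))"
    by (rule orbit_cyclic_eq3) simp
  also have "\<dots> = face_step M ` out w" using xs(2) by (simp only: set_rev set_map out_def)
  finally show F: "face K (face_step M h0) = face_step M ` out w" by (simp only: face_def)
  have F_iff: "e \<in> face_step M ` out w \<longleftrightarrow> face_step M (face_step M e) \<in> out w" if "e \<in> darts M" for e
  proof
    assume "face_step M (face_step M e) \<in> out w"
    then have "face_step M (face_step M (face_step M e)) \<in> face_step M ` out w" by (rule imageI)
    then show "e \<in> face_step M ` out w" using face_triangle[OF that] by simp
  next
    assume "e \<in> face_step M ` out w"
    then obtain h where "h \<in> out w" "e = face_step M h" by blast
    then show "face_step M (face_step M e) \<in> out w" by (simp add: face_triangle)
  qed
  \<comment> \<open>The triangle of a rim dart \<open>e\<close> is closed by the spoke from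
    \<open>w\<close> to the tail of \<open>e\<close>, which is two steps after
    \<open>e\<close>.\<close>
  let ?h = "\<lambda>e. face_step M (face_step M e)" and ?s = "\<lambda>e. opp M (face_step M (face_step M e))"
  let ?F = "face_step M ` out w"
  have hF: "?h ` ?F = out w" by (auto simp: image_image face_triangle)
  have sF: "?s ` ?F = opp M ` out w" by (auto simp: image_image face_triangle)
  have oppout: "opp M ` out w = {e \<in> darts M. dst M e = w}"
  proof
    show "opp M ` out w \<subseteq> {e \<in> darts M. dst M e = w}" by (auto simp: dst_opp)
    show "{e \<in> darts M. dst M e = w} \<subseteq> opp M ` out w"
    proof
      fix e assume "e \<in> {e \<in> darts M. dst M e = w}"
      then have "opp M e \<in> out w" by (simp add: src_opp)
      then have "opp M (opp M e) \<in> opp M ` out w" by (rule imageI)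
      then show "e \<in> opp M ` out w" by simp
    qed
  qed
  show "add_hub K (face K (face_step M h0)) M"
    unfolding F add_hub_def
  proof (rule conjI, goal_cases)
    case 1
    show ?case unfolding faces_def F[symmetric] using rimK[OF h0] by (rule imageI)
  next
    case 2
    show ?case
    proof (rule exI[of _ w], rule exI[of _ ?s], rule exI[of _ ?h], intro conjI ballI)
    show "w \<notin> vs K" by (simp add: vsK)
    show "inj_on ?s ?F" "inj_on ?h ?F" by (auto simp: inj_on_def)
    show "?s ` ?F \<inter> ?h ` ?F = {}" unfolding hF sF oppout using no_loop by auto
    show "(?s ` ?F \<union> ?h ` ?F) \<inter> darts K = {}" unfolding hF sF oppout DK by auto
    show "vs M = insert w (vs K)" using w by (auto simp: vsK)
    show "darts M = darts K \<union> ?s ` ?F \<union> ?h ` ?F" unfolding hF sF oppout DK by auto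
  next
    fix d assume d: "d \<in> darts K"
    then have dM: "d \<in> darts M" "src M d \<noteq> w" "dst M d \<noteq> w" by (auto simp: DK)
    show "src M d = src K d" "dst M d = dst K d" "opp M d = opp K d" using K'[OF d] by simp_all
    show "rot M d = (if rot K d \<in> ?F then ?s (rot K d) else rot K d)"
    proof (cases "dst M (rot M d) = w")
      case True
      let ?k = "opp M (rot M d)"
      have k: "?k \<in> out w" using True dM by (simp add: src_opp)
      have eq: "rot K d = face_step M ?k" using K'(4)[OF d] True by (simp add: face_step_opp)
      have "?s (face_step M ?k) = rot M d" using k by (simp add: face_triangle)
      then show ?thesis unfolding eq using k by simp
    next
      case False
      then have eq: "rot K d = rot M d" using K'(4)[OF d] by simp
      have "rot M d \<notin> ?F"
      proof
        assume "rot M d \<in> ?F"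
        then obtain h where "h \<in> out w" "rot M d = face_step M h" by blast
        then have "h \<in> out w" "d = opp M h" by (simp_all add: face_step_def)
        then show False using dM by (simp add: dst_opp)
      qed
      then show ?thesis using eq by simp
    qed
  next
    fix d assume "d \<in> ?F"
    then obtain h where h: "h \<in> out w" "d = face_step M h" by blast
    have hd: "?h d = h" using h by (simp add: face_triangle)
    have dK: "d \<in> darts K" using rimK h by simp
    have hM: "h \<in> darts M" "src M h = w" using h by auto
    show "src M (?s d) = src K d" "dst M (?s d) = w" "opp M (?s d) = ?h d" "rot M (?s d) = d"
      "src M (?h d) = w" "dst M (?h d) = src K d" "opp M (?h d) = ?s d"
      unfolding hd K'(1)[OF dK] using hM h(2)
      by (simp_all add: src_opp dst_opp src_face_step face_step_def)
    show "rot M (?h (face_step K d)) = ?h d"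
    proof -
      let ?k = "opp M (face_step M (face_step M h))"
      have "rot M ?k = face_step M (face_step M (face_step M h))" by (simp add: face_step_def[of M "face_step M (face_step M h)"])
      then have k: "rot M ?k = h" using face_triangle[OF hM(1)] by simp
      then have "?k \<in> out w" using hM src_rot[of ?k] rot_in_iff[of ?k] by simp
      from step[OF this] have "face_step K d = face_step M ?k" unfolding k h(2) .
      then have "?h (face_step K d) = ?k" using \<open>?k \<in> out w\<close> by (simp add: face_triangle)
      then show ?thesis unfolding hd using k by simp
    qed
  qed
  qed
qed

definition adj :: "'a \<Rightarrow> 'a \<Rightarrow> bool" where
  "adj u v \<longleftrightarrow> (\<exists>d \<in> darts M. src M d = u \<and> dst M d = v)"

lemma adjI: "d \<in> darts M \<Longrightarrow> adj (src M d) (dst M d)"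
  by (auto simp: adj_def)

lemma adj_sym: "adj u v \<Longrightarrow> adj v u"
proof -
  assume "adj u v"
  then obtain d where "d \<in> darts M" "src M d = u" "dst M d = v" by (auto simp: adj_def)
  then have "opp M d \<in> darts M" "src M (opp M d) = v" "dst M (opp M d) = u"
    by (simp_all add: src_opp dst_opp)
  then show "adj v u" by (auto simp: adj_def)
qed

lemma maximal_planarI:
  assumes "\<And>d e. \<lbrakk>d \<in> darts M; e \<in> darts M; d \<noteq> e; src M d = src M e; dst M d = dst M e\<rbrakk> \<Longrightarrow>
    bounds_2wheel M d e \<or> bounds_2wheel M e d"
  shows "maximal_planar M"
  unfolding maximal_planar_def arc_to_ends_def
  using plane_graph loopfree card_face assms by simp

end

locale simple_triangulation = triangulation +
  assumes simple_darts: "\<lbrakk>d \<in> darts M; e \<in> darts M; src M d = src M e; dst M d = dst M e\<rbrakk> \<Longrightarrow> d = e"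

locale wheel3 = simple_triangulation +
  fixes e
  assumes e: "e \<in> darts M"
    and three: "rot M (rot M (rot M e)) = e"
    and rim: "distinct [src M e, dst M e, dst M (rot M e), dst M (rot M (rot M e))]"
begin

lemma contraction: "contraction M e"
proof
  have "face_step M (face_step M e) = opp M (rot M (rot M e))"
    using face_step_rot[of "rot M (rot M e)"] e three by simp
  moreover have "dst M (face_step M e) = src M (face_step M (face_step M e))"
    using e by (simp add: src_face_step)
  ultimately have "dst M (face_step M e) = dst M (rot M (rot M e))" using e by (simp add: src_opp)
  then show "distinct [src M e, dst M e, dst M (face_step M e), dst M (face_step M (opp M e))]"
    using rim by (auto simp: face_step_opp)
qed (use e simple_darts in auto)

sublocale c: contraction M e by (rule contraction)

lemma c_p: "c.p = rot M (rot M e)"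
  using c.rots(3) three by (metis rot_inj)

lemma c_q: "c.q = rot M e"
  by (simp add: c.q_def c.d'_def face_step_opp)

lemma out_hub: "out c.w = {e, c.p, c.q}"
proof -
  have "e \<noteq> rot M e" "e \<noteq> rot M (rot M e)" "rot M e \<noteq> rot M (rot M e)" using rim by auto
  then have "cyc (rot M) [e, rot M e, rot M (rot M e)]" using three by (simp add: cyc_def)
  from cyc_imp_cyclic_on[OF this] have "orbit (rot M) e = {e, rot M e, rot M (rot M e)}"
    using orbit_cyclic_eq3[of "rot M" _ e] by simp
  moreover have "orbit (rot M) e = out (src M e)"
    unfolding out_def by (rule orbit_cyclic_eq3[OF rot_cyclic]) (use e src_in in auto)
  ultimately show ?thesis unfolding c_p c_q c.w_def by auto
qed

lemma c_D': "c.D' = {f \<in> darts M. src M f \<noteq> c.w \<and> dst M f \<noteq> c.w}"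
proof -
  have "f \<in> c.X \<longleftrightarrow> src M f = c.w \<or> dst M f = c.w" if f: "f \<in> darts M" for f
  proof
    assume "f \<in> c.X"
    then show "src M f = c.w \<or> dst M f = c.w" using c.ends by (auto simp: c.X_def)
  next
    assume "src M f = c.w \<or> dst M f = c.w"
    then have "f \<in> out c.w \<or> opp M f \<in> out c.w" using f by (auto simp: src_opp)
    then have "f \<in> c.X \<or> opp M f \<in> c.X" unfolding out_hub by (auto simp: c.X_def)
    then show "f \<in> c.X" by (simp add: c.opp_X)
  qed
  then show ?thesis unfolding c.D'_def by auto
qed

text \<open>The contracted spoke and the two edges lost with it are all three spokes, so nothing but
  the hub disappears.\<close>

lemma deletes_contract: "deletes c.w c.N"
proof -
  have "src c.N f = src M f \<and> dst c.N f = dst M f \<and> opp c.N f = opp M f \<and>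
       rot c.N f = (if dst M (rot M f) = c.w then rot M (rot M f) else rot M f)" if f: "f \<in> c.D'" for f
  proof (intro conjI)
    have fM: "f \<in> darts M" "src M f \<noteq> c.w" "dst M f \<noteq> c.w" using f unfolding c_D' by auto
    then show "src c.N f = src M f" "dst c.N f = dst M f" "opp c.N f = opp M f"
      using f by (simp_all add: c.contract_simps c.proj_def)
    consider "f = opp M c.a" | "f = c.r" | "rot M f = c.q'" "f \<noteq> opp M c.a" "f \<noteq> c.r"
      | "f \<noteq> opp M c.a" "f \<noteq> c.r" "rot M f \<noteq> c.q'" by blast
    then show "rot c.N f = (if dst M (rot M f) = c.w then rot M (rot M f) else rot M f)"
    proof cases
      case 1
      have "rot M c.p' \<noteq> c.p" "rot M c.p' \<noteq> c.q'"
        using rot_neq[of c.p' c.p] rot_neq[of c.p' c.q'] c.ends c.neqs by auto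
      then show ?thesis unfolding c.rot_contract[OF f] using 1 c.rots c.ends by (simp add: Let_def)
    next
      case 2
      have "rot M c.q = c.p" by (simp add: c_p c_q)
      then show ?thesis unfolding c.rot_contract[OF f] using 2 c.rots c.ends c.distinct_darts
        by (simp add: Let_def) 
    next
      case 3
      have "c.q' \<noteq> c.p" using c.distinct_darts by auto
      then show ?thesis unfolding c.rot_contract[OF f] using 3 c.rots c.ends by (simp add: Let_def)
    next
      case 4
      have "rot M f \<noteq> c.p" using rot_neq[of f c.p] fM c.ends by auto
      moreover have "dst M (rot M f) \<noteq> c.w"
      proof
        assume w: "dst M (rot M f) = c.w"
        then have "opp M (rot M f) \<in> out c.w" using fM by (simp add: src_opp)
        then have "opp M (opp M (rot M f)) \<in> opp M ` {e, c.p, c.q}" unfolding out_hub by (rule imageI)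
        then have "rot M f \<in> {c.d', c.p', c.q'}" by (simp add: c.opps)
        then have "rot M f = c.d' \<or> rot M f = c.p'" using 4 by auto
        then have "f = c.r \<or> f = opp M c.a" using c.rots rot_inj by metis
        then show False using 4 by blast
      qed
      ultimately show ?thesis using 4 f by (simp add: c.rot_contract_same)
    qed
  qed
  then show ?thesis unfolding deletes_def c.contract_simps(1,2) using c_D' by blast
qed

lemma reduction:
  "maximal_planar c.N \<and> order c.N = order M - 1 \<and> extend_3wheel c.N M"
proof (intro conjI)
  interpret N: triangulation c.N by (rule c.contracted)
  show "maximal_planar c.N"
  proof (rule N.maximal_planarI)
    fix d f assume df: "d \<in> darts c.N" "f \<in> darts c.N" "d \<noteq> f" "src c.N d = src c.N f" "dst c.N d = dst c.N f"
    then have "d \<in> c.D'" "f \<in> c.D'" by (simp_all add: c.contract_simps)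
    then have "d \<in> darts M" "f \<in> darts M" "src M d = src M f" "dst M d = dst M f"
      using df deletes_contract unfolding deletes_def by (auto simp: c.D'_sub)
    then have "d = f" by (rule simple_darts)
    then show "bounds_2wheel c.N d f \<or> bounds_2wheel c.N f d" using df by simp
  qed
  have "c.w \<in> vs M" using src_in[OF e] by (simp add: c.w_def)
  then show "order c.N = order M - 1" by (simp add: order_def c.contract_simps)
  have eo: "e \<in> out c.w" using e by (simp add: c.w_def)
  have rim: "face_step M e \<in> darts c.N"
    using rim_ends[OF eo] e by (simp add: c.contract_simps c_D')
  note hub = hub_deleted[OF deletes_contract eo]
  have "face c.N (face_step M e) \<in> faces c.N" using rim by (simp add: faces_def)
  then show "extend_3wheel c.N M" unfolding extend_3wheel_def using hub(1) N.card_face by blast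
qed

end

section \<open>Contracting two opposite spokes of a wheel\<close>

text \<open>
  The spokes \<open>l, e, et, es, e1\<close> of the wheel are in counterclockwise order, where \<open>e1 = l\<close> in a 4-wheel
  and \<open>e1\<close> is followed by \<open>l\<close> in a 5-wheel.  First the hub is contracted into the end \<open>s2\<close> of \<open>e\<close>,
  then \<open>s2\<close> into the end \<open>s1\<close> of \<open>es\<close>.  With this choice the surviving darts keep the names that
  \<open>split_path\<close> and \<open>split_funnel\<close> require.
\<close>

locale fold = simple_triangulation +
  fixes e l
  assumes e: "e \<in> darts M"
    and l: "rot M l = e"
    and rim: "distinct [src M e, dst M e, dst M (rot M e), dst M (rot M (rot M e)), dst M l]"
      "distinct [src M e, dst M e, dst M (rot M e), dst M (rot M (rot M e)), dst M (rot M (rot M (rot M e)))]"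
    and not_adj: "\<not> adj (dst M e) (dst M (rot M (rot M e)))"
    and short: "rot M (rot M (rot M e)) = l \<or> rot M (rot M (rot M (rot M e))) = l"
begin

definition "hub = src M e"
definition "et = rot M e"
definition "es = rot M et"
definition "e1 = rot M es"
definition "s2 = dst M e"
definition "tp = dst M et"
definition "s1 = dst M es"
definition "v1 = dst M e1"
definition "v2 = dst M l"
definition "a = face_step M es"
definition "ra = face_step M et"
definition "a' = opp M ra"
definition "c = face_step M e"
definition "g = face_step M e1"

lemma in_darts [simp]: "e \<in> darts M" "et \<in> darts M" "es \<in> darts M" "e1 \<in> darts M" "l \<in> darts M"
  "a \<in> darts M" "ra \<in> darts M" "a' \<in> darts M" "c \<in> darts M" "g \<in> darts M"
proof -
  have "rot M l \<in> darts M" using l e by simp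
  then show "l \<in> darts M" by simp
qed (use e in \<open>simp_all add: et_def es_def e1_def a_def ra_def a'_def c_def g_def\<close>)

lemma steps:
  "face_step M (opp M e) = et" "face_step M (opp M et) = es" "face_step M (opp M es) = e1" "face_step M (opp M l) = e"
  "face_step M a = opp M et" "face_step M ra = opp M e" "face_step M c = opp M l" "face_step M g = opp M es"
  "face_step M es = a" "face_step M et = ra" "face_step M e = c" "face_step M e1 = g"
  "rot M l = e" "rot M e = et" "rot M et = es" "rot M es = e1"
proof -
  show "face_step M a = opp M et" unfolding a_def es_def by (rule face_step_rot) simp
  show "face_step M ra = opp M e" unfolding ra_def et_def by (rule face_step_rot) simp
  show "face_step M g = opp M es" unfolding g_def e1_def by (rule face_step_rot) simp
  show "face_step M c = opp M l" unfolding c_def using face_step_rot[of l] l by simp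
qed (use l in \<open>simp_all add: face_step_opp et_def es_def e1_def a_def ra_def c_def g_def\<close>)

lemma ends [simp]:
  "src M e = hub" "src M et = hub" "src M es = hub" "src M e1 = hub" "src M l = hub"
  "dst M e = s2" "dst M et = tp" "dst M es = s1" "dst M e1 = v1" "dst M l = v2"
  "src M a = s1" "dst M a = tp" "src M ra = tp" "dst M ra = s2" "src M a' = s2" "dst M a' = tp"
  "src M c = s2" "dst M c = v2" "src M g = v1" "dst M g = s1"
proof -
  show 0: "src M e = hub" "src M et = hub" "src M es = hub" "src M e1 = hub" "dst M e = s2"
    "dst M et = tp" "dst M es = s1" "dst M e1 = v1" "dst M l = v2"
    by (simp_all add: hub_def et_def es_def e1_def s2_def tp_def s1_def v1_def v2_def)
  show l0: "src M l = hub" using src_rot[of l] by (simp add: l hub_def)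
  show 1: "src M a = s1" "src M ra = tp" "src M c = s2" "src M g = v1"
    using src_face_step[of es] src_face_step[of et] src_face_step[of e] src_face_step[of e1]
    by (simp_all add: steps 0)
  have "dst M d = src M (face_step M d)" if "d \<in> darts M" for d using that by (simp add: src_face_step)
  from this[of a] this[of ra] this[of c] this[of g]
  show 2: "dst M a = tp" "dst M ra = s2" "dst M c = v2" "dst M g = s1"
    by (simp_all add: steps src_opp 0)
  show "src M a' = s2" "dst M a' = tp" by (simp_all add: a'_def src_opp dst_opp 1 2)
qed

text \<open>\<open>v1\<close> and \<open>v2\<close> are not separated here, since they coincide in a
  4-wheel.\<close>

lemma neq: "hub \<noteq> s2" "hub \<noteq> tp" "hub \<noteq> s1" "hub \<noteq> v1" "hub \<noteq> v2" "s2 \<noteq> tp" "s2 \<noteq> s1" "s2 \<noteq> v1" "s2 \<noteq> v2"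
   "tp \<noteq> s1" "tp \<noteq> v1" "tp \<noteq> v2" "s1 \<noteq> v1" "s1 \<noteq> v2"
  using rim[folded et_def, folded es_def, folded e1_def] by simp_all

lemmas neqs = neq neq[symmetric]

lemma not_adj': "\<not> adj s2 s1"
  using not_adj[folded et_def, folded es_def] by simp

lemma contraction1: "contraction M e"
proof
  show "distinct [src M e, dst M e, dst M (face_step M e), dst M (face_step M (opp M e))]"
    using neqs by (simp add: steps)
qed (use simple_darts in auto)

sublocale c1: contraction M e by (rule contraction1)

lemma c1_eqs: "c1.w = hub" "c1.s = s2" "c1.x = v2" "c1.y = tp" "c1.d' = opp M e" "c1.a = c" "c1.p' = opp M l"
  "c1.p = l" "c1.q = et" "c1.g = ra" "c1.q' = opp M et" "c1.r = a'"
  by (simp_all add: c1.w_def c1.s_def c1.x_def c1.y_def c1.d'_def c1.a_def c1.p'_def c1.p_def c1.q_def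
      c1.g_def c1.q'_def c1.r_def steps a'_def)

abbreviation "N1 \<equiv> contract M e"

sublocale N1: triangulation N1 by (rule c1.contracted)

lemma swp1: "c1.swp d = (if d = l then c else if d = c then l else if d = opp M et then ra
    else if d = ra then opp M et else d)"
  using c1.swp_simps c1.swp_other[of d] unfolding c1_eqs by auto

lemma X1: "c1.X = {e, opp M e, l, opp M l, et, opp M et}"
  by (simp add: c1.X_def c1_eqs)

lemma dst_neq: "dst M d \<noteq> dst M f \<Longrightarrow> d \<noteq> f" and src_neq: "src M d \<noteq> src M f \<Longrightarrow> d \<noteq> f"
  by auto

lemma opp_ends [simp]: "src M (opp M e) = s2" "src M (opp M et) = tp" "src M (opp M es) = s1"
  "src M (opp M e1) = v1" "src M (opp M l) = v2" "dst M (opp M e) = hub" "dst M (opp M et) = hub"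
  "dst M (opp M es) = hub" "dst M (opp M e1) = hub" "dst M (opp M l) = hub"
  "src M (opp M a) = tp" "dst M (opp M a) = s1" "src M (opp M c) = v2" "dst M (opp M c) = s2"
  "src M (opp M g) = s1" "dst M (opp M g) = v1"
  by (simp_all add: src_opp dst_opp)

text \<open>The edge towards \<open>v1\<close> that vanishes in the second contraction: the spoke
  \<open>e1\<close> of a 5-wheel. In a 4-wheel that spoke is \<open>l\<close>, which is already
  gone, and the rim dart \<open>c\<close> stands in for it.\<close>

definition "q = (if e1 = l then c else e1)"

lemma q_darts [simp]: "q \<in> darts M" and dst_q [simp]: "dst M q = v1"
  by (auto simp: q_def) (metis ends(9,10,18))

lemma swp_q: "c1.swp e1 = q" "c1.swp q = e1"
proof -
  have "e1 \<noteq> c" "e1 \<noteq> opp M et" "e1 \<noteq> ra"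
    using neqs by (auto intro!: src_neq)
  then show "c1.swp e1 = q" by (simp add: q_def swp1)
  then show "c1.swp q = e1" using c1.swp_swp[of e1] by simp
qed

lemma in_D1: "es \<in> c1.D'" "a \<in> c1.D'" "ra \<in> c1.D'" "q \<in> c1.D'" "c \<in> c1.D'" "g \<in> c1.D'"
proof -
  have D1: "d \<in> c1.D'" if "d \<in> darts M" "src M d \<noteq> hub" "dst M d \<noteq> hub" for d
  proof -
    have "d \<notin> {e, opp M e, l, opp M l, et, opp M et}" using that(2,3) by auto
    then show ?thesis using that(1) by (simp add: c1.D'_def X1)
  qed
  show "a \<in> c1.D'" "ra \<in> c1.D'" "g \<in> c1.D'" and c: "c \<in> c1.D'" using neqs by (auto intro!: D1)
  have "es \<noteq> e" "es \<noteq> l" "es \<noteq> et" using neqs by (auto intro!: dst_neq)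
  moreover have "es \<noteq> opp M e" "es \<noteq> opp M l" "es \<noteq> opp M et" using neqs by (auto intro!: src_neq)
  ultimately show "es \<in> c1.D'" by (simp add: c1.D'_def X1)
  show "q \<in> c1.D'"
  proof (cases "e1 = l")
    case True then show ?thesis using c by (simp add: q_def)
  next
    case False
    have "e1 \<noteq> e" "e1 \<noteq> et" using neqs by (auto intro!: dst_neq)
    moreover have "e1 \<noteq> opp M e" "e1 \<noteq> opp M l" "e1 \<noteq> opp M et" using neqs by (auto intro!: src_neq)
    ultimately show ?thesis using False by (simp add: c1.D'_def X1 q_def)
  qed
qed

lemma face_step_N1:
  "face_step N1 es = a" "face_step N1 a = ra" "face_step N1 (opp M es) = q" "face_step N1 q = g"
proof -
  have 1: "c1.swp es = es"
  proof -
    have "es \<noteq> l" using neqs by (auto intro!: dst_neq)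
    moreover have "es \<noteq> c" "es \<noteq> opp M et" "es \<noteq> ra" using neqs by (auto intro!: src_neq)
    ultimately show ?thesis by (simp add: swp1)
  qed
  have other: "c1.swp d = d" if "src M d = s1 \<or> src M d = v1 \<and> dst M d = s1" for d
  proof -
    have "d \<noteq> l" "d \<noteq> c" "d \<noteq> opp M et" "d \<noteq> ra" using that neqs by auto
    then show ?thesis by (simp add: swp1)
  qed
  show "face_step N1 es = a" using in_D1 by (simp add: c1.face_step_contract 1 steps other)
  show "face_step N1 a = ra"
    using in_D1 by (simp add: c1.face_step_contract other steps) (simp add: swp1 src_neq neqs)
  show "face_step N1 (opp M es) = q" using in_D1 by (simp add: c1.face_step_contract other steps swp_q)
  show "face_step N1 q = g" using in_D1 by (simp add: c1.face_step_contract other steps swp_q)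
qed

lemma N1_opp: "d \<in> c1.D' \<Longrightarrow> opp N1 d = opp M d"
  by (simp add: c1.contract_simps)

lemma N1_ends: "src N1 d = c1.proj (src M d)" "dst N1 d = c1.proj (dst M d)"
  by (simp_all add: c1.contract_simps)

lemma proj1 [simp]: "c1.proj hub = s2" "v \<noteq> hub \<Longrightarrow> c1.proj v = v"
  by (simp_all add: c1.proj_def c1_eqs)

text \<open>A dart of \<open>N1\<close> parallel to \<open>es\<close> starts in \<open>M\<close> at
  the hub or at \<open>s2\<close>. The first makes it \<open>es\<close> by simplicity, the second
  contradicts \<open>not_adj'\<close>.\<close>

lemma contraction2: "contraction N1 es"
proof
  show "es \<in> darts N1" using in_D1 by (simp add: c1.contract_simps)
  show "distinct [src N1 es, dst N1 es, dst N1 (face_step N1 es), dst N1 (face_step N1 (opp N1 es))]"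
    using neqs by (simp add: face_step_N1 N1_opp in_D1 N1_ends)
  fix d assume d: "d \<in> darts N1" "src N1 d = src N1 es" "dst N1 d = dst N1 es"
  then have dM: "d \<in> darts M" "c1.proj (src M d) = s2" "c1.proj (dst M d) = s1"
    using neqs by (auto simp: c1.contract_simps c1.D'_def N1_ends)
  then have "dst M d = s1" "src M d = hub \<or> src M d = s2"
    using neqs by (auto simp: c1.proj_def c1_eqs split: if_splits)
  moreover have "src M d \<noteq> s2"
    using not_adj' dM(1) \<open>dst M d = s1\<close> by (auto simp: adj_def)
  ultimately show "d = es" using simple_darts[of d es] dM(1) by simp
qed

sublocale c2: contraction N1 es by (rule contraction2)

abbreviation "H \<equiv> contract N1 es"

lemma c2_eqs: "c2.w = s2" "c2.s = s1" "c2.x = tp" "c2.y = v1" "c2.d' = opp M es" "c2.a = a" "c2.p' = ra" "c2.p = a'"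
  "c2.q = q" "c2.g = g" "c2.q' = opp M q" "c2.r = opp M g"
proof -
  show "c2.w = s2" "c2.s = s1" using neqs by (simp_all add: c2.w_def c2.s_def N1_ends)
  show "c2.x = tp" "c2.y = v1" using neqs
    by (simp_all add: c2.x_def c2.y_def N1_ends face_step_N1 N1_opp in_D1)
  show d': "c2.d' = opp M es" and a: "c2.a = a" using in_D1 by (simp_all add: c2.d'_def c2.a_def N1_opp face_step_N1)
  show p': "c2.p' = ra" by (simp add: c2.p'_def a face_step_N1)
  show "c2.p = a'" using in_D1 by (simp add: c2.p_def p' N1_opp a'_def)
  show q: "c2.q = q" by (simp add: c2.q_def d' face_step_N1)
  show g: "c2.g = g" by (simp add: c2.g_def q face_step_N1)
  show "c2.q' = opp M q" using in_D1 by (simp add: c2.q'_def q N1_opp)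
  show "c2.r = opp M g" using in_D1 by (simp add: c2.r_def g N1_opp)
qed

lemma X2: "c2.X = {es, opp M es, a', ra, q, opp M q}"
  by (simp add: c2.X_def c2_eqs)

definition "D2 = darts M - c1.X - c2.X"

lemma darts_H: "darts H = D2"
  by (simp add: c2.contract_simps c2.D'_def D2_def c1.contract_simps c1.D'_def)

lemma c2_D': "c2.D' = D2"
  using c2.contract_simps(2) darts_H by simp

lemma D2_D1: "d \<in> D2 \<Longrightarrow> d \<in> c1.D'" and D2_M: "d \<in> D2 \<Longrightarrow> d \<in> darts M"
  by (auto simp: D2_def c1.D'_def)

lemma opp_X2: "opp M d \<in> c2.X \<longleftrightarrow> d \<in> c2.X"
proof -
  have X2': "c2.X = {es, opp M es, a', opp M a', q, opp M q}" by (simp add: X2 a'_def)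
  have "opp M d \<in> c2.X" if "d \<in> c2.X" for d using that unfolding X2' by auto
  from this[of d] this[of "opp M d"] show ?thesis by auto
qed

lemma opp_D2 [simp]: "opp M d \<in> D2 \<longleftrightarrow> d \<in> D2"
  by (simp add: D2_def c1.opp_X opp_X2)

lemma opp_H: "d \<in> D2 \<Longrightarrow> opp H d = opp M d"
  by (simp add: c2.contract_simps c2_D' N1_opp D2_D1)

lemma out_hub:
  assumes "d \<in> darts M" "src M d = hub"
  shows "d \<in> {e, et, es, e1, l}"
proof (rule closed_rot_out[of _ e])
  have 1: "rot M e1 \<in> {e, et, es, e1, l}"
    using short[folded et_def, folded es_def, folded e1_def] l by auto
  fix d assume "d \<in> {e, et, es, e1, l}"
  then consider "d = e1" | "d = e" | "d = et" | "d = es" | "d = l" by blast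
  then show "rot M d \<in> {e, et, es, e1, l}"
    by cases (use 1 in \<open>simp_all add: steps\<close>)
qed (use assms in auto)

lemma D2_not_hub:
  assumes "d \<in> D2"
  shows "src M d \<noteq> hub" "dst M d \<noteq> hub"
proof -
  have no: "d \<notin> {e, et, es, e1, l}" if "d \<in> D2" for d
    using that by (auto simp: D2_def X1 X2 q_def split: if_splits)
  show "src M d \<noteq> hub" using out_hub[of d] no[OF assms] D2_M[OF assms] by blast
  have "src M (opp M d) \<noteq> hub" using out_hub[of "opp M d"] no[of "opp M d"] assms D2_M[OF assms] by auto
  then show "dst M d \<noteq> hub" using D2_M[OF assms] by (simp add: src_opp)
qed

definition "merge v = (if v = s2 then s1 else v)"

lemma ends_H:
  assumes "d \<in> D2"
  shows "src H d = merge (src M d)" "dst H d = merge (dst M d)"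
  using D2_not_hub[OF assms] by (simp_all add: c2.contract_simps N1_ends c2.proj_def c2_eqs merge_def)

lemma rot_N1:
  assumes "d \<in> c1.D'" "d \<noteq> opp M c" "d \<noteq> a'" "rot M d \<noteq> l" "rot M d \<noteq> opp M et"
  shows "rot N1 d = rot M d"
  using c1.rot_contract_same[OF assms(1)] assms unfolding c1_eqs by simp

lemma vs_H: "vs H = vs M - {hub, s2}"
  by (auto simp: c2.contract_simps c1.contract_simps c2_eqs c1_eqs)

lemma order_H: "order H = order M - 2"
proof -
  have "{hub, s2} \<subseteq> vs M" using src_in[of e] dst_in[of e] by simp
  then show ?thesis
    using neqs card_Diff_subset[of "{hub, s2}" "vs M"] by (simp add: order_def vs_H numeral_2_eq_2)
qed

text \<open>Since \<open>M\<close> is simple, parallel darts of \<open>H\<close> had different ends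
  in \<open>M\<close> at one extremity. These must be \<open>s1\<close> and \<open>s2\<close>, so
  the other extremity is a common neighbour.\<close>

lemma parallel_H:
  assumes d: "d \<in> darts H" "f \<in> darts H" "d \<noteq> f" "src H d = src H f" "dst H d = dst H f"
  obtains "src M d \<in> {s1, s2}" "src M f \<in> {s1, s2}" "src M d \<noteq> src M f" "dst M d = dst M f"
      "adj s1 (dst M d)" "adj s2 (dst M d)"
  | "dst M d \<in> {s1, s2}" "dst M f \<in> {s1, s2}" "dst M d \<noteq> dst M f" "src M d = src M f"
      "adj s1 (src M d)" "adj s2 (src M d)"
proof -
  have D2: "d \<in> D2" "f \<in> D2" and DM: "d \<in> darts M" "f \<in> darts M" using d(1,2) D2_M by (auto simp: darts_H)
  have eq: "merge (src M d) = merge (src M f)" "merge (dst M d) = merge (dst M f)"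
    using d(4,5) by (simp_all add: ends_H D2)
  have loop: "merge (src M x) \<noteq> merge (dst M x)" if "x \<in> D2" for x
    using c2.contracted that triangulation.no_loop[of H x] by (simp add: darts_H ends_H)
  have adjs: "adj (src M d) (dst M d)" "adj (src M f) (dst M f)" using DM adjI by blast+
  have ne: "src M d \<noteq> src M f \<or> dst M d \<noteq> dst M f" using simple_darts[OF DM] d(3) by blast
  show thesis
  proof (cases "src M d = src M f")
    case False
    then have s: "src M d \<in> {s1, s2}" "src M f \<in> {s1, s2}"
      using eq(1) by (auto simp: merge_def split: if_splits)
    then have "merge (src M d) = s1" "merge (src M f) = s1" by (auto simp: merge_def)
    then have "merge (dst M d) \<noteq> s1" "merge (dst M f) \<noteq> s1" using loop D2 by force+
    then have dd: "dst M d = dst M f" using eq(2) by (auto simp: merge_def split: if_splits)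
    show thesis by (rule that(1)) (use s False dd adjs in auto)
  next
    case True
    then have dn: "dst M d \<noteq> dst M f" using ne by blast
    then have s: "dst M d \<in> {s1, s2}" "dst M f \<in> {s1, s2}"
      using eq(2) by (auto simp: merge_def split: if_splits)
    show thesis by (rule that(2)) (use s True dn adjs adj_sym in auto)
  qed
qed

end

section \<open>Recovering the wheel from the folded graph\<close>

context fold
begin

lemma rots: "rot M (opp M g) = opp M es" "rot M (opp M a) = opp M et" "rot M a' = opp M e"
  "rot M (opp M c) = opp M l" "rot M (opp M es) = a" "rot M (opp M et) = ra" "rot M (opp M e) = c"
  "rot M (opp M e1) = g"
proof -
  have "rot M (opp M d) = face_step M d" for d by (simp add: face_step_def)
  then show "rot M (opp M g) = opp M es" "rot M (opp M a) = opp M et" "rot M a' = opp M e"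
  "rot M (opp M c) = opp M l" "rot M (opp M es) = a" "rot M (opp M et) = ra" "rot M (opp M e) = c"
  "rot M (opp M e1) = g" by (simp_all add: steps a'_def)
qed

lemma opp_eqs [simp]: "opp M ra = a'" "opp M a' = ra"
  by (simp_all add: a'_def)

text \<open>The stage between the split and the insertion of the hub. It has a face of length 4 or
  5, so it is not built by \<open>contract\<close>.\<close>

abbreviation "K \<equiv> delete_vertex M hub"

lemma K_simps: "vs K = vs M - {hub}" "darts K = {d \<in> darts M. src M d \<noteq> hub \<and> dst M d \<noteq> hub}"
  "src K d = src M d" "dst K d = dst M d" "opp K d = opp M d"
  "rot K d = (if dst M (rot M d) = hub then rot M (rot M d) else rot M d)"
  by (simp_all add: delete_vertex_def)

lemma add_hub_K: "add_hub K (face K a) M"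
  using hub_deleted(1)[OF deletes_delete_vertex, of es hub] by (simp add: steps)

lemma rot_ra_N1: "rot N1 ra = rot M ra"
proof (rule rot_N1)
  show "ra \<in> c1.D'" by (rule in_D1)
  show "ra \<noteq> opp M c" "ra \<noteq> a'" "rot M ra \<noteq> l" using neqs by (auto intro!: src_neq)
  have "ra \<noteq> opp M a" using neqs by (auto intro!: dst_neq)
  then show "rot M ra \<noteq> opp M et" using rots(2) rot_inj[of ra "opp M a"] by simp
qed

lemma rot_D2_N1:
  assumes "d \<in> D2" "d \<noteq> opp M a" "d \<noteq> opp M c"
  shows "rot N1 d = rot M d"
proof (rule rot_N1)
  show "d \<in> c1.D'" by (rule D2_D1[OF assms(1)])
  show "d \<noteq> a'" using assms(1) by (auto simp: D2_def X2)
  show "rot M d \<noteq> l" using D2_not_hub[OF assms(1)] by (auto intro!: src_neq)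
  show "rot M d \<noteq> opp M et" using rots(2) rot_inj[of d "opp M a"] assms by simp
qed fact

text \<open>Thus the split moves exactly the darts that belong to \<open>s2\<close> in
  \<open>M\<close>, and \<open>s2\<close> itself can serve as the new vertex.\<close>

lemma between_H: "d \<in> D2 \<Longrightarrow> d \<in> between H (opp M g) a \<longleftrightarrow> src M d = s2"
proof -
  assume d: "d \<in> D2"
  have "between H (opp M g) a = N1.out s2 - {es, a', q}"
    using c2.between_contract unfolding c2_eqs .
  moreover have "d \<notin> {es, a', q}" using d by (auto simp: D2_def X2)
  moreover have "d \<in> N1.out s2 \<longleftrightarrow> src M d = s2"
    using D2_D1[OF d] D2_not_hub[OF d] by (simp add: c1.contract_simps)
  ultimately show ?thesis by blast
qed

lemma not_in_D2: "a' \<notin> D2" "ra \<notin> D2" "q \<notin> D2" "opp M q \<notin> D2" "es \<notin> D2" "opp M es \<notin> D2"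
  "e \<notin> D2" "opp M e \<notin> D2" "l \<notin> D2" "opp M l \<notin> D2" "et \<notin> D2" "opp M et \<notin> D2"
  by (auto simp: D2_def X1 X2)

lemma D2_s1:
  assumes "d \<in> darts M" "src M d = s1" "dst M d \<noteq> hub"
  shows "d \<in> D2"
proof -
  have q: "src M q = s2 \<or> src M q = hub" "src M (opp M q) = v1"
    by (simp add: q_def, simp add: src_opp)
  have "d \<notin> c1.X" using assms neqs by (auto simp: X1)
  moreover have "d \<noteq> q" "d \<noteq> opp M q" using q assms neqs by auto
  then have "d \<notin> c2.X" using assms neqs by (auto simp: X2)
  ultimately show ?thesis using assms(1) by (simp add: D2_def)
qed

lemma src_split: "d \<in> D2 \<Longrightarrow> src M d = (if src M d = s2 then s2 else src H d)"
  "d \<in> D2 \<Longrightarrow> dst M d = (if src M (opp M d) = s2 then s2 else dst H d)"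
  using src_opp D2_M by (auto simp: ends_H merge_def)

text \<open>A common neighbour is harmless if its edge to \<open>s2\<close> is contracted away. For
  \<open>v1\<close> this holds only in a 4-wheel, which is what \<open>q = c\<close> says; in a
  5-wheel a second edge from \<open>v1\<close> would remain and become parallel.\<close>

lemma maximal_planar_H:
  assumes "\<And>z. adj s1 z \<Longrightarrow> adj s2 z \<Longrightarrow> z = hub \<or> z = tp \<or> z = v1 \<and> q = c"
  shows "maximal_planar H"
proof -
  interpret H: triangulation H by (rule c2.contracted)
  have no: "dst M d \<noteq> z" if d: "d \<in> D2" "src M d = s2" "adj s1 z" "adj s2 z" for d z
  proof
    assume z: "dst M d = z"
    have "z = tp \<or> z = v1 \<and> q = c" using assms d D2_not_hub[OF d(1)] z by blast
    then have "d = a' \<or> d = q"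
    proof
      assume "z = tp"
      then have "d = a'" using z d D2_M[OF d(1)] by (intro simple_darts) simp_all
      then show ?thesis ..
    next
      assume z': "z = v1 \<and> q = c"
      then have "src M q = s2" by simp
      then have "d = q" using z z' d(2) dst_q simple_darts[OF D2_M[OF d(1)] q_darts] by metis
      then show ?thesis ..
    qed
    then show False using d(1) not_in_D2 by blast
  qed
  show ?thesis
  proof (rule H.maximal_planarI)
    fix d f assume df: "d \<in> darts H" "f \<in> darts H" "d \<noteq> f" "src H d = src H f" "dst H d = dst H f"
    then have D2: "d \<in> D2" "f \<in> D2" by (simp_all add: darts_H)
    from df have False
    proof (cases rule: parallel_H)
      case 1
      then have "src M d = s2 \<or> src M f = s2" by auto
      then show ?thesis using no[of d] no[of f] 1 D2 by auto
    next
      case 2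
      then have "dst M d = s2 \<or> dst M f = s2" by auto
      then show ?thesis
        using no[of "opp M d" "src M d"] no[of "opp M f" "src M f"] 2 D2 D2_M by (auto simp: src_opp dst_opp)
    qed
    then show "bounds_2wheel H d f \<or> bounds_2wheel H f d" ..
  qed
qed

end

locale wheel4 = fold +
  assumes four: "rot M (rot M (rot M e)) = l"
begin

lemma e1_l: "e1 = l" "q = c" "v1 = v2"
proof -
  show e1: "e1 = l" using four[folded et_def, folded es_def, folded e1_def] .
  then show "q = c" by (simp add: q_def)
  have "dst M e1 = dst M l" by (simp only: e1)
  then show "v1 = v2" by simp
qed

lemma rot_l: "rot M (opp M l) = g"
  using rots(8) e1_l by simp

lemma rot_H:
  assumes "d \<in> D2"
  shows "rot H d = (if d = opp M a then rot M ra else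
     let z = if d = opp M g then rot M c else rot M d in
     if z = a' then a else if z = opp M c then g else z)"
proof -
  have d: "d \<noteq> opp M c" using assms not_in_D2(4) e1_l by auto
  have c: "rot N1 c = rot M c"
  proof (rule rot_N1)
    show "c \<in> c1.D'" by (rule in_D1)
    show "c \<noteq> opp M c" "rot M c \<noteq> l" "rot M c \<noteq> opp M et" using neqs by (auto intro!: src_neq)
    show "c \<noteq> a'" using neqs by (auto intro!: dst_neq)
  qed
  have ra: "rot M ra \<noteq> a'" "rot M ra \<noteq> opp M c" using neqs by (auto intro!: src_neq)
  have "d \<in> c2.D'" using assms by (simp add: c2_D')
  from c2.rot_contract[OF this] show ?thesis
    unfolding c2_eqs e1_l N1_opp[OF in_D1(2)]
    using ra rot_D2_N1[OF assms _ d] by (simp add: Let_def rot_ra_N1 c)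
qed

lemma next_hub:
  assumes "d \<in> darts M" "dst M (rot M d) = hub"
  shows "d \<in> {a', opp M a, opp M g, opp M c}"
proof -
  have "opp M (rot M d) \<in> {e, et, es, e1, l}"
    using assms by (intro out_hub) (simp_all add: src_opp)
  then have "opp M (rot M d) \<in> {e, et, es, l}" using e1_l by simp
  then have "opp M (opp M (rot M d)) \<in> opp M ` {e, et, es, l}" by (rule imageI)
  then have "rot M d \<in> {rot M a', rot M (opp M a), rot M (opp M g), rot M (opp M c)}"
    by (simp add: rots)
  then show ?thesis by simp
qed

lemma next_not_hub:
  assumes "d \<in> D2" "d \<noteq> opp M g" "d \<noteq> opp M a"
  shows "dst M (rot M d) \<noteq> hub"
  using next_hub[OF D2_M[OF assms(1)]] assms not_in_D2 e1_l by auto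

lemma darts_K: "darts K = D2 \<union> {a', c, ra, opp M c}"
proof
  show "darts K \<subseteq> D2 \<union> {a', c, ra, opp M c}" by (auto simp: K_simps D2_def X1 X2 e1_l)
  show "D2 \<union> {a', c, ra, opp M c} \<subseteq> darts K"
    using D2_not_hub D2_M neqs by (auto simp: K_simps)
qed

lemma split_path: "split_path H a (opp M g) K"
proof -
  have D2: "a \<in> D2" "opp M g \<in> D2"
    by (rule D2_s1; use neqs in simp)+
  let ?b = "opp M g" and ?B = "between H (opp M g) a"
  have oa: "opp H a = opp M a" and ob: "opp H ?b = g" using D2 by (simp_all add: opp_H)
  have s2H: "s2 \<notin> vs H" by (simp add: vs_H)
  have neq_darts: "distinct [a', c, ra, opp M c]"
    using neqs by (auto dest: arg_cong[where f = "src M"] arg_cong[where f = "dst M"])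
  have rot_gen: "rot K d = (if d = ?b then a else if d = opp H a then ra
        else if rot H d = opp H ?b then opp M c else if d \<in> ?B \<and> rot H d = a then a' else rot H d)"
    if d: "d \<in> D2" for d
  proof -
    have "opp M a \<noteq> ?b" using neqs by (auto intro!: src_neq)
    consider "d = ?b" | "d = opp M a" "d \<noteq> ?b" | "d \<noteq> ?b" "d \<noteq> opp M a" by blast
    then show ?thesis
    proof cases
      case 1 then show ?thesis by (simp add: K_simps rots)
    next
      case 2 then show ?thesis by (simp add: K_simps rots oa)
    next
      case 3
      have K: "rot K d = rot M d" using next_not_hub[OF d] 3 by (simp add: K_simps)
      have H: "rot H d = (if rot M d = a' then a else if rot M d = opp M c then g else rot M d)"
        using rot_H[OF d] 3 by (simp add: Let_def)
      have ag: "a \<noteq> g" "opp M c \<noteq> a'" using neqs by (auto intro!: src_neq)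
      have "rot M d \<noteq> g" using rot_l rot_inj[of d "opp M l"] d not_in_D2 by auto
      moreover have "rot M d \<noteq> a" using rots(5) rot_inj[of d "opp M es"] d not_in_D2 by auto
      moreover have "src M d = s2" if "rot M d = a'" using that src_rot[of d] by simp
      ultimately show ?thesis unfolding K H oa ob using 3 ag between_H[OF d] by auto
    qed
  qed
  have rot_b': "rot K c = (if rot H ?b = a then a' else rot H ?b)"
  proof -
    have "c \<noteq> a'" "c \<noteq> opp M c" using neq_darts by auto
    moreover have "c \<noteq> opp M a" "c \<noteq> opp M g" using neqs by (auto intro!: src_neq)
    ultimately have "dst M (rot M c) \<noteq> hub" using next_hub[of c] by auto
    then have "rot K c = rot M c" by (simp add: K_simps)
    moreover have "rot M c \<noteq> a" "rot M c \<noteq> opp M c" "?b \<noteq> opp M a" using neqs by (auto intro!: src_neq)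
    ultimately show ?thesis using rot_H[OF D2(2)] by (simp add: Let_def)
  qed
  have rot_ra: "rot K ra = rot H (opp H a)"
  proof -
    have "opp M a \<in> D2" using D2 by simp
    then have "rot H (opp M a) = rot M ra" using rot_H by simp
    moreover have "ra \<noteq> a'" "ra \<noteq> opp M c" "ra \<noteq> opp M g" using neqs by (auto intro!: src_neq)
    moreover have "ra \<noteq> opp M a" using neqs by (auto intro!: dst_neq)
    ultimately show ?thesis using next_hub[of ra] by (auto simp: K_simps oa)
  qed
  show ?thesis
    unfolding split_path_def
  proof (intro conjI, goal_cases)
    case 7
    \<comment> \<open>The split restores what the second contraction removed: the vertex
      \<open>s2\<close> with its edges \<open>a'\<close> to \<open>tp\<close> and \<open>c\<close>
      to \<open>v1\<close>.\<close>
    show ?case unfolding Let_def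
    proof (rule exI[of _ s2], rule exI[of _ a'], rule exI[of _ c], rule exI[of _ ra], rule exI[of _ "opp M c"],
        intro conjI ballI)
      show "s2 \<notin> vs H" "distinct [a', c, ra, opp M c]" by fact+
      show "{a', c, ra, opp M c} \<inter> darts H = {}" using not_in_D2 e1_l by (auto simp: darts_H)
      show "vs K = insert s2 (vs H)" using neqs dst_in[of e] by (auto simp: K_simps vs_H)
      show "darts K = darts H \<union> {a', c, ra, opp M c}" by (simp add: darts_K darts_H)
      fix d assume "d \<in> darts H"
      then have d: "d \<in> D2" by (simp add: darts_H)
      show "src K d = (if d \<in> ?B then s2 else src H d)"
        using src_split(1)[OF d] between_H[OF d] by (simp add: K_simps)
      show "dst K d = (if opp H d \<in> ?B then s2 else dst H d)"
        using src_split(2)[OF d] between_H[of "opp M d"] d by (simp add: K_simps opp_H)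
      show "opp K d = opp H d" using d by (simp add: K_simps opp_H)
      show "rot K d = (if d = ?b then a else if d = opp H a then ra
        else if rot H d = opp H ?b then opp M c else if d \<in> ?B \<and> rot H d = a then a' else rot H d)"
        by (rule rot_gen[OF d])
    qed (use rot_b' rot_ra ob D2 e1_l neqs in \<open>simp_all add: K_simps rots ends_H merge_def rot_l\<close>)
  qed (use D2 neqs in \<open>simp_all add: darts_H ends_H merge_def\<close>)
qed

lemma extend: "extend_4wheel H M"
  unfolding extend_4wheel_def using split_path add_hub_K by blast

lemma maximal_planar_H_2wheel:
  assumes four_top: "rot M (rot M ra) = opp M a"
    and z: "dst M (rot M ra) = z" "z \<noteq> hub" "z \<noteq> s1" "z \<noteq> s2" "z \<noteq> v1"
    and common: "\<And>y. adj s1 y \<Longrightarrow> adj s2 y \<Longrightarrow> y = hub \<or> y = tp \<or> y = v1 \<or> y = z"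
  shows "maximal_planar H"
proof -
  interpret H: triangulation H by (rule c2.contracted)
  \<comment> \<open>\<open>f\<close> is the fourth dart at \<open>tp\<close>. It lies in the
    triangles \<open>tp z s2\<close> and \<open>tp z s1\<close>, whose edges from \<open>s2\<close>
    and \<open>s1\<close> to \<open>z\<close> are \<open>d0\<close> and \<open>e0\<close>.\<close>
  define f where "f = rot M ra"
  define d0 where "d0 = opp M (face_step M f)"
  define e0 where "e0 = rot M a"
  have f: "f \<in> darts M" "src M f = tp" "dst M f = z" using z by (simp_all add: f_def)
  have zv2: "z \<noteq> v2" using z(5) by (simp add: e1_l(3))
  have ztp: "z \<noteq> tp" using no_loop[OF f(1)] f by auto
  have step_a': "face_step M a' = f" by (simp add: face_step_def f_def)
  have step_f: "face_step M (face_step M f) = a'"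
    using face_triangle[of a'] by (simp add: step_a')
  have d0: "d0 \<in> darts M" "src M d0 = s2" "dst M d0 = z" "rot M d0 = a'"
  proof -
    show "d0 \<in> darts M" using f by (simp add: d0_def)
    have "dst M (face_step M f) = src M a'" using src_face_step[of "face_step M f"] f step_f by simp
    then show "src M d0 = s2" "dst M d0 = z" using f by (simp_all add: d0_def src_opp dst_opp src_face_step)
    show "rot M d0 = a'" unfolding d0_def by (simp only: face_step_opp[symmetric] opp_opp step_f)
  qed
  have step_opp_a: "face_step M (opp M a) = e0" by (simp add: face_step_opp e0_def)
  have step_opp_f: "face_step M (opp M f) = opp M a" using four_top by (simp add: face_step_opp f_def)
  have step_e0: "face_step M e0 = opp M f"
    using face_triangle[of "opp M f"] f by (simp add: step_opp_f step_opp_a)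
  have e0: "e0 \<in> darts M" "src M e0 = s1" "dst M e0 = z" "rot M (opp M e0) = opp M f"
  proof -
    show e: "e0 \<in> darts M" "src M e0 = s1" by (simp_all add: e0_def)
    show "dst M e0 = z" using src_face_step[OF e(1)] f by (simp add: step_e0 src_opp)
    show "rot M (opp M e0) = opp M f" using step_e0 by (simp add: face_step_def)
  qed
  have rot_f: "rot M (opp M f) = opp M d0" by (simp add: d0_def face_step_def)
  have D2I: "d \<in> D2" if "d \<in> darts M" "src M d = z" "dst M d \<noteq> hub" for d
  proof -
    have "d \<notin> c1.X" using that z neqs by (auto simp: X1)
    moreover have "d \<notin> c2.X" using that z ztp neqs e1_l by (auto simp: X2)
    ultimately show ?thesis using that(1) by (simp add: D2_def)
  qed
  have "opp M d0 \<in> D2" by (rule D2I) (use d0 neqs in \<open>simp_all add: src_opp dst_opp\<close>)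
  moreover have "opp M e0 \<in> D2" by (rule D2I) (use e0 neqs in \<open>simp_all add: src_opp dst_opp\<close>)
  moreover have of: "opp M f \<in> D2" by (rule D2I) (use f neqs in \<open>simp_all add: src_opp dst_opp\<close>)
  ultimately have D2: "d0 \<in> D2" "e0 \<in> D2" "f \<in> D2" by simp_all
  have a: "a \<in> D2" using neqs by (auto intro!: D2_s1)
  have rotH: "rot H d0 = a" "rot H a = e0" "rot H (opp M e0) = opp M f" "rot H (opp M f) = opp M d0"
  proof -
    have ne: "d0 \<noteq> opp M a" "d0 \<noteq> opp M g" "a \<noteq> opp M a" "e0 \<noteq> a'" "e0 \<noteq> opp M c" "opp M d0 \<noteq> a'"
      "opp M d0 \<noteq> opp M c" "opp M f \<noteq> a'" "opp M f \<noteq> opp M c" "opp M f \<noteq> opp M a" "opp M e0 \<noteq> opp M a"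
      "opp M e0 \<noteq> opp M g" "opp M f \<noteq> opp M g"
      by (rule src_neq, use neqs z(2-) zv2 ztp in \<open>simp add: src_opp d0(1-3) e0(1-3) f(1-3)\<close>)+
    have ag: "a \<noteq> opp M g" using neqs by (auto intro!: dst_neq)
    have rot_a: "rot M a = e0" by (simp add: e0_def)
    show "rot H d0 = a" using rot_H[OF D2(1)] ne d0 by (simp add: Let_def)
    show "rot H a = e0" using rot_H[OF a] ne ag rot_a by (simp add: Let_def)
    show "rot H (opp M e0) = opp M f" using rot_H[of "opp M e0"] ne e0 D2 by (simp add: Let_def)
    show "rot H (opp M f) = opp M d0" using rot_H[OF of] ne rot_f by (simp add: Let_def)
  qed
  have deg: "out_degree (skel H) tp = 2"
  proof -
    have out: "d \<in> {opp M a, opp M et, ra, f}" if "d \<in> darts M" "src M d = tp" for d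
    proof (rule closed_rot_out[of _ ra])
      fix d assume "d \<in> {opp M a, opp M et, ra, f}"
      then consider "d = opp M a" | "d = opp M et" | "d = ra" | "d = f" by blast
      then show "rot M d \<in> {opp M a, opp M et, ra, f}"
        by cases (use four_top rots in \<open>simp_all add: f_def\<close>)
    qed (use that in auto)
    have "out_arcs (skel H) tp = {opp M a, f}"
    proof (rule set_eqI)
      fix d
      have tp: "merge v = tp \<longleftrightarrow> v = tp" for v using neqs by (auto simp: merge_def)
      have "d \<in> out_arcs (skel H) tp \<longleftrightarrow> d \<in> D2 \<and> src M d = tp"
        by (auto simp: darts_H ends_H tp)
      also have "\<dots> \<longleftrightarrow> d \<in> {opp M a, f}"
      proof
        assume "d \<in> D2 \<and> src M d = tp"
        then have "d \<in> {opp M a, opp M et, ra, f}" "d \<noteq> opp M et" "d \<noteq> ra"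
          using out[of d] D2_M[of d] not_in_D2 by auto
        then show "d \<in> {opp M a, f}" by blast
      next
        assume "d \<in> {opp M a, f}"
        then consider "d = opp M a" | "d = f" by blast
        then show "d \<in> D2 \<and> src M d = tp" by cases (use a D2 f(2) in simp_all)
      qed
      finally show "d \<in> out_arcs (skel H) tp \<longleftrightarrow> d \<in> {opp M a, f}" .
    qed
    moreover have "opp M a \<noteq> f" using f z by (auto intro!: dst_neq)
    ultimately show ?thesis by (simp add: out_degree_def)
  qed
  have endsH: "dst H a = tp" "dst H (opp M f) = tp"
    using a of neqs f by (simp_all add: ends_H merge_def dst_opp)
  have opps: "opp H e0 = opp M e0" "opp H d0 = opp M d0" "opp H (opp M d0) = d0" "opp H (opp M e0) = e0"
    using D2 by (simp_all add: opp_H)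
  have DH: "a \<in> darts H" "opp M f \<in> darts H" using a of by (simp_all add: darts_H)
  \<comment> \<open>The vertex of degree 2 is \<open>tp\<close>; its spokes are \<open>a\<close>
    from the merged vertex and \<open>opp M f\<close> from \<open>z\<close>. Read from
    \<open>z\<close>, the same 2-wheel has the reversed darts in exchanged order.\<close>
  have bounds: "bounds_2wheel H d0 e0"
    unfolding bounds_2wheel_def
    by (rule bexI[OF _ DH(1)], rule bexI[OF _ DH(2)]) (simp add: rotH opps endsH deg)
  have bounds': "bounds_2wheel H (opp M e0) (opp M d0)"
    unfolding bounds_2wheel_def
    by (rule bexI[OF _ DH(2)], rule bexI[OF _ DH(1)]) (simp add: rotH opps endsH deg)
  \<comment> \<open>Besides \<open>z\<close>, the possible common neighbours are the hub,
    \<open>tp\<close> and \<open>v1\<close>, and their edges to \<open>s2\<close> are not in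
    \<open>H\<close>.\<close>
  have only: "d = e0 \<and> src M d = s1 \<or> d = d0 \<and> src M d = s2"
    if d: "d \<in> D2" "src M d \<in> {s1, s2}" "adj s1 (dst M d)" "adj s2 (dst M d)"
      and d': "d' \<in> D2" "src M d' \<in> {s1, s2}" "src M d \<noteq> src M d'" "dst M d' = dst M d" for d d'
  proof -
    have dM: "d \<in> darts M" "d' \<in> darts M" using d d' D2_M by auto
    obtain h where h: "h \<in> D2" "src M h = s2" "dst M h = dst M d" "h \<in> darts M"
    proof (cases "src M d = s2")
      case True
      then show thesis using that[of d] d(1) dM(1) by simp
    next
      case False
      then have "src M d' = s2" using d(2) d'(2,3) by auto
      then show thesis using that[of d'] d'(1,4) dM(2) by simp
    qed
    have "dst M d = hub \<or> dst M d = tp \<or> dst M d = v1 \<or> dst M d = z" using common d by blast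
    moreover have "dst M d \<noteq> hub" using D2_not_hub d(1) by blast
    moreover have "dst M d \<noteq> tp"
    proof
      assume "dst M d = tp"
      then have "h = a'" using h by (intro simple_darts) simp_all
      then show False using h not_in_D2 by blast
    qed
    moreover have "dst M d \<noteq> v1"
    proof
      assume "dst M d = v1"
      then have "h = c" using h e1_l by (intro simple_darts) simp_all
      then show False using h not_in_D2 e1_l by auto
    qed
    ultimately have dz: "dst M d = z" by blast
    from d(2) consider "src M d = s1" | "src M d = s2" by blast
    then show ?thesis
    proof cases
      case 1
      then have "d = e0" by (intro simple_darts dM e0) (simp_all add: e0 dz)
      then show ?thesis using 1 by blast
    next
      case 2
      then have "d = d0" by (intro simple_darts dM d0) (simp_all add: d0 dz)
      then show ?thesis using 2 by blast
    qed
  qed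
  show ?thesis
  proof (rule H.maximal_planarI)
    fix d h assume df: "d \<in> darts H" "h \<in> darts H" "d \<noteq> h" "src H d = src H h" "dst H d = dst H h"
    then have DD: "d \<in> D2" "h \<in> D2" by (simp_all add: darts_H)
    then have DM: "d \<in> darts M" "h \<in> darts M" using D2_M by auto
    from df show "bounds_2wheel H d h \<or> bounds_2wheel H h d"
    proof (cases rule: parallel_H)
      case 1
      have "d = e0 \<and> src M d = s1 \<or> d = d0 \<and> src M d = s2"
        by (rule only[OF DD(1) 1(1,5,6) DD(2) 1(2,3) 1(4)[symmetric]])
      moreover have "h = e0 \<and> src M h = s1 \<or> h = d0 \<and> src M h = s2"
        by (rule only[OF DD(2) 1(2) 1(5)[unfolded 1(4)] 1(6)[unfolded 1(4)] DD(1) 1(1) 1(3)[symmetric] 1(4)])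
      ultimately have "d = d0 \<and> h = e0 \<or> d = e0 \<and> h = d0" using df(3) by blast
      then show ?thesis using bounds by blast
    next
      case 2
      have e: "src M (opp M d) = dst M d" "dst M (opp M d) = src M d" "src M (opp M h) = dst M h"
        "dst M (opp M h) = src M h" using DM by (simp_all add: src_opp dst_opp)
      have o: "opp M d \<in> D2" "opp M h \<in> D2" using DD by simp_all
      have "opp M d = e0 \<or> opp M d = d0"
        using only[OF o(1) _ _ _ o(2), unfolded e, OF 2(1,5,6,2,3) 2(4)[symmetric]] by blast
      moreover have "opp M h = e0 \<or> opp M h = d0"
        using only[OF o(2) _ _ _ o(1), unfolded e, OF 2(2) 2(5)[unfolded 2(4)] 2(6)[unfolded 2(4)] 2(1) 2(3)[symmetric] 2(4)]
        by blast
      moreover have "opp M d \<noteq> opp M h" using df(3) by simp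
      ultimately have "opp M d = e0 \<and> opp M h = d0 \<or> opp M d = d0 \<and> opp M h = e0" by auto
      moreover have "d = opp M (opp M d)" "h = opp M (opp M h)" by simp_all
      ultimately have "d = opp M e0 \<and> h = opp M d0 \<or> d = opp M d0 \<and> h = opp M e0" by metis
      then show ?thesis using bounds' by blast
    qed
  qed
qed

end

locale wheel5 = fold +
  assumes five: "rot M (rot M (rot M (rot M e))) = l"
    and bottoms: "dst M (rot M (rot M (rot M e))) \<noteq> dst M l"
begin

text \<open>The rim edge between the two bottoms, which has no counterpart in a 4-wheel.\<close>

definition "k = face_step M l"

lemma v1_v2: "v1 \<noteq> v2"
  using bottoms[folded et_def, folded es_def, folded e1_def] by simp

lemma e1_l: "rot M e1 = l" "e1 \<noteq> l" "q = e1"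
proof -
  show "rot M e1 = l" using five[folded et_def, folded es_def, folded e1_def] .
  show "e1 \<noteq> l"
  proof
    assume "e1 = l"
    then have "dst M e1 = dst M l" by (simp only:)
    then show False using v1_v2 by simp
  qed
  then show "q = e1" by (simp add: q_def)
qed

lemma k: "k \<in> darts M" "src M k = v2" "dst M k = v1" "rot M (opp M l) = k" "rot M (opp M k) = opp M e1"
proof -
  show "k \<in> darts M" "src M k = v2" by (simp_all add: k_def src_face_step)
  have s: "face_step M k = opp M e1" unfolding k_def using face_step_rot[of e1] e1_l by simp
  then show "rot M (opp M k) = opp M e1" "rot M (opp M l) = k" by (simp_all add: face_step_def k_def)
  have "dst M k = src M (face_step M k)" using \<open>k \<in> darts M\<close> by (simp add: src_face_step)
  then show "dst M k = v1" by (simp add: s)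
qed

lemma rot_H:
  assumes "d \<in> D2"
  shows "rot H d = (if d = opp M a then rot M ra else if d = opp M g then c else if d = opp M c then k else
     if rot M d = a' then a else if rot M d = opp M e1 then g else rot M d)"
proof -
  have e1: "rot N1 e1 = c"
  proof -
    have "e1 \<in> c1.D'" using in_D1 e1_l by simp
    moreover have "e1 \<noteq> opp M c" "e1 \<noteq> a'" using neqs by (auto intro!: src_neq)
    ultimately show ?thesis using c1.rot_contract[of e1] e1_l unfolding c1_eqs by (simp add: Let_def)
  qed
  have c: "rot N1 (opp M c) = k"
  proof -
    have "opp M c \<in> c1.D'" using in_D1 by simp
    moreover have "k \<noteq> l" "k \<noteq> opp M et" using neqs k by (auto intro!: src_neq)
    ultimately show ?thesis using c1.rot_contract[of "opp M c"] k unfolding c1_eqs by (simp add: Let_def)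
  qed
  have ne: "rot M ra \<noteq> a'" "rot M ra \<noteq> opp M e1" "c \<noteq> opp M e1" "k \<noteq> a'" "k \<noteq> opp M e1"
    "opp M a \<noteq> opp M c" "opp M g \<noteq> opp M c"
    using neqs k v1_v2 by (auto intro!: src_neq simp del: opp_inj)
  have ne': "c \<noteq> a'" using neqs by (auto intro!: dst_neq)
  have "d \<in> c2.D'" using assms by (simp add: c2_D')
  from c2.rot_contract[OF this] show ?thesis
    unfolding c2_eqs e1_l N1_opp[OF in_D1(2)]
    using ne ne' rot_D2_N1[OF assms] by (simp add: Let_def rot_ra_N1 c e1)
qed

lemma next_hub:
  assumes "d \<in> darts M" "dst M (rot M d) = hub"
  shows "d \<in> {a', opp M a, opp M g, opp M k, opp M c}"
proof -
  have "opp M (rot M d) \<in> {e, et, es, e1, l}"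
    using assms by (intro out_hub) (simp_all add: src_opp)
  then have "opp M (opp M (rot M d)) \<in> opp M ` {e, et, es, e1, l}" by (rule imageI)
  then have "rot M d \<in> {rot M a', rot M (opp M a), rot M (opp M g), rot M (opp M k), rot M (opp M c)}"
    by (simp add: rots k)
  then show ?thesis by simp
qed

lemma darts_K: "darts K = D2 \<union> {a', ra}"
proof
  show "darts K \<subseteq> D2 \<union> {a', ra}" by (auto simp: K_simps D2_def X1 X2 e1_l)
  show "D2 \<union> {a', ra} \<subseteq> darts K"
    using D2_not_hub D2_M neqs by (auto simp: K_simps)
qed

lemma split_funnel: "split_funnel H a (opp M g) c K"
proof -
  interpret H: triangulation H by (rule c2.contracted)
  have D2I: "d \<in> D2" if "d \<in> darts M" "src M d \<noteq> hub" "dst M d \<noteq> hub" "d \<noteq> a'" "d \<noteq> ra" for d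
  proof -
    have "d \<in> darts K" using that by (simp add: K_simps)
    then show ?thesis using that unfolding darts_K by blast
  qed
  have D2: "a \<in> D2" "opp M g \<in> D2" "c \<in> D2"
    by (rule D2I;
      use neqs in \<open>auto dest: arg_cong[where f = "src M"] arg_cong[where f = "dst M"]\<close>)+
  let ?b = "opp M g" and ?B = "between H (opp M g) a"
  have oa: "opp H a = opp M a" and ob: "opp H ?b = g" using D2 by (simp_all add: opp_H)
  have Hb: "rot H ?b = c" using rot_H[OF D2(2)] neqs src_neq[of ?b "opp M a"] by simp
  have funnel_H: "funnel H a ?b c"
    unfolding funnel_def
  proof (intro conjI)
    show "a \<in> darts H" "?b \<in> darts H" "c \<in> darts H" using D2 by (simp_all add: darts_H)
    show "src H a = src H ?b" "src H c = src H ?b" "distinct [src H a, dst H a, dst H ?b, dst H c]"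
      using D2 neqs v1_v2 by (simp_all add: ends_H merge_def)
    show "rot H ?b = c" by (rule Hb)
    \<comment> \<open>Since \<open>H\<close> is a triangulation, consecutive bottoms automatically
      span a face with the stem.\<close>
    have "face_step H (opp H ?b) = c" using Hb by (simp add: H.face_step_opp)
    then show "face_step H (face_step H c) = opp H ?b"
      using H.face_triangle[OF H.opp_in, of ?b] D2(2) unfolding darts_H by simp
  qed
  have rot_gen: "rot K d = (if d = ?b then a else if d = opp H a then ra
        else if d \<in> ?B \<and> rot H d = a then a' else rot H d)"
    if d: "d \<in> D2" for d
  proof -
    have ne: "opp M a \<noteq> ?b" "opp M c \<noteq> ?b" "opp M a \<noteq> opp M c" "opp M k \<noteq> ?b" "opp M k \<noteq> opp M c"
      "opp M k \<noteq> opp M a" "opp M e1 \<noteq> a'" "k \<noteq> a" "g \<noteq> a"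
      using neqs k v1_v2 by (auto intro!: src_neq simp del: opp_inj simp: src_opp)
    have da: "d \<noteq> a'" using d not_in_D2 by auto
    have k_dst: "dst M k \<noteq> hub" using k neqs by simp
    consider "d = ?b" | "d = opp M a" "d \<noteq> ?b" | "d = opp M c" "d \<noteq> ?b" "d \<noteq> opp M a"
      | "d = opp M k" "d \<noteq> ?b" "d \<noteq> opp M a" "d \<noteq> opp M c"
      | "d \<noteq> ?b" "d \<noteq> opp M a" "d \<noteq> opp M c" "d \<noteq> opp M k" by blast
    then show ?thesis
    proof cases
      case 1 then show ?thesis by (simp add: K_simps rots)
    next
      case 2 then show ?thesis by (simp add: K_simps rots oa)
    next
      case 3 then show ?thesis using rot_H[OF d] ne by (simp add: K_simps rots oa k)
    next
      case 4 then show ?thesis using rot_H[OF d] ne by (simp add: K_simps rots oa k)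
    next
      case 5
      have K: "rot K d = rot M d" using next_hub[OF D2_M[OF d]] 5 da by (auto simp: K_simps)
      have "rot M d \<noteq> opp M e1" using k(5) rot_inj[of d "opp M k"] 5 by simp
      then have H: "rot H d = (if rot M d = a' then a else rot M d)"
        using rot_H[OF d] 5 by simp
      have "rot M d \<noteq> a" using rots(5) rot_inj[of d "opp M es"] d not_in_D2 by auto
      moreover have "src M d = s2" if "rot M d = a'" using that src_rot[of d] by simp
      ultimately show ?thesis unfolding K H oa using 5 between_H[OF d] by auto
    qed
  qed
  have rot_ra: "rot K ra = rot H (opp H a)"
  proof -
    have "opp M a \<in> D2" using D2 by simp
    then have "rot H (opp M a) = rot M ra" using rot_H by simp
    moreover have "ra \<noteq> a'" "ra \<noteq> opp M g" "ra \<noteq> opp M k" "ra \<noteq> opp M c"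
      using neqs k by (auto intro!: src_neq simp: src_opp)
    moreover have "ra \<noteq> opp M a" using neqs by (auto intro!: dst_neq)
    ultimately show ?thesis using next_hub[of ra] by (auto simp: K_simps oa)
  qed
  show ?thesis
    unfolding split_funnel_def
  proof (intro conjI, goal_cases)
    case 2
    \<comment> \<open>Only the edge of \<open>a'\<close> is new: \<open>c\<close> survives both
      contractions and becomes the dart from the stem to the second bottom.\<close>
    show ?case unfolding Let_def
    proof (rule exI[of _ s2], rule exI[of _ a'], rule exI[of _ ra], intro conjI ballI)
      show "s2 \<notin> vs H" by (simp add: vs_H)
      show "a' \<noteq> ra" using neqs by (auto intro!: src_neq)
      show "{a', ra} \<inter> darts H = {}" using not_in_D2 by (auto simp: darts_H)
      show "vs K = insert s2 (vs H)" using neqs dst_in[of e] by (auto simp: K_simps vs_H)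
      show "darts K = darts H \<union> {a', ra}" by (simp add: darts_K darts_H)
      fix d assume "d \<in> darts H"
      then have d: "d \<in> D2" by (simp add: darts_H)
      show "src K d = (if d \<in> ?B then s2 else src H d)"
        using src_split(1)[OF d] between_H[OF d] by (simp add: K_simps)
      show "dst K d = (if opp H d \<in> ?B then s2 else dst H d)"
        using src_split(2)[OF d] between_H[of "opp M d"] d by (simp add: K_simps opp_H)
      show "opp K d = opp H d" using d by (simp add: K_simps opp_H)
      show "rot K d = (if d = ?b then a else if d = opp H a then ra
        else if d \<in> ?B \<and> rot H d = a then a' else rot H d)"
        by (rule rot_gen[OF d])
    qed (use rot_ra D2 neqs in \<open>simp_all add: K_simps rots ends_H merge_def\<close>)
  qed (rule funnel_H)
qed

lemma extend: "extend_5wheel H M"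
  unfolding extend_5wheel_def using split_funnel add_hub_K by blast

end

section \<open>Sides of triangles\<close>

context simple_triangulation
begin

lemma card_out_to:
  assumes "\<And>u. u \<in> N \<Longrightarrow> adj v u"
  shows "card {d \<in> out v. dst M d \<in> N} = card N"
proof (rule bij_betw_same_card[of "dst M"], rule bij_betw_imageI)
  show "inj_on (dst M) {d \<in> out v. dst M d \<in> N}"
    by (rule inj_onI) (auto intro: simple_darts)
  show "dst M ` {d \<in> out v. dst M d \<in> N} = N"
  proof
    show "N \<subseteq> dst M ` {d \<in> out v. dst M d \<in> N}"
    proof
      fix u assume u: "u \<in> N"
      then obtain d where "d \<in> darts M" "src M d = v" "dst M d = u" using assms unfolding adj_def by blast
      then have "d \<in> {d \<in> out v. dst M d \<in> N}" "dst M d = u" using u by auto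
      then show "u \<in> dst M ` {d \<in> out v. dst M d \<in> N}" by blast
    qed
  qed auto
qed

definition triangle :: "'a set \<Rightarrow> bool" where
  "triangle T \<longleftrightarrow> card T = 3 \<and> (\<forall>u \<in> T. \<forall>v \<in> T. u \<noteq> v \<longrightarrow> adj u v)"

text \<open>Neither side is marked as the inner one; \<open>side_compl\<close> exchanges them. An
  equivalence is possible because a triangle in a simple graph has no chords.\<close>

definition side :: "'a set \<Rightarrow> 'b set \<Rightarrow> bool" where
  "side T S \<longleftrightarrow> closed_faces S \<and>
     (\<forall>d \<in> darts M. (d \<in> S) \<noteq> (opp M d \<in> S) \<longleftrightarrow> src M d \<in> T \<and> dst M d \<in> T)"

lemma triangleI:
  assumes "adj u v" "adj v w" "adj w u" "u \<noteq> v" "v \<noteq> w" "w \<noteq> u"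
  shows "triangle {u, v, w}"
  unfolding triangle_def using assms adj_sym by auto

lemma triangle_finite: "triangle T \<Longrightarrow> finite T"
  unfolding triangle_def using card.infinite by fastforce

lemma triangle_out:
  assumes T: "triangle T" "v \<in> T"
  shows "card {d \<in> out v. dst M d \<in> T} = 2"
proof -
  have "{d \<in> out v. dst M d \<in> T} = {d \<in> out v. dst M d \<in> T - {v}}" by (auto dest: no_loop)
  moreover have "card {d \<in> out v. dst M d \<in> T - {v}} = card (T - {v})"
    by (rule card_out_to) (use T in \<open>auto simp: triangle_def\<close>)
  moreover have "card (T - {v}) = 2" using T by (simp add: triangle_def)
  ultimately show ?thesis by simp
qed

lemma triangle_out_ex:
  assumes "triangle T" "v \<in> T"
  obtains d where "d \<in> darts M" "src M d = v" "dst M d \<in> T"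
proof -
  have "{d \<in> out v. dst M d \<in> T} \<noteq> {}"
  proof
    assume "{d \<in> out v. dst M d \<in> T} = {}"
    then have "card {d \<in> out v. dst M d \<in> T} = 0" by (simp only: card.empty)
    then show False using triangle_out[OF assms] by simp
  qed
  then show thesis using that by auto
qed

lemma side_exists:
  assumes T: "triangle T"
  obtains S where "side T S"
proof -
  have "even (card {d \<in> out v. src M d \<in> T \<and> dst M d \<in> T})" for v
  proof (cases "v \<in> T")
    case True
    then have "{d \<in> out v. src M d \<in> T \<and> dst M d \<in> T} = {d \<in> out v. dst M d \<in> T}" by auto
    then show ?thesis using triangle_out[OF T True] by simp
  next
    case False
    then have "{d \<in> out v. src M d \<in> T \<and> dst M d \<in> T} = {}" by auto
    then show ?thesis by (simp only: card.empty) simp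
  qed
  then obtain S where "closed_faces S"
    "\<And>d. d \<in> darts M \<Longrightarrow> (d \<in> S) \<noteq> (opp M d \<in> S) \<longleftrightarrow> src M d \<in> T \<and> dst M d \<in> T"
    using even_darts_bound_region[of "\<lambda>d. src M d \<in> T \<and> dst M d \<in> T"] src_opp dst_opp by auto
  then show thesis using that unfolding side_def by blast
qed

lemma side_edge: "side T S \<Longrightarrow> d \<in> darts M \<Longrightarrow> src M d \<in> T \<Longrightarrow> dst M d \<in> T \<Longrightarrow> opp M d \<in> S \<longleftrightarrow> d \<notin> S"
  unfolding side_def by blast

lemma side_other: "side T S \<Longrightarrow> d \<in> darts M \<Longrightarrow> src M d \<notin> T \<or> dst M d \<notin> T \<Longrightarrow> opp M d \<in> S \<longleftrightarrow> d \<in> S"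
  unfolding side_def by blast

lemma side_closed: "side T S \<Longrightarrow> closed_faces S"
  by (simp add: side_def)

lemma side_sub: "side T S \<Longrightarrow> S \<subseteq> darts M"
  by (simp add: side_def closed_faces_def)

lemma side_compl: "side T S \<Longrightarrow> side T (darts M - S)"
  unfolding side_def using closed_faces_Diff[OF closed_faces_darts, of S] by auto

lemma side_avoiding:
  assumes "triangle T"
  obtains S where "side T S" "d \<notin> S"
  using side_exists[OF assms] side_compl by (metis DiffD2)

text \<open>Weaker than \<open>side\<close>, since a 4-cycle may have chords: their ends lie in
  \<open>Z\<close> although the border does not run along them.\<close>

definition cut :: "'a set \<Rightarrow> 'b set \<Rightarrow> bool" where
  "cut Z S \<longleftrightarrow> closed_faces S \<and>
     (\<forall>d \<in> darts M. (d \<in> S) \<noteq> (opp M d \<in> S) \<longrightarrow> src M d \<in> Z \<and> dst M d \<in> Z)"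

lemma side_imp_cut: "side T S \<Longrightarrow> cut T S"
  unfolding side_def cut_def by blast

lemma cut_other: "cut Z S \<Longrightarrow> d \<in> darts M \<Longrightarrow> src M d \<notin> Z \<or> dst M d \<notin> Z \<Longrightarrow> opp M d \<in> S \<longleftrightarrow> d \<in> S"
  unfolding cut_def by blast

lemma cut_rot: "cut Z S \<Longrightarrow> rot M d \<in> S \<longleftrightarrow> opp M d \<in> S"
  unfolding cut_def by (simp add: closed_faces_rot)

text \<open>No edge at a vertex off \<open>Z\<close> is crossed by the cut, so the rotation there
  never changes sides.\<close>

lemma cut_out:
  assumes S: "cut Z S" and v: "v \<notin> Z" and d: "d \<in> out v" "e \<in> out v"
  shows "d \<in> S \<longleftrightarrow> e \<in> S"
proof -
  have "f \<in> S" if h: "h \<in> S" "h \<in> out v" "f \<in> out v" for h f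
  proof -
    have "f \<in> S \<inter> out v"
    proof (rule closed_rot_out[of _ h])
      fix g assume g: "g \<in> S \<inter> out v"
      then have "opp M g \<in> S" using cut_other[OF S, of g] v by auto
      then show "rot M g \<in> S \<inter> out v" using g cut_rot[OF S] by simp
    qed (use h in auto)
    then show ?thesis by simp
  qed
  then show ?thesis using d by blast
qed

lemmas side_out = cut_out[OF side_imp_cut]

text \<open>The boundary \<open>B\<close> of \<open>U\<close> runs along the triangle only, and by
  parity it contains both or none of the triangle edges at each corner. If it is empty,
  \<open>U\<close> is trivial in the whole graph; if it is the full triangle, \<open>S - U\<close>
  has empty boundary.\<close>

lemma side_connected:
  assumes T: "triangle T" and S: "side T S" and U: "closed_faces U" "U \<subseteq> S"
    and opp: "\<And>d. d \<in> S \<Longrightarrow> opp M d \<in> S \<Longrightarrow> d \<in> U \<longleftrightarrow> opp M d \<in> U"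
  shows "U = {} \<or> U = S"
proof -
  define B where "B d \<longleftrightarrow> (d \<in> U) \<noteq> (opp M d \<in> U)" for d
  have B_opp: "B (opp M d) \<longleftrightarrow> B d" for d by (auto simp: B_def)
  have B_T: "src M d \<in> T \<and> dst M d \<in> T" if d: "d \<in> darts M" "B d" for d
  proof (rule ccontr)
    assume "\<not> ?thesis"
    then have "opp M d \<in> S \<longleftrightarrow> d \<in> S" using side_other[OF S d(1)] by blast
    moreover have "d \<in> S \<or> opp M d \<in> S" using d(2) U(2) unfolding B_def by blast
    ultimately show False using opp[of d] d(2) unfolding B_def by blast
  qed
  have full: "B f" if d: "d \<in> darts M" "B d" and f: "f \<in> darts M" "src M f = src M d" "dst M f \<in> T" for d f
  proof -
    let ?v = "src M d"
    have v: "?v \<in> T" using B_T[OF d] by blast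
    have fin: "finite {f \<in> out ?v. dst M f \<in> T}" by (rule finite_subset[OF _ finite_out]) auto
    have sub: "{f \<in> out ?v. B f} \<subseteq> {f \<in> out ?v. dst M f \<in> T}" using B_T by auto
    have "d \<in> {f \<in> out ?v. B f}" using d by simp
    then have "card {f \<in> out ?v. B f} \<noteq> 0" using finite_subset[OF sub fin] by auto
    moreover have "even (card {f \<in> out ?v. B f})" unfolding B_def by (rule even_bd[OF U(1)])
    ultimately have "2 \<le> card {f \<in> out ?v. B f}" by presburger
    then have "{f \<in> out ?v. B f} = {f \<in> out ?v. dst M f \<in> T}"
      using triangle_out[OF T v] by (intro card_seteq[OF fin sub]) simp
    then show ?thesis using f by auto
  qed
  show ?thesis
  proof (cases "\<exists>d \<in> darts M. B d")
    case False
    then have "opp M d \<in> U \<longleftrightarrow> d \<in> U" if "d \<in> darts M" for d using that unfolding B_def by blast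
    from closed_faces_opp_trivial[OF U(1) this] show ?thesis using U(2) side_sub[OF S] by blast
  next
    case True
    then obtain d where d: "d \<in> darts M" "B d" by blast
    have all: "B f" if f: "f \<in> darts M" "src M f \<in> T" "dst M f \<in> T" for f
    proof (cases "src M f = src M d")
      case True then show ?thesis using full[OF d f(1)] f(3) by simp
    next
      case False
      have "adj (src M d) (src M f)" using False B_T[OF d] f T unfolding triangle_def by auto
      then obtain g where g: "g \<in> darts M" "src M g = src M d" "dst M g = src M f" unfolding adj_def by blast
      then have "B (opp M g)" using full[OF d g(1,2)] f(2) B_opp by simp
      moreover have "opp M g \<in> darts M" "src M (opp M g) = src M f" using g by (simp_all add: src_opp)
      ultimately show ?thesis using full[of "opp M g" f] f by simp
    qed
    have SU: "closed_faces (S - U)" by (rule closed_faces_Diff[OF side_closed[OF S] U(1)])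
    have "opp M f \<in> S - U \<longleftrightarrow> f \<in> S - U" if f: "f \<in> darts M" for f
    proof (cases "src M f \<in> T \<and> dst M f \<in> T")
      case True
      then have "B f" using all f by blast
      moreover have "opp M f \<in> S \<longleftrightarrow> f \<notin> S" using side_edge[OF S f] True by blast
      ultimately show ?thesis using U(2) unfolding B_def by blast
    next
      case False
      then have "opp M f \<in> S \<longleftrightarrow> f \<in> S" using side_other[OF S f] by blast
      moreover have "\<not> B f" using B_T[OF f] False by blast
      ultimately show ?thesis unfolding B_def by blast
    qed
    from closed_faces_opp_trivial[OF SU this] have "S - U = {} \<or> S - U = darts M" .
    moreover have "S - U \<noteq> darts M" using d U(2) side_sub[OF S] unfolding B_def by blast
    ultimately show ?thesis using U(2) by blast
  qed
qed

definition interior :: "'b set \<Rightarrow> 'a set" where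
  "interior S = {v \<in> vs M. out v \<subseteq> S}"

lemma out_nonempty: "v \<in> vs M \<Longrightarrow> \<exists>d. d \<in> out v"
  using rot_cyclic[of v] unfolding cyclic_on_def out_def by blast

lemma interiorI:
  assumes "side T S" "d \<in> S" "src M d \<notin> T"
  shows "src M d \<in> interior S"
proof -
  have d: "d \<in> darts M" using assms(1,2) side_sub by blast
  then have "e \<in> S" if "e \<in> out (src M d)" for e
    using side_out[OF assms(1,3) _ that, of d] assms(2) by simp
  then show ?thesis using src_in[OF d] unfolding interior_def by blast
qed

lemma interior_not_T:
  assumes T: "triangle T" and S: "side T S" and v: "v \<in> interior S"
  shows "v \<notin> T"
proof
  assume vT: "v \<in> T"
  obtain d where d: "d \<in> out v" "dst M d \<in> T" by (rule triangle_out_ex[OF T vT]) auto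
  then have "d \<in> S" "rot M d \<in> S" using v by (auto simp: interior_def)
  then have "opp M d \<in> S" using closed_faces_rot[OF side_closed[OF S]] by simp
  then show False using side_edge[OF S, of d] d vT \<open>d \<in> S\<close> by auto
qed

lemma interior_dart:
  assumes S: "side T S" and v: "src M d \<in> interior S" and d: "d \<in> darts M"
  shows "d \<in> S" "opp M d \<in> S"
proof -
  have "d \<in> S" "rot M d \<in> S" using v d by (auto simp: interior_def)
  then show "d \<in> S" "opp M d \<in> S" using closed_faces_rot[OF side_closed[OF S]] by simp_all
qed

lemma interior_adj:
  assumes S: "side T S" and v: "v \<in> interior S" and adj: "adj v u"
  shows "u \<in> T \<or> u \<in> interior S"
proof -
  obtain d where d: "d \<in> darts M" "src M d = v" "dst M d = u" using adj unfolding adj_def by blast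
  then have "opp M d \<in> S" using interior_dart(2)[OF S _ d(1)] v by simp
  then show ?thesis using interiorI[OF S, of "opp M d"] d by (auto simp: src_opp)
qed

text \<open>A face has three darts; the bound excludes sides that are just a face.\<close>

definition region :: "'a set \<Rightarrow> 'b set \<Rightarrow> bool" where
  "region T S \<longleftrightarrow> triangle T \<and> side T S \<and> card S > 3"

text \<open>Minimal over all triangles and both of their sides at once, so that it can be compared
  with sides of triangles through \<open>z\<close>.\<close>

definition minimal_region :: "'a set \<Rightarrow> 'b set \<Rightarrow> bool" where
  "minimal_region T S \<longleftrightarrow> region T S \<and> (\<forall>T' S'. region T' S' \<longrightarrow> card S \<le> card S')"

definition corners :: "'b \<Rightarrow> 'a set" where
  "corners d = {src M d, dst M d, dst M (face_step M d)}"

lemma face_ends: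
  assumes "d \<in> darts M"
  shows "src M (face_step M d) = dst M d"
    "src M (face_step M (face_step M d)) = dst M (face_step M d)"
    "dst M (face_step M (face_step M d)) = src M d"
    "src M d \<noteq> dst M d" "dst M d \<noteq> dst M (face_step M d)" "src M d \<noteq> dst M (face_step M d)"
proof -
  show 1: "src M (face_step M d) = dst M d"
    "src M (face_step M (face_step M d)) = dst M (face_step M d)"
    "dst M (face_step M (face_step M d)) = src M d"
    using assms by (simp_all add: src_face_step dst_face_step2)
  show "src M d \<noteq> dst M d" using assms by (rule no_loop)
  show "dst M d \<noteq> dst M (face_step M d)" using no_loop[of "face_step M d"] assms 1 by simp
  show "src M d \<noteq> dst M (face_step M d)"
    using no_loop[of "face_step M (face_step M d)"] assms 1 by simp
qed

lemma triangle_corners: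
  assumes d: "d \<in> darts M"
  shows "triangle (corners d)"
  unfolding corners_def
proof (rule triangleI)
  show "adj (src M d) (dst M d)" using adjI[OF d] .
  show "adj (dst M d) (dst M (face_step M d))"
    using adjI[of "face_step M d"] d face_ends[OF d] by simp
  show "adj (dst M (face_step M d)) (src M d)"
    using adjI[of "face_step M (face_step M d)"] d face_ends[OF d] by simp
qed (use face_ends[OF d] in auto)

lemma side_face:
  assumes d: "d \<in> darts M"
  shows "side (corners d) (face M d)"
  unfolding side_def
proof (intro conjI ballI)
  show "closed_faces (face M d)" by (rule closed_faces_face[OF d])
  note fe = face_ends[OF d]
  let ?d1 = "face_step M d" and ?d2 = "face_step M (face_step M d)"
  have in_T: "src M f \<in> corners d \<and> dst M f \<in> corners d" if "f \<in> face M d" for f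
    using that fe unfolding face_eq[OF d] corners_def by auto
  fix f assume f: "f \<in> darts M"
  show "(f \<in> face M d) \<noteq> (opp M f \<in> face M d) \<longleftrightarrow> src M f \<in> corners d \<and> dst M f \<in> corners d"
  proof
    assume "(f \<in> face M d) \<noteq> (opp M f \<in> face M d)"
    then consider "f \<in> face M d" | "opp M f \<in> face M d" by blast
    then show "src M f \<in> corners d \<and> dst M f \<in> corners d"
      by cases (use in_T[of f] in_T[of "opp M f"] f in \<open>auto simp: src_opp dst_opp\<close>)
  next
    assume "src M f \<in> corners d \<and> dst M f \<in> corners d"
    then have ends: "src M f \<in> {src M d, src M ?d1, src M ?d2}" "dst M f \<in> {src M d, src M ?d1, src M ?d2}"
      using fe by (auto simp: corners_def)
    have succ: "f \<in> face M d" if f: "f \<in> darts M" and c: "src M f = src M h \<and> dst M f = dst M h"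
      and h: "h \<in> {d, ?d1, ?d2}" for f h
    proof -
      have "h \<in> darts M" using h d by auto
      then have "f = h" using simple_darts[OF f, of h] c by blast
      then show ?thesis using h by (simp add: face_eq[OF d])
    qed
    have "f \<in> face M d \<or> opp M f \<in> face M d"
    proof -
      have loop: "src M f \<noteq> dst M f" by (rule no_loop[OF f])
      have o: "opp M f \<in> darts M" "src M (opp M f) = dst M f" "dst M (opp M f) = src M f"
        using f by (simp_all add: src_opp dst_opp)
      have "\<exists>h \<in> {d, ?d1, ?d2}. src M f = src M h \<and> dst M f = dst M h \<or> dst M f = src M h \<and> src M f = dst M h"
        using ends loop fe by auto
      then show ?thesis using succ[OF f] succ[OF o(1)] unfolding o(2,3) by blast
    qed
    moreover have "\<not> (f \<in> face M d \<and> opp M f \<in> face M d)"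
    proof
      assume a: "f \<in> face M d \<and> opp M f \<in> face M d"
      have "src M (opp M f) = dst M f" "dst M (opp M f) = src M f" using f by (simp_all add: src_opp dst_opp)
      then show False using a fe unfolding face_eq[OF d] by auto
    qed
    ultimately show "(f \<in> face M d) \<noteq> (opp M f \<in> face M d)" by blast
  qed
qed

lemma card_face_darts: "d \<in> darts M \<Longrightarrow> card (face M d) = 3"
  using card_face[of "face M d"] by (simp add: faces_def)

lemma minimal_region_exists:
  assumes "8 \<le> order M"
  obtains T S where "minimal_region T S"
proof -
  \<comment> \<open>36 = 6 * 8 - 12. The complement of any face is then a region, so a minimal one
    exists.\<close>
  have cd: "card (darts M) \<ge> 36" using euler6 assms by (simp add: order_def)
  then obtain d where d: "d \<in> darts M" by fastforce
  have "side (corners d) (darts M - face M d)" by (rule side_compl[OF side_face[OF d]])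
  moreover have "card (darts M - face M d) = card (darts M) - 3"
    using card_face_darts[OF d] closed_faces_face[OF d]
    by (subst card_Diff_subset) (auto simp: closed_faces_def face_eq d)
  ultimately have "region (corners d) (darts M - face M d)"
    using triangle_corners[OF d] cd by (simp add: region_def)
  then have "\<exists>S T. region T S" by blast
  then obtain S where S: "\<exists>T. region T S" "\<And>S'. (\<exists>T. region T S') \<Longrightarrow> card S \<le> card S'"
    using ex_has_least_nat[of "\<lambda>S. \<exists>T. region T S" _ card] by metis
  then show thesis using that unfolding minimal_region_def by blast
qed

lemma minimal_regionD:
  assumes "minimal_region T S" "triangle T'" "side T' S'" "S' \<subset> S"
  shows "card S' \<le> 3"
proof (rule ccontr)
  assume "\<not> card S' \<le> 3"
  then have "region T' S'" using assms by (simp add: region_def)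
  then have "card S \<le> card S'" using assms(1) by (auto simp: minimal_region_def)
  moreover have "finite S"
    using assms(1) finite_closed_faces side_closed unfolding minimal_region_def region_def by blast
  ultimately show False using psubset_card_mono[OF _ assms(4)] by simp
qed

text \<open>Otherwise all edges of the face at \<open>d\<close> lie on the triangle, and by
  \<open>side_connected\<close> the face fills \<open>S\<close>.\<close>

lemma region_third_vertex:
  assumes R: "region T S" and d: "d \<in> S" "src M d \<in> T" "dst M d \<in> T"
  shows "dst M (face_step M d) \<notin> T"
proof
  assume z: "dst M (face_step M d) \<in> T"
  have T: "triangle T" and S: "side T S" and c: "card S > 3" using R by (auto simp: region_def)
  have dM: "d \<in> darts M" using d(1) side_sub[OF S] by blast
  have in_T: "src M f \<in> T \<and> dst M f \<in> T" if "f \<in> face M d" for f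
    using that face_ends[OF dM] d z unfolding face_eq[OF dM] by auto
  have sub: "face M d \<subseteq> S" by (rule face_subset[OF side_closed[OF S] d(1)])
  have "face M d = {} \<or> face M d = S"
  proof (rule side_connected[OF T S closed_faces_face[OF dM] sub])
    fix f assume f: "f \<in> S" "opp M f \<in> S"
    have fM: "f \<in> darts M" using f side_sub[OF S] by blast
    have "\<not> (src M f \<in> T \<and> dst M f \<in> T)" using side_edge[OF S fM] f by blast
    then show "f \<in> face M d \<longleftrightarrow> opp M f \<in> face M d"
      using in_T[of f] in_T[of "opp M f"] fM by (auto simp: src_opp dst_opp)
  qed
  then show False using c card_face_darts[OF dM] in_face_self[OF dM] by auto
qed

text \<open>Of the six darts along the triangle, \<open>opp\<close> exchanges those in
  \<open>S\<close> with those outside \<open>S\<close>.\<close>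

lemma card_T_darts:
  assumes T: "triangle T" and S: "side T S"
  shows "card {d \<in> S. src M d \<in> T \<and> dst M d \<in> T} = 3"
proof -
  let ?E = "{d \<in> darts M. src M d \<in> T \<and> dst M d \<in> T}"
  let ?ES = "{d \<in> S. src M d \<in> T \<and> dst M d \<in> T}"
  have fin: "finite ?E" using finite_darts by simp
  have "?E = (\<Union>v \<in> T. {d \<in> out v. dst M d \<in> T})" by auto
  moreover have "card (\<Union>v \<in> T. {d \<in> out v. dst M d \<in> T}) = (\<Sum>v \<in> T. card {d \<in> out v. dst M d \<in> T})"
  proof (rule card_UN_disjoint[OF triangle_finite[OF T]])
    show "\<forall>v \<in> T. finite {d \<in> out v. dst M d \<in> T}" using finite_darts by auto
  qed auto
  moreover have "(\<Sum>v \<in> T. card {d \<in> out v. dst M d \<in> T}) = (\<Sum>v \<in> T. 2)"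
    using triangle_out[OF T] by (intro sum.cong) auto
  moreover have "card T = 3" using T by (simp add: triangle_def)
  ultimately have six: "card ?E = 6" by simp
  have sub: "?ES \<subseteq> ?E" using side_sub[OF S] by auto
  have img: "opp M ` ?ES = ?E - ?ES"
  proof
    show "opp M ` ?ES \<subseteq> ?E - ?ES"
      using side_edge[OF S] side_sub[OF S] by (auto simp: src_opp dst_opp)
    show "?E - ?ES \<subseteq> opp M ` ?ES"
    proof
      fix d assume d: "d \<in> ?E - ?ES"
      then have "opp M d \<in> ?ES" using side_edge[OF S, of d] by (auto simp: src_opp dst_opp)
      then have "opp M (opp M d) \<in> opp M ` ?ES" by (rule imageI)
      then show "d \<in> opp M ` ?ES" by simp
    qed
  qed
  have "card (opp M ` ?ES) = card ?ES" by (rule card_image) (auto simp: inj_on_def)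
  then have "card (?E - ?ES) = card ?ES" unfolding img .
  moreover have "card (?E - ?ES) = card ?E - card ?ES" using fin sub finite_subset by (intro card_Diff_subset) auto
  moreover have "card ?ES \<le> card ?E" by (rule card_mono[OF fin sub])
  ultimately show ?thesis using six by linarith
qed

lemma card_vs_split:
  assumes T: "triangle T" and S: "side T S"
  shows "card (vs M) = card (interior S) + card (interior (darts M - S)) + 3"
proof -
  let ?S' = "darts M - S"
  note S' = side_compl[OF S]
  have Tvs: "T \<subseteq> vs M"
  proof
    fix v assume "v \<in> T"
    then show "v \<in> vs M" by (rule triangle_out_ex[OF T]) (use src_in in auto)
  qed
  have fin: "finite (interior S)" "finite (interior ?S')" "finite T"
    using finite_vs triangle_finite[OF T] by (simp_all add: interior_def)
  have un: "vs M = interior S \<union> interior ?S' \<union> T"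
  proof
    show "vs M \<subseteq> interior S \<union> interior ?S' \<union> T"
    proof
      fix v assume v: "v \<in> vs M"
      then obtain d where d: "d \<in> out v" using out_nonempty by blast
      show "v \<in> interior S \<union> interior ?S' \<union> T"
        using interiorI[OF S, of d] interiorI[OF S', of d] d by auto
    qed
  qed (use Tvs in \<open>auto simp: interior_def\<close>)
  have d1: "interior S \<inter> interior ?S' = {}"
    using out_nonempty unfolding interior_def by blast
  have d2: "(interior S \<union> interior ?S') \<inter> T = {}"
    using interior_not_T[OF T S] interior_not_T[OF T S'] by blast
  show ?thesis
    unfolding un using card_Un_disjoint[OF _ fin(3) d2] card_Un_disjoint[OF fin(1,2) d1] fin T
    by (simp add: triangle_def)
qed

text \<open>\<open>inner_euler_le\<close> with f = |S| / 3 and e = (|S| - 3) / 2, where 3 counts the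
  darts along the triangle, whose opposites are outside \<open>S\<close>.\<close>

lemma inner_count:
  assumes T: "triangle T" and S: "side T S"
  shows "6 * card (interior S) + 3 \<le> card S"
proof -
  have I: "interior S \<subset> vs M"
  proof
    show "interior S \<subseteq> vs M" by (auto simp: interior_def)
    have "T \<noteq> {}" using T by (auto simp: triangle_def)
    moreover have "T \<inter> interior S = {}" using interior_not_T[OF T S] by blast
    moreover have "vs M \<noteq> interior S"
    proof
      assume eq: "vs M = interior S"
      obtain v where v: "v \<in> T" using \<open>T \<noteq> {}\<close> by blast
      then have "v \<in> vs M" by (rule triangle_out_ex[OF T]) (use src_in in auto)
      then show False using eq v \<open>T \<inter> interior S = {}\<close> by blast
    qed
    ultimately show "interior S \<noteq> vs M" by simp
  qed
  have "card (inner_faces S) + card (interior S) \<le> card (inner_edges S) + 1"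
  proof (rule inner_euler_le[OF side_closed[OF S] I])
    show "d \<in> S" if "d \<in> darts M" "src M d \<in> interior S" for d
      using interior_dart(1)[OF S that(2,1)] .
    show "U = {} \<or> U = S" if "closed_faces U" "U \<subseteq> S"
      "\<And>d. d \<in> S \<Longrightarrow> opp M d \<in> S \<Longrightarrow> d \<in> U \<longleftrightarrow> opp M d \<in> U" for U
      by (rule side_connected[OF T S that])
  qed
  moreover have "3 * card (inner_faces S) = card S" by (rule card_inner_faces[OF side_closed[OF S]])
  moreover have "2 * card (inner_edges S) = card {d \<in> S. opp M d \<in> S}"
    by (rule card_inner_edges[OF side_sub[OF S]])
  moreover have "card {d \<in> S. opp M d \<in> S} + 3 = card S"
  proof -
    let ?E = "{d \<in> S. src M d \<in> T \<and> dst M d \<in> T}"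
    have fin: "finite S" by (rule finite_closed_faces[OF side_closed[OF S]])
    have "S = {d \<in> S. opp M d \<in> S} \<union> ?E"
      using side_other[OF S] side_sub[OF S] by blast
    moreover have "{d \<in> S. opp M d \<in> S} \<inter> ?E = {}" using side_edge[OF S] side_sub[OF S] by blast
    ultimately have "card S = card {d \<in> S. opp M d \<in> S} + card ?E"
      using card_Un_disjoint[of "{d \<in> S. opp M d \<in> S}" ?E] fin by simp
    then show ?thesis using card_T_darts[OF T S] by simp
  qed
  ultimately show ?thesis by linarith
qed

text \<open>With k interior vertices, \<open>inner_count\<close> for the complement and
  \<open>euler6\<close> give |S| <= 6k + 3. At least four darts of \<open>S\<close> start on the
  triangle, so the interior degrees add up to at most 6k - 1.\<close>

lemma low_degree_vertex:
  assumes R: "region T S"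
  obtains v where "v \<in> interior S" "card (out v) \<le> 5"
proof -
  have T: "triangle T" and S: "side T S" using R by (auto simp: region_def)
  have finS: "finite S" by (rule finite_closed_faces[OF side_closed[OF S]])
  let ?k = "card (interior S)"
  have "card (darts M) = card S + card (darts M - S)"
    using card_Diff_subset[OF finS side_sub[OF S]] card_mono[OF finite_darts side_sub[OF S]] by simp
  then have cS: "card S \<le> 6 * ?k + 3"
    using inner_count[OF T side_compl[OF S]] card_vs_split[OF T S] euler6 by linarith
  let ?E = "{d \<in> S. src M d \<in> T \<and> dst M d \<in> T}" and ?D = "{d \<in> S. src M d \<in> T}"
  have "?E \<noteq> {}" using card_T_darts[OF T S] card.empty by (metis zero_neq_numeral)
  then obtain d where d: "d \<in> S" "src M d \<in> T" "dst M d \<in> T" by blast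
  have dM: "d \<in> darts M" using d(1) side_sub[OF S] by blast
  \<comment> \<open>A fourth dart besides the three along the triangle: it starts at a corner and
    leads off \<open>T\<close> by \<open>region_third_vertex\<close>.\<close>
  have new: "face_step M d \<in> ?D" "face_step M d \<notin> ?E"
    using region_third_vertex[OF R d] d face_ends(1)[OF dM] closed_faces_iff[OF side_closed[OF S], of d] by auto
  have "card (insert (face_step M d) ?E) \<le> card ?D"
    by (rule card_mono) (use finS new in auto)
  moreover have "card (insert (face_step M d) ?E) = 4"
    using card_insert_disjoint[of ?E] finS new(2) card_T_darts[OF T S] by simp
  ultimately have D: "4 \<le> card ?D" by simp
  have finI: "finite (interior S)" using finite_vs by (simp add: interior_def)
  have "(\<Sum>v \<in> interior S. card (out v)) = card (\<Union>v \<in> interior S. out v)"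
    by (rule card_UN_disjoint[symmetric, OF finI]) auto
  also have "\<dots> \<le> card (S - ?D)"
  proof (rule card_mono)
    show "(\<Union>v \<in> interior S. out v) \<subseteq> S - ?D"
      using interior_not_T[OF T S] by (auto simp: interior_def)
  qed (use finS in simp)
  also have "\<dots> = card S - card ?D" by (rule card_Diff_subset) (use finS in auto)
  finally have sum: "(\<Sum>v \<in> interior S. card (out v)) + 4 \<le> card S"
    using D card_mono[OF finS, of ?D] by auto
  have "\<exists>v \<in> interior S. card (out v) \<le> 5"
  proof (rule ccontr)
    assume "\<not> ?thesis"
    then have "(\<Sum>v \<in> interior S. 6) \<le> (\<Sum>v \<in> interior S. card (out v))"
      by (intro sum_mono) force
    then show False using sum cS by simp
  qed
  then show thesis using that by blast
qed

end

section \<open>Wheels inside a minimal region\<close>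

context simple_triangulation
begin

lemma cut_separates:
  assumes S: "cut Z S" and xy: "x \<notin> Z" "y \<notin> Z"
    and dx: "dx \<in> out x" "dx \<in> S" and dy: "dy \<in> out y" "dy \<notin> S"
  shows "\<not> adj x y" "adj x v \<Longrightarrow> adj y v \<Longrightarrow> v \<in> Z"
proof -
  have x: "opp M d \<in> S" if "d \<in> darts M" "src M d = x" for d
    using cut_out[OF S xy(1) dx(1), of d] cut_other[OF S, of d] that dx(2) xy(1) by simp
  have y: "opp M d \<notin> S" if "d \<in> darts M" "src M d = y" for d
    using cut_out[OF S xy(2) dy(1), of d] cut_other[OF S, of d] that dy(2) xy(2) by simp
  show "\<not> adj x y"
  proof
    assume "adj x y"
    then obtain d where d: "d \<in> darts M" "src M d = x" "dst M d = y" unfolding adj_def by blast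
    then have "opp M d \<in> out y" by (simp add: src_opp)
    then show False using cut_out[OF S xy(2) dy(1), of "opp M d"] x[OF d(1,2)] dy(2) by blast
  qed
  assume "adj x v" "adj y v"
  then obtain d f where d: "d \<in> darts M" "src M d = x" "dst M d = v"
    and f: "f \<in> darts M" "src M f = y" "dst M f = v" unfolding adj_def by blast
  then have "opp M d \<in> out v" "opp M f \<in> out v" by (simp_all add: src_opp)
  then show "v \<in> Z" using cut_out[OF S, of v "opp M d" "opp M f"] x[OF d(1,2)] y[OF f(1,2)] by blast
qed

text \<open>The cut runs along the middle spoke, so the darts before and after it are on different
  sides. The second form of \<open>h3\<close> passes one more spoke that ends off \<open>Z\<close>,
  as is needed in a 5-wheel.\<close>

lemma cut_separates_rim:
  assumes S: "cut Z S" and h1: "h1 \<in> darts M" and h2: "(rot M h1 \<in> S) \<noteq> (opp M (rot M h1) \<in> S)"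
    and h3: "h3 = rot M (rot M h1) \<or> h3 = rot M (rot M (rot M h1)) \<and> dst M (rot M (rot M h1)) \<notin> Z"
    and Z: "dst M h1 \<notin> Z" "dst M h3 \<notin> Z"
  shows "\<not> adj (dst M h1) (dst M h3)"
    "adj (dst M h1) v \<Longrightarrow> adj (dst M h3) v \<Longrightarrow> v \<in> Z"
proof -
  let ?h2 = "rot M h1"
  have h3M: "h3 \<in> darts M" using h1 h3 by auto
  have o1: "opp M h1 \<in> S \<longleftrightarrow> h1 \<in> S" using cut_other[OF S h1] Z(1) by simp
  have o3: "opp M h3 \<in> S \<longleftrightarrow> h3 \<in> S" using cut_other[OF S h3M] Z(2) by simp
  have "?h2 \<in> S \<longleftrightarrow> h1 \<in> S" using cut_rot[OF S, of h1] o1 by simp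
  moreover have "rot M ?h2 \<in> S \<longleftrightarrow> opp M ?h2 \<in> S" using cut_rot[OF S] .
  ultimately have r: "rot M ?h2 \<in> S \<longleftrightarrow> h1 \<notin> S" using h2 by blast
  have "h3 \<in> S \<longleftrightarrow> h1 \<notin> S"
    using h3
  proof
    assume "h3 = rot M (rot M ?h2) \<and> dst M (rot M ?h2) \<notin> Z"
    then show ?thesis using r cut_rot[OF S, of "rot M ?h2"] cut_other[OF S, of "rot M ?h2"] h1 by simp
  qed (use r in simp)
  then have st: "opp M h3 \<in> S \<longleftrightarrow> opp M h1 \<notin> S" using o1 o3 by simp
  have out: "opp M h1 \<in> out (dst M h1)" "opp M h3 \<in> out (dst M h3)" using h1 h3M by (simp_all add: src_opp)
  show "\<not> adj (dst M h1) (dst M h3)"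
  proof (cases "opp M h1 \<in> S")
    case True
    then show ?thesis using cut_separates(1)[OF S Z out(1) _ out(2)] st by simp
  next
    case False
    then show ?thesis using cut_separates(1)[OF S Z(2,1) out(2) _ out(1)] st adj_sym by blast
  qed
  assume a: "adj (dst M h1) v" "adj (dst M h3) v"
  show "v \<in> Z"
  proof (cases "opp M h1 \<in> S")
    case True
    then show ?thesis using cut_separates(2)[OF S Z out(1) _ out(2) _ a] st by simp
  next
    case False
    then show ?thesis using cut_separates(2)[OF S Z(2,1) out(2) _ out(1) _ a(2,1)] st by simp
  qed
qed

lemma four_cycle_cut:
  assumes dis: "distinct [w, u, z, u']" and adjs: "adj w u" "adj u z" "adj z u'" "adj u' w"
  obtains S where "cut {w, u, z, u'} S"
    "\<And>d. d \<in> darts M \<Longrightarrow> src M d = w \<Longrightarrow> dst M d \<in> {u, u'} \<Longrightarrow> (d \<in> S) \<noteq> (opp M d \<in> S)"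
proof -
  \<comment> \<open>Joining opposite pairs selects the 4-cycle and leaves out its possible chords,
    so that every degree is 0 or 2.\<close>
  define C where "C d \<longleftrightarrow> src M d \<in> {w, z} \<and> dst M d \<in> {u, u'} \<or> src M d \<in> {u, u'} \<and> dst M d \<in> {w, z}" for d
  have sym: "adj u w" "adj z u" "adj u' z" "adj w u'" using adjs adj_sym by blast+
  have C_even: "even (card {d \<in> out v. C d})" for v
  proof -
    consider "v \<in> {w, z}" "v \<notin> {u, u'}" | "v \<in> {u, u'}" "v \<notin> {w, z}" | "v \<notin> {w, z}" "v \<notin> {u, u'}"
      using dis by auto
    then show ?thesis
    proof cases
      case 1
      then have "{d \<in> out v. C d} = {d \<in> out v. dst M d \<in> {u, u'}}" unfolding C_def in_out by blast
      moreover have "card {d \<in> out v. dst M d \<in> {u, u'}} = card {u, u'}"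
        by (rule card_out_to) (use 1(1) adjs sym in auto)
      ultimately show ?thesis using dis by simp
    next
      case 2
      then have "{d \<in> out v. C d} = {d \<in> out v. dst M d \<in> {w, z}}" unfolding C_def in_out by blast
      moreover have "card {d \<in> out v. dst M d \<in> {w, z}} = card {w, z}"
        by (rule card_out_to) (use 2(1) adjs sym in auto)
      ultimately show ?thesis using dis by simp
    next
      case 3
      then have "{d \<in> out v. C d} = {}" unfolding C_def in_out by blast
      then show ?thesis by (simp only: card.empty) simp
    qed
  qed
  have C_opp: "C (opp M d) \<longleftrightarrow> C d" if "d \<in> darts M" for d
    unfolding C_def src_opp[OF that] dst_opp[OF that] by blast
  obtain S where S: "closed_faces S" "\<And>d. d \<in> darts M \<Longrightarrow> (d \<in> S) \<noteq> (opp M d \<in> S) \<longleftrightarrow> C d"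
    by (rule even_darts_bound_region[of C, OF C_opp C_even]) (assumption, rule that)
  have "src M d \<in> {w, u, z, u'} \<and> dst M d \<in> {w, u, z, u'}" if "C d" for d using that unfolding C_def by blast
  then have "cut {w, u, z, u'} S" unfolding cut_def using S by blast
  moreover have "(d \<in> S) \<noteq> (opp M d \<in> S)" if d: "d \<in> darts M" "src M d = w" "dst M d \<in> {u, u'}" for d
  proof -
    have "C d" using d(2,3) unfolding C_def by blast
    then show ?thesis using S(2)[OF d(1)] by blast
  qed
  ultimately show thesis by (rule that)
qed

section \<open>Reductions at a vertex of degree 3, 4 or 5\<close>

definition ring :: "'a \<Rightarrow> 'b list \<Rightarrow> bool" where
  "ring v hs \<longleftrightarrow> cyc (rot M) hs \<and> set hs = out v"

lemma ring_rotate: "ring v (xs @ ys) \<Longrightarrow> ring v (ys @ xs)"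
  unfolding ring_def using cyc_rotate by (auto simp: Un_commute)

lemma ring_exists:
  assumes "v \<in> vs M"
  obtains hs where "ring v hs" "length hs = card (out v)"
proof -
  obtain d where d: "d \<in> out v" using out_nonempty[OF assms] by blast
  obtain xs where xs: "cyc (rot M) (d # xs)" "set (d # xs) = out v"
    by (rule cyclic_on_imp_cyc[OF rot_cyclic[OF assms], of d]) (use d in \<open>auto simp: out_def\<close>)
  then have "ring v (d # xs)" by (simp add: ring_def)
  moreover have "distinct (d # xs)" using xs(1) by (simp add: cyc_def)
  then have "length (d # xs) = card (out v)" using distinct_card xs(2) by metis
  ultimately show thesis by (rule that)
qed

lemma ring_distinct:
  assumes "ring v hs"
  shows "distinct (v # map (dst M) hs)"
proof -
  have out: "h \<in> darts M \<and> src M h = v" if "h \<in> set hs" for h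
    using that assms unfolding ring_def by auto
  have "v \<noteq> dst M h" if "h \<in> set hs" for h using no_loop[of h] out[OF that] by auto
  moreover have "inj_on (dst M) (set hs)"
  proof (rule inj_onI)
    fix h h' assume "h \<in> set hs" "h' \<in> set hs" "dst M h = dst M h'"
    then show "h = h'" using out simple_darts by simp
  qed
  moreover have "distinct hs" using assms by (simp add: ring_def cyc_def)
  ultimately show ?thesis by (auto simp: distinct_map)
qed

lemma ring_darts: "ring v hs \<Longrightarrow> h \<in> set hs \<Longrightarrow> h \<in> darts M \<and> src M h = v"
  unfolding ring_def by auto

definition reducible :: bool where
  "reducible \<longleftrightarrow> (\<exists>H :: ('a, 'b) embedded_graph. maximal_planar H \<and>
     (order H = order M - 1 \<and> extend_3wheel H M \<or>
      order H = order M - 2 \<and> (extend_4wheel H M \<or> extend_5wheel H M)))"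

lemma reducible3:
  assumes R: "ring v [h0, h1, h2]"
  shows reducible
proof -
  have r: "rot M h0 = h1" "rot M h1 = h2" "rot M h2 = h0" using R by (simp_all add: ring_def cyc_def)
  have h: "h0 \<in> darts M" "src M h0 = v" using ring_darts[OF R] by auto
  interpret W: wheel3 M h0
    by unfold_locales (use ring_distinct[OF R] h in \<open>simp_all add: r\<close>)
  show ?thesis unfolding reducible_def using W.reduction by blast
qed

lemma fold4:
  assumes R: "ring v [h0, h1, h2, h3]" and na: "\<not> adj (dst M h0) (dst M h2)"
  shows "wheel4 M h0 h3"
proof -
  have r: "rot M h0 = h1" "rot M h1 = h2" "rot M h2 = h3" "rot M h3 = h0"
    using R by (simp_all add: ring_def cyc_def)
  have h: "h0 \<in> darts M" "src M h0 = v" using ring_darts[OF R] by auto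
  show ?thesis
    by unfold_locales (use ring_distinct[OF R] h na in \<open>simp_all add: r\<close>)
qed

lemma reducible4:
  assumes R: "ring v [h0, h1, h2, h3]" and na: "\<not> adj (dst M h0) (dst M h2)"
    and common: "\<And>y. adj (dst M h0) y \<Longrightarrow> adj (dst M h2) y \<Longrightarrow> y \<in> {v, dst M h1, dst M h3}"
  shows reducible
proof -
  have r: "rot M h0 = h1" "rot M h1 = h2" "rot M h2 = h3" using R by (simp_all add: ring_def cyc_def)
  have h: "src M h0 = v" using ring_darts[OF R, of h0] by simp
  interpret W: wheel4 M h0 h3 by (rule fold4[OF R na])
  have names: "W.hub = v" "W.tp = dst M h1" "W.s1 = dst M h2" "W.v1 = dst M h3" "W.s2 = dst M h0"
    unfolding W.hub_def W.tp_def W.s1_def W.v1_def W.s2_def W.e1_def W.es_def W.et_def r h by (rule refl)+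
  have "maximal_planar W.H"
  proof (rule W.maximal_planar_H)
    fix y assume "adj W.s1 y" "adj W.s2 y"
    then have "y \<in> {v, dst M h1, dst M h3}" using common unfolding names by blast
    then show "y = W.hub \<or> y = W.tp \<or> y = W.v1 \<and> W.q = W.c"
      using W.e1_l(2) unfolding names by blast
  qed
  then show ?thesis unfolding reducible_def using W.order_H W.extend by blast
qed

lemma reducible4_2wheel:
  assumes R: "ring v [h0, h1, h2, h3]" and na: "\<not> adj (dst M h0) (dst M h2)"
    and top: "rot M (rot M (face_step M h1)) = opp M (face_step M h2)"
    and z: "dst M (rot M (face_step M h1)) = z" "z \<notin> {v, dst M h0, dst M h2, dst M h3}"
    and common: "\<And>y. adj (dst M h0) y \<Longrightarrow> adj (dst M h2) y \<Longrightarrow> y \<in> {v, dst M h1, dst M h3, z}"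
  shows reducible
proof -
  have r: "rot M h0 = h1" "rot M h1 = h2" "rot M h2 = h3" using R by (simp_all add: ring_def cyc_def)
  have h: "src M h0 = v" using ring_darts[OF R, of h0] by simp
  interpret W: wheel4 M h0 h3 by (rule fold4[OF R na])
  have names: "W.hub = v" "W.tp = dst M h1" "W.s1 = dst M h2" "W.v1 = dst M h3" "W.s2 = dst M h0"
    "W.ra = face_step M h1" "W.a = face_step M h2"
    unfolding W.hub_def W.tp_def W.s1_def W.v1_def W.s2_def W.ra_def W.a_def W.e1_def W.es_def W.et_def r h
    by (rule refl)+
  have "maximal_planar W.H"
  proof (rule W.maximal_planar_H_2wheel)
    show "rot M (rot M W.ra) = opp M W.a" "dst M (rot M W.ra) = z" unfolding names by fact+
    show "z \<noteq> W.hub" "z \<noteq> W.s1" "z \<noteq> W.s2" "z \<noteq> W.v1" using z(2) unfolding names by blast+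
    fix y assume "adj W.s1 y" "adj W.s2 y"
    then show "y = W.hub \<or> y = W.tp \<or> y = W.v1 \<or> y = z" using common unfolding names by blast
  qed
  then show ?thesis unfolding reducible_def using W.order_H W.extend by blast
qed

text \<open>Compared with \<open>reducible4\<close>, the ends of \<open>h3\<close> and
  \<open>h4\<close> are no longer allowed: each keeps its rim edge to the merged vertex, so a
  further edge would be parallel to it.\<close>

lemma reducible5:
  assumes R: "ring v [h0, h1, h2, h3, h4]" and na: "\<not> adj (dst M h0) (dst M h2)"
    and common: "\<And>y. adj (dst M h0) y \<Longrightarrow> adj (dst M h2) y \<Longrightarrow> y \<in> {v, dst M h1}"
  shows reducible
proof -
  have r: "rot M h0 = h1" "rot M h1 = h2" "rot M h2 = h3" "rot M h3 = h4" "rot M h4 = h0"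
    using R by (simp_all add: ring_def cyc_def)
  have h: "h0 \<in> darts M" "src M h0 = v" using ring_darts[OF R] by auto
  interpret W: wheel5 M h0 h4
    by unfold_locales (use ring_distinct[OF R] h na in \<open>simp_all add: r\<close>)
  have names: "W.hub = v" "W.tp = dst M h1" "W.s1 = dst M h2" "W.s2 = dst M h0"
    unfolding W.hub_def W.tp_def W.s1_def W.s2_def W.e1_def W.es_def W.et_def r h by (rule refl)+
  have "maximal_planar W.H"
  proof (rule W.maximal_planar_H)
    fix y assume "adj W.s1 y" "adj W.s2 y"
    then have "y \<in> {v, dst M h1}" using common unfolding names by blast
    then show "y = W.hub \<or> y = W.tp \<or> y = W.v1 \<and> W.q = W.c" unfolding names by blast
  qed
  then show ?thesis unfolding reducible_def using W.order_H W.extend by blast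
qed

end

section \<open>A vertex adjacent to the whole rim of another vertex\<close>

locale apex = simple_triangulation +
  fixes v z
  assumes v: "v \<in> vs M" and z: "z \<noteq> v" "z \<notin> dst M ` out v" and z_adj: "\<And>h. h \<in> out v \<Longrightarrow> adj z (dst M h)"
    and deg: "4 \<le> card (out v)"
begin

definition rim :: "'b \<Rightarrow> 'b" where
  "rim h = opp M (face_step M (rot M h))"

definition tri :: "'b \<Rightarrow> 'a set" where
  "tri h = {z, dst M h, dst M (rot M h)}"

text \<open>The side of the triangle \<open>tri h\<close> that does not contain \<open>v\<close>; it is determined by \<open>h\<close> since \<open>v\<close> is
  off the triangle.\<close>

definition beyond :: "'b \<Rightarrow> 'b set" where
  "beyond h = (SOME S. side (tri h) S \<and> h \<notin> S)"

context
  fixes h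
  assumes h: "h \<in> out v"
begin

lemma consecutive_neq: "dst M (rot M h) \<noteq> dst M h"
proof
  assume eq: "dst M (rot M h) = dst M h"
  have hM: "h \<in> darts M" using h by simp
  have fp: "rot M h = h" by (rule simple_darts[OF _ hM _ eq]) (simp_all add: hM)
  have "out v \<subseteq> {h}"
  proof
    fix d assume d: "d \<in> out v"
    show "d \<in> {h}"
    proof (rule closed_rot_out[of "{h}" h d])
      show "\<And>d. d \<in> {h} \<Longrightarrow> rot M d \<in> {h}" using fp by simp
    qed (use h d in simp_all)
  qed
  then have "card (out v) \<le> card {h}" by (rule card_mono[rotated]) simp
  then show False using deg by simp
qed

lemma rim_ends: "rim h \<in> darts M" "src M (rim h) = dst M h" "dst M (rim h) = dst M (rot M h)"
proof -
  have hM: "h \<in> darts M" using h by simp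
  show "rim h \<in> darts M" using hM by (simp add: rim_def)
  show "dst M (rim h) = dst M (rot M h)" using hM by (simp add: rim_def dst_opp src_face_step)
  have "dst M (face_step M (rot M h)) = src M (face_step M (face_step M (rot M h)))"
    using face_ends(2)[of "rot M h"] hM by simp
  then show "src M (rim h) = dst M h" using hM by (simp add: rim_def src_opp face_step_rot)
qed

lemma tri_triangle: "triangle (tri h)"
  unfolding tri_def
proof (rule triangleI)
  show "adj z (dst M h)" by (rule z_adj[OF h])
  show "adj (dst M (rot M h)) z" using z_adj[of "rot M h"] h adj_sym by auto
  show "adj (dst M h) (dst M (rot M h))" using adjI[OF rim_ends(1)] rim_ends(2,3) by simp
  show "z \<noteq> dst M h" using z(2) h by blast
  show "dst M (rot M h) \<noteq> z" using z(2) h by (metis in_out imageI rot_in_iff src_rot)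
  show "dst M h \<noteq> dst M (rot M h)" using consecutive_neq by simp
qed

lemma v_not_tri: "v \<notin> tri h"
proof -
  have "v \<noteq> dst M h" using no_loop[of h] h by auto
  moreover have "v \<noteq> dst M (rot M h)" using no_loop[of "rot M h"] h by auto
  ultimately show ?thesis using z(1) by (auto simp: tri_def)
qed

lemma beyond: "side (tri h) (beyond h)" "h \<notin> beyond h"
proof -
  have "\<exists>S. side (tri h) S \<and> h \<notin> S"
    by (rule side_avoiding[OF tri_triangle, of h]) blast
  then have "side (tri h) (beyond h) \<and> h \<notin> beyond h" unfolding beyond_def by (rule someI_ex)
  then show "side (tri h) (beyond h)" "h \<notin> beyond h" by auto
qed

lemma hub_not_beyond: "d \<in> out v \<Longrightarrow> d \<notin> beyond h" "d \<in> out v \<Longrightarrow> opp M d \<notin> beyond h"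
proof -
  assume d: "d \<in> out v"
  show 1: "d \<notin> beyond h" using side_out[OF beyond(1) v_not_tri h d] beyond(2) by blast
  then show "opp M d \<notin> beyond h" using side_other[OF beyond(1), of d] v_not_tri d by auto
qed

lemma rim_beyond: "rim h \<in> beyond h"
proof -
  have "rot M h \<notin> beyond h" using hub_not_beyond(1) h by simp
  then have "face_step M (rot M h) \<notin> beyond h"
    using closed_faces_iff[OF side_closed[OF beyond(1)]] by simp
  then have "opp M (rim h) \<notin> beyond h" by (simp add: rim_def)
  then show ?thesis using side_edge[OF beyond(1) rim_ends(1)] rim_ends(2,3) by (simp add: tri_def)
qed

text \<open>A spoke joins this rim vertex to \<open>v\<close>, and both of its ends are off the
  triangle, so they are on the same side.\<close>

lemma rim_vertex_not_beyond:
  assumes h': "h' \<in> out v" "dst M h' \<notin> tri h" and d: "d \<in> darts M" "src M d = dst M h' \<or> dst M d = dst M h'"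
  shows "d \<notin> beyond h"
proof -
  have o: "opp M h' \<in> out (dst M h')" using h'(1) by (simp add: src_opp)
  have st: "e \<notin> beyond h" if "e \<in> out (dst M h')" for e
    using side_out[OF beyond(1) h'(2) o that] hub_not_beyond(2)[OF h'(1)] by blast
  from d(2) show ?thesis
  proof
    assume "src M d = dst M h'"
    then show ?thesis using st d(1) by simp
  next
    assume dd: "dst M d = dst M h'"
    then have "opp M d \<notin> beyond h" using st d(1) by (simp add: src_opp)
    then show ?thesis using side_other[OF beyond(1) d(1)] dd h'(2) by simp
  qed
qed

text \<open>\<open>beyond h\<close> contains the face of \<open>rim h\<close> and hence equals it.
  As it also contains a dart of the edge between \<open>z\<close> and the end of \<open>h\<close>,
  the third corner of this face is \<open>z\<close>.\<close>

lemma small_beyond: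
  assumes "card (beyond h) \<le> 3"
  shows "dst M (face_step M (rim h)) = z"
proof -
  note rM = rim_ends(1)
  let ?r = "rim h"
  have "finite (beyond h)" by (rule finite_closed_faces[OF side_closed[OF beyond(1)]])
  moreover have "face M ?r \<subseteq> beyond h" by (rule face_subset[OF side_closed[OF beyond(1)] rim_beyond])
  ultimately have eq: "beyond h = face M ?r"
    using card_face_darts[OF rM] assms by (metis card_seteq)
  obtain f where f: "f \<in> darts M" "src M f = z" "dst M f = dst M h" using z_adj[OF h] unfolding adj_def by blast
  have "f \<in> beyond h \<or> opp M f \<in> beyond h" using side_edge[OF beyond(1) f(1)] f by (auto simp: tri_def)
  then obtain g where g: "g \<in> face M ?r" "src M g = z \<or> dst M g = z"
  proof
    assume "f \<in> beyond h" then show thesis using that[of f] f eq by simp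
  next
    assume "opp M f \<in> beyond h" then show thesis using that[of "opp M f"] f eq by (simp add: dst_opp)
  qed
  have "z \<noteq> dst M h" "z \<noteq> dst M (rot M h)" using z(2) h by (auto simp: image_iff)
  then show ?thesis
    using g face_ends[OF rM] rim_ends unfolding face_eq[OF rM] by auto
qed

end

text \<open>Every edge of one triangle has an end on the rim which is off the other triangle and
  joined to \<open>v\<close>, so no dart of it is beyond the other. By
  \<open>side_connected\<close>, two such sides that meet would include each other, but
  \<open>rim h\<close> is in just one of them.\<close>

lemma beyond_disjoint:
  assumes h: "h \<in> out v" "h' \<in> out v"
    and dis: "{dst M h, dst M (rot M h)} \<inter> {dst M h', dst M (rot M h')} = {}"
  shows "beyond h \<inter> beyond h' = {}"
proof (rule ccontr)
  assume ne: "beyond h \<inter> beyond h' \<noteq> {}"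
  have not_beyond: "d \<notin> beyond k" if k: "k \<in> out v" "k' \<in> out v"
      "{dst M k, dst M (rot M k)} \<inter> {dst M k', dst M (rot M k')} = {}"
      and d: "d \<in> darts M" "src M d \<in> tri k'" "dst M d \<in> tri k'" for k k' d
  proof -
    have r: "rot M k' \<in> out v" using k(2) by simp
    have nz: "dst M k' \<noteq> z" "dst M (rot M k') \<noteq> z" using z(2) k(2) r by (blast, blast)
    then have n: "dst M k' \<notin> tri k" "dst M (rot M k') \<notin> tri k" using k(3) by (auto simp: tri_def)
    have "src M d \<noteq> dst M d" by (rule no_loop[OF d(1)])
    then consider "src M d = dst M k' \<or> dst M d = dst M k'" | "src M d = dst M (rot M k') \<or> dst M d = dst M (rot M k')"
      using d(2,3) unfolding tri_def by auto
    then show ?thesis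
      by cases (rule rim_vertex_not_beyond[OF k(1) k(2) n(1) d(1)], assumption,
        rule rim_vertex_not_beyond[OF k(1) r n(2) d(1)], assumption)
  qed
  have sub: "beyond k \<subseteq> beyond k'" if k: "k \<in> out v" "k' \<in> out v"
      "{dst M k, dst M (rot M k)} \<inter> {dst M k', dst M (rot M k')} = {}"
      "beyond k \<inter> beyond k' \<noteq> {}" for k k'
  proof -
    have "beyond k \<inter> beyond k' = {} \<or> beyond k \<inter> beyond k' = beyond k"
    proof (rule side_connected[OF tri_triangle[OF k(1)] beyond(1)[OF k(1)]])
      show "closed_faces (beyond k \<inter> beyond k')"
        by (rule closed_faces_Int; rule side_closed, rule beyond(1)) (use k in auto)
      fix d assume d: "d \<in> beyond k" "opp M d \<in> beyond k"
      have dM: "d \<in> darts M" using d(1) side_sub[OF beyond(1)[OF k(1)]] by blast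
      have "src M d \<notin> tri k' \<or> dst M d \<notin> tri k'" using not_beyond[OF k(1-3) dM] d(1) by blast
      then have "opp M d \<in> beyond k' \<longleftrightarrow> d \<in> beyond k'" by (rule side_other[OF beyond(1)[OF k(2)] dM])
      then show "d \<in> beyond k \<inter> beyond k' \<longleftrightarrow> opp M d \<in> beyond k \<inter> beyond k'" using d by blast
    qed simp
    then show ?thesis using k(4) by blast
  qed
  have "beyond h = beyond h'"
    using sub[OF h dis ne] sub[OF h(2,1)] dis ne by blast
  moreover have "rim h \<in> beyond h" by (rule rim_beyond[OF h(1)])
  moreover have "rim h \<notin> beyond h'"
    using not_beyond[of h' h "rim h"] h dis rim_ends[OF h(1)] by (auto simp: tri_def)
  ultimately show False by simp
qed

text \<open>Both faces have an edge between \<open>z\<close> and their common rim vertex. By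
  simplicity it is the same edge, which glues the two faces together.\<close>

lemma rim_corner:
  assumes h: "h \<in> out v" and zh: "dst M (face_step M (rim h)) = z" "dst M (face_step M (rim (rot M h))) = z"
  shows "rot M (face_step M (rot M h)) = face_step M (rim h)"
    "rot M (face_step M (rim h)) = rim (rot M h)"
    "rot M (rim (rot M h)) = opp M (rot M h)"
proof -
  let ?k = "rot M h"
  have k: "?k \<in> out v" and hM: "h \<in> darts M" using h by auto
  show "rot M (face_step M ?k) = face_step M (rim h)" by (simp add: rim_def face_step_opp)
  let ?f = "face_step M (rim h)" and ?g = "face_step M (face_step M (rim ?k))"
  have "opp M ?f = ?g"
  proof (rule simple_darts)
    show "opp M ?f \<in> darts M" "?g \<in> darts M" using rim_ends(1)[OF h] rim_ends(1)[OF k] by simp_all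
    show "src M (opp M ?f) = src M ?g" "dst M (opp M ?f) = dst M ?g"
      using rim_ends[OF h] rim_ends[OF k] face_ends[OF rim_ends(1)[OF h]] face_ends[OF rim_ends(1)[OF k]] zh
      by (simp_all add: src_opp dst_opp)
  qed
  then have "face_step M (opp M ?f) = face_step M ?g" by simp
  then show "rot M ?f = rim ?k" using face_triangle[OF rim_ends(1)[OF k]] by (simp add: face_step_opp)
  show "rot M (rim ?k) = opp M ?k"
    using face_step_rot[of ?k] hM by (simp add: rim_def face_step_def[of M "face_step M (rot M ?k)"])
qed

text \<open>The corners of \<open>tri h\<close> are in \<open>T\<close> or interior to
  \<open>S\<close>, so each of its edges has a dart in \<open>S\<close>. The complement of
  \<open>S\<close> is therefore not divided by the triangle, and \<open>side_connected\<close> puts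
  it entirely in \<open>beyond h\<close> or entirely off it.\<close>

lemma beyond_cases:
  assumes R: "region T S" and vS: "v \<in> interior S" and h: "h \<in> out v"
  shows "beyond h \<subset> S \<or> darts M - S \<subseteq> beyond h"
proof -
  have T: "triangle T" and S: "side T S" using R by (auto simp: region_def)
  have near: "dst M k \<in> T \<or> dst M k \<in> interior S" if "k \<in> out v" for k
    using interior_adj[OF S vS, of "dst M k"] adjI[of k] that by auto
  \<comment> \<open>\<open>v\<close> has at least four neighbours and \<open>T\<close> only three
    vertices. An interior neighbour forces \<open>z\<close> into \<open>T\<close> or the interior as
    well.\<close>
  have "\<exists>k \<in> out v. dst M k \<notin> T"
  proof (rule ccontr)
    assume "\<not> ?thesis"
    then have "out v \<subseteq> {k \<in> out v. dst M k \<in> T}" by blast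
    moreover have "inj_on (dst M) (out v)" by (rule inj_onI) (auto intro: simple_darts)
    ultimately have "card (out v) \<le> card T"
      by (intro card_inj_on_le[of "dst M"] triangle_finite[OF T]) auto
    then show False using deg T by (simp add: triangle_def)
  qed
  then obtain k where k: "k \<in> out v" "dst M k \<in> interior S" using near by blast
  have zT: "z \<in> T \<or> z \<in> interior S"
    using interior_adj[OF S k(2)] z_adj[OF k(1)] adj_sym by blast
  have corner: "u \<in> T \<or> u \<in> interior S" if "u \<in> tri h" for u
    using that near[OF h] near[of "rot M h"] h zT by (auto simp: tri_def)
  have edge: "d \<in> S \<or> opp M d \<in> S" if d: "d \<in> darts M" "src M d \<in> tri h" "dst M d \<in> tri h" for d
  proof (cases "src M d \<in> interior S \<or> dst M d \<in> interior S")
    case True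
    then show ?thesis
    proof
      assume "src M d \<in> interior S"
      then show ?thesis using interior_dart(1)[OF S _ d(1)] by blast
    next
      assume "dst M d \<in> interior S"
      then show ?thesis using interior_dart(1)[OF S, of "opp M d"] d(1) by (simp add: src_opp)
    qed
  next
    case False
    then have "src M d \<in> T" "dst M d \<in> T" using corner d by blast+
    then show ?thesis using side_edge[OF S d(1)] by blast
  qed
  have "(darts M - S) \<inter> beyond h = {} \<or> (darts M - S) \<inter> beyond h = darts M - S"
  proof (rule side_connected[OF T side_compl[OF S]])
    show "closed_faces ((darts M - S) \<inter> beyond h)"
      by (rule closed_faces_Int[OF side_closed[OF side_compl[OF S]] side_closed[OF beyond(1)[OF h]]])
    fix d assume d: "d \<in> darts M - S" "opp M d \<in> darts M - S"
    then have "src M d \<notin> tri h \<or> dst M d \<notin> tri h" using edge[of d] by blast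
    then have "opp M d \<in> beyond h \<longleftrightarrow> d \<in> beyond h" using side_other[OF beyond(1)[OF h]] d by blast
    then show "d \<in> (darts M - S) \<inter> beyond h \<longleftrightarrow> opp M d \<in> (darts M - S) \<inter> beyond h" using d by blast
  qed simp
  moreover have "h \<in> S" "h \<notin> beyond h" using vS h beyond(2)[OF h] by (auto simp: interior_def)
  ultimately show ?thesis using side_sub[OF beyond(1)[OF h]] by blast
qed

text \<open>Disjoint sets cannot both contain the complement of \<open>S\<close>, which is
  nonempty.\<close>

lemma opposite_beyond:
  assumes R: "region T S" and vS: "v \<in> interior S" and h: "h \<in> out v" "h' \<in> out v"
    and dis: "{dst M h, dst M (rot M h)} \<inter> {dst M h', dst M (rot M h')} = {}"
  shows "beyond h \<subset> S \<or> beyond h' \<subset> S"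
proof (rule ccontr)
  assume "\<not> ?thesis"
  then have "darts M - S \<subseteq> beyond h \<inter> beyond h'"
    using beyond_cases[OF R vS h(1)] beyond_cases[OF R vS h(2)] by blast
  then have "darts M - S = {}" using beyond_disjoint[OF h dis] by blast
  moreover have T: "triangle T" and S: "side T S" using R by (auto simp: region_def)
  have "T \<noteq> {}" using T by (auto simp: triangle_def)
  then obtain u where u: "u \<in> T" by blast
  obtain d where d': "d \<in> darts M" "src M d = u" "dst M d \<in> T" by (rule triangle_out_ex[OF T u])
  then have d: "d \<in> darts M" "src M d \<in> T" "dst M d \<in> T" using u by simp_all
  then have "opp M d \<in> S \<longleftrightarrow> d \<notin> S" "opp M d \<in> darts M" using side_edge[OF S d] by simp_all
  ultimately show False using d(1) by blast
qed

lemma beyond_face: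
  assumes "minimal_region T S" "h \<in> out v" "beyond h \<subset> S"
  shows "dst M (face_step M (rim h)) = z"
  using small_beyond[OF assms(2)] minimal_regionD[OF assms(1) tri_triangle beyond(1) assms(3)] assms(2)
  by blast

end

text \<open>Two consecutive faces at \<open>z\<close> close the rotation at their common rim vertex
  after four darts, which lead to \<open>v\<close>, \<open>z\<close> and two rim vertices, distinct
  by \<open>ne\<close>. All four darts are in \<open>S\<close>, so the vertex is interior.\<close>

lemma (in apex) corner_interior:
  assumes min: "minimal_region T S" and vS: "v \<in> interior S" and h: "h \<in> out v"
    and sub: "beyond h \<subset> S" "beyond (rot M h) \<subset> S" and ne: "dst M h \<noteq> dst M (rot M (rot M h))"
  shows "dst M (rot M h) \<in> interior S" "card (out (dst M (rot M h))) = 4"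
proof -
  let ?k = "rot M h"
  let ?u = "dst M ?k"
  have S: "side T S" using min by (simp add: minimal_region_def region_def)
  have k: "?k \<in> out v" and hM: "h \<in> darts M" using h by auto
  note rc = rim_corner[OF h beyond_face[OF min h sub(1)] beyond_face[OF min k sub(2)]]
  let ?X = "{opp M ?k, face_step M ?k, face_step M (rim h), rim ?k}"
  have X: "?X \<subseteq> out ?u"
    using rim_ends[OF h] rim_ends[OF k] hM by (auto simp: src_opp src_face_step)
  have X': "out ?u \<subseteq> ?X"
  proof
    fix d assume d: "d \<in> out ?u"
    show "d \<in> ?X"
    proof (rule closed_rot_out[of _ "opp M ?k"])
      fix f assume "f \<in> ?X"
      moreover have "rot M (opp M ?k) = face_step M ?k" by (simp add: face_step_def)
      ultimately show "rot M f \<in> ?X" using rc by auto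
    qed (use d hM in \<open>auto simp: src_opp\<close>)
  qed
  have "?X \<subseteq> S"
  proof -
    have "opp M ?k \<in> S" "?k \<in> S" using interior_dart[OF S, of ?k] k vS by auto
    moreover have "rim h \<in> S" "rim ?k \<in> S" using rim_beyond[OF h] rim_beyond[OF k] sub by blast+
    ultimately show ?thesis using closed_faces_iff[OF side_closed[OF S]] by auto
  qed
  then show "?u \<in> interior S" using X' dst_in[of ?k] hM by (auto simp: interior_def)
  have d: "dst M (opp M ?k) = v" "dst M (face_step M ?k) = dst M h" "dst M (face_step M (rim h)) = z"
    "dst M (rim ?k) = dst M (rot M ?k)"
  proof -
    show "dst M (opp M ?k) = v" using k by (simp add: dst_opp)
    have "opp M (face_step M ?k) = rim h" by (simp add: rim_def)
    then show "dst M (face_step M ?k) = dst M h" using rim_ends(2)[OF h] hM by (metis face_step_in_iff rot_in_iff src_opp)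
    show "dst M (face_step M (rim h)) = z" by (rule beyond_face[OF min h sub(1)])
    show "dst M (rim ?k) = dst M (rot M ?k)" by (rule rim_ends(3)[OF k])
  qed
  have kk: "rot M ?k \<in> out v" using k by simp
  have "v \<noteq> dst M h" "v \<noteq> dst M (rot M ?k)" "z \<noteq> dst M h" "z \<noteq> dst M (rot M ?k)"
    using no_loop[of h] no_loop[of "rot M ?k"] h kk z(2) by (auto simp: image_iff)
  then have "distinct (map (dst M) [opp M ?k, face_step M ?k, face_step M (rim h), rim ?k])"
    using ne z(1) unfolding list.map d by auto
  then have "distinct [opp M ?k, face_step M ?k, face_step M (rim h), rim ?k]"
    unfolding distinct_map by blast
  then have "card ?X = 4" by simp
  moreover have "out ?u = ?X" by (rule subset_antisym[OF X' X])
  ultimately show "card (out ?u) = 4" by (simp only:)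
qed

section \<open>Vertices of degree four and five in a minimal region\<close>

context simple_triangulation
begin

lemma adj_hub: "ring v hs \<Longrightarrow> h \<in> set hs \<Longrightarrow> adj v (dst M h)"
  using adjI[of h] ring_darts by force

lemma not_adj_self: "\<not> adj u u"
  unfolding adj_def by (auto dest: no_loop)

lemma chord_side:
  assumes R: "ring v hs" and h: "h0 \<in> set hs" "h2 \<in> set hs" "h0 \<noteq> h2" and adj: "adj (dst M h0) (dst M h2)"
  obtains S where "cut {v, dst M h0, dst M h2} S" "(h2 \<in> S) \<noteq> (opp M h2 \<in> S)"
proof -
  have hM: "h0 \<in> darts M" "src M h0 = v" "h2 \<in> darts M" "src M h2 = v" using ring_darts[OF R] h by auto
  have "triangle {v, dst M h0, dst M h2}"
  proof (rule triangleI)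
    show "adj v (dst M h0)" "adj (dst M h2) v" using adj_hub[OF R] h adj_sym by blast+
    show "v \<noteq> dst M h0" "dst M h2 \<noteq> v" using no_loop[of h0] no_loop[of h2] hM by auto
    show "dst M h0 \<noteq> dst M h2" using adj not_adj_self by metis
  qed (rule adj)
  then obtain S where S: "side {v, dst M h0, dst M h2} S" by (rule side_exists)
  moreover have "(h2 \<in> S) \<noteq> (opp M h2 \<in> S)" using side_edge[OF S hM(3)] hM(4) by simp
  ultimately show thesis using that side_imp_cut by blast
qed

lemma path_side:
  assumes R: "ring v hs" and h: "h0 \<in> set hs" "h2 \<in> set hs" "h0 \<noteq> h2"
    and z: "adj (dst M h0) z" "adj (dst M h2) z" "z \<noteq> v"
  obtains S where "cut {v, dst M h0, z, dst M h2} S" "(h2 \<in> S) \<noteq> (opp M h2 \<in> S)"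
proof -
  have hM: "h0 \<in> darts M" "src M h0 = v" "h2 \<in> darts M" "src M h2 = v" using ring_darts[OF R] h by auto
  have ne: "dst M h0 \<noteq> dst M h2" using simple_darts[of h0 h2] hM h(3) by auto
  have "distinct [v, dst M h0, z, dst M h2]"
    using no_loop[of h0] no_loop[of h2] hM z not_adj_self ne by auto
  moreover have "adj v (dst M h0)" "adj z (dst M h2)" "adj (dst M h2) v"
    using adj_hub[OF R] h z adj_sym by blast+
  ultimately obtain S where "cut {v, dst M h0, z, dst M h2} S"
     "\<And>d. d \<in> darts M \<Longrightarrow> src M d = v \<Longrightarrow> dst M d \<in> {dst M h0, dst M h2} \<Longrightarrow> (d \<in> S) \<noteq> (opp M d \<in> S)"
    using four_cycle_cut[of v "dst M h0" z "dst M h2"] z(1) by blast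
  then show thesis using that[of S] hM by simp
qed

text \<open>The chord and two spokes form a triangle separating the other two rim vertices. These
  are thus not adjacent and have only harmless common neighbours, so they can be merged.\<close>

lemma chord4:
  assumes R: "ring v [h0, h1, h2, h3]" and adj: "adj (dst M h0) (dst M h2)"
  shows reducible
proof -
  have r: "rot M h1 = h2" "rot M h2 = h3" using R by (simp_all add: ring_def cyc_def)
  have dis: "distinct (v # map (dst M) [h0, h1, h2, h3])" by (rule ring_distinct[OF R])
  have ne: "h0 \<noteq> h2" using dis by auto
  obtain S where S: "cut {v, dst M h0, dst M h2} S" "(h2 \<in> S) \<noteq> (opp M h2 \<in> S)"
    by (rule chord_side[OF R _ _ ne adj]) auto
  have h1: "h1 \<in> darts M" using ring_darts[OF R] by auto
  have Z: "dst M h1 \<notin> {v, dst M h0, dst M h2}" "dst M h3 \<notin> {v, dst M h0, dst M h2}" using dis by auto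
  note sep = cut_separates_rim[OF S(1) h1, unfolded r, OF S(2) disjI1[OF refl] Z]
  have R': "ring v [h1, h2, h3, h0]" using ring_rotate[of v "[h0]" "[h1, h2, h3]"] R by simp
  show ?thesis by (rule reducible4[OF R' sep(1)]) (use sep(2) in blast)
qed

text \<open>The 4-cycle through \<open>v\<close> and \<open>z\<close> separates the ends of
  \<open>h1\<close> and \<open>h3\<close>, whose common neighbours must then lie on it. This is why
  both pairs of opposite rim vertices are blocked by the same \<open>z\<close>.\<close>

lemma path4:
  assumes R: "ring v [h0, h1, h2, h3]" and z: "adj (dst M h0) z" "adj (dst M h2) z" "z \<notin> {v, dst M h1, dst M h3}"
    and y: "adj (dst M h1) y" "adj (dst M h3) y"
  shows "y \<in> {v, dst M h0, z, dst M h2}"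
proof -
  have r: "rot M h1 = h2" "rot M h2 = h3" using R by (simp_all add: ring_def cyc_def)
  have dis: "distinct (v # map (dst M) [h0, h1, h2, h3])" by (rule ring_distinct[OF R])
  have ne: "h0 \<noteq> h2" and zv: "z \<noteq> v" using dis z(3) by auto
  obtain S where S: "cut {v, dst M h0, z, dst M h2} S" "(h2 \<in> S) \<noteq> (opp M h2 \<in> S)"
    by (rule path_side[OF R _ _ ne z(1,2) zv]) auto
  have h1: "h1 \<in> darts M" using ring_darts[OF R] by auto
  have Z: "dst M h1 \<notin> {v, dst M h0, z, dst M h2}" "dst M h3 \<notin> {v, dst M h0, z, dst M h2}"
    using dis z(3) by auto
  show ?thesis by (rule cut_separates_rim(2)[OF S(1) h1, unfolded r, OF S(2) disjI1[OF refl] Z y])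
qed

lemma degree4_reducible:
  assumes min: "minimal_region T S" and vS: "v \<in> interior S" and four: "card (out v) = 4"
  shows reducible
proof -
  have region: "region T S" using min by (simp add: minimal_region_def)
  have v: "v \<in> vs M" using vS by (simp add: interior_def)
  obtain hs where hs: "ring v hs" "length hs = 4" using ring_exists[OF v] four by metis
  then obtain h0 h1 h2 h3 where R: "ring v [h0, h1, h2, h3]"
    by (auto simp: numeral_eq_Suc length_Suc_conv)
  have R1: "ring v [h1, h2, h3, h0]" using ring_rotate[of v "[h0]" "[h1, h2, h3]"] R by simp
  have R2: "ring v [h2, h3, h0, h1]" using ring_rotate[of v "[h1]" "[h2, h3, h0]"] R1 by simp
  have R3: "ring v [h3, h0, h1, h2]" using ring_rotate[of v "[h2]" "[h3, h0, h1]"] R2 by simp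
  let ?x0 = "dst M h0" and ?x1 = "dst M h1" and ?x2 = "dst M h2" and ?x3 = "dst M h3"
  have dis: "distinct [v, ?x0, ?x1, ?x2, ?x3]" using ring_distinct[OF R] by simp
  show ?thesis
  proof (rule ccontr)
    assume irr: "\<not> reducible"
    have na: "\<not> adj ?x0 ?x2" "\<not> adj ?x1 ?x3" using chord4[OF R] chord4[OF R1] irr by blast+
    then have na': "\<not> adj ?x2 ?x0" "\<not> adj ?x3 ?x1" using adj_sym by blast+
    obtain z where z02: "adj ?x0 z" "adj ?x2 z" "z \<notin> {v, ?x1, ?x3}"
      using reducible4[OF R na(1)] irr by blast
    obtain z' where z': "adj ?x1 z'" "adj ?x3 z'" "z' \<notin> {v, ?x2, ?x0}"
      using reducible4[OF R1 na(2)] irr by blast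
    have "z' \<in> {v, ?x0, z, ?x2}" by (rule path4[OF R z02 z'(1,2)])
    then have zz: "z' = z" using z'(3) by blast
    have z13: "adj ?x1 z" "adj ?x3 z" using z' zz by auto
    have zx: "z \<noteq> ?x0" "z \<noteq> ?x2" "z \<notin> {v, ?x0, ?x2}" using z' zz by auto
    have out: "out v = {h0, h1, h2, h3}" using R by (simp add: ring_def)
    interpret apex M v z
    proof
      show "z \<notin> dst M ` out v" unfolding out using z02(3) zx by auto
      show "adj z (dst M h)" if "h \<in> out v" for h using that z02 z13 adj_sym unfolding out by blast
    qed (use v z02(3) four in auto)
    have r: "rot M h0 = h1" "rot M h1 = h2" "rot M h2 = h3" "rot M h3 = h0"
      using R by (simp_all add: ring_def cyc_def)
    have h: "h0 \<in> out v" "h1 \<in> out v" "h2 \<in> out v" "h3 \<in> out v" unfolding out by auto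
    \<comment> \<open>Opposite rim edges have no common end.\<close>
    have f02: "beyond h0 \<subset> S \<or> beyond h2 \<subset> S"
      by (rule opposite_beyond[OF region vS h(1,3)]) (use dis in \<open>auto simp: r\<close>)
    have f13: "beyond h1 \<subset> S \<or> beyond h3 \<subset> S"
      by (rule opposite_beyond[OF region vS h(2,4)]) (use dis in \<open>auto simp: r\<close>)
    have no_corner: False
      if R': "ring v [k0, k1, k2, k3]" and na: "\<not> adj (dst M k0) (dst M k2)"
        and sub: "beyond k0 \<subset> S" "beyond k1 \<subset> S"
        and zk: "adj (dst M k1) z" "adj (dst M k3) z" for k0 k1 k2 k3
    proof -
      have r': "rot M k0 = k1" "rot M k1 = k2" using R' by (simp_all add: ring_def cyc_def)
      have k: "k0 \<in> out v" "k1 \<in> out v" and out': "out v = {k0, k1, k2, k3}" using R' by (auto simp: ring_def)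
      have zout: "z \<notin> {v, dst M k0, dst M k1, dst M k2, dst M k3}" using z unfolding out' by auto
      have c: "dst M (face_step M (rim k0)) = z" "dst M (face_step M (rim k1)) = z"
        using beyond_face[OF min k(1) sub(1)] beyond_face[OF min k(2) sub(2)] by auto
      note rc = rim_corner[OF k(1) c(1) c(2)[folded r'(1)], unfolded r'(1)]
      have R'': "ring v [k1, k2, k3, k0]" using ring_rotate[of v "[k0]" "[k1, k2, k3]"] R' by simp
      have reducible
      proof (rule reducible4_2wheel[OF R' na])
        show "rot M (rot M (face_step M k1)) = opp M (face_step M k2)"
          unfolding rc(1) rc(2) by (simp add: rim_def r')
        show "dst M (rot M (face_step M k1)) = z" unfolding rc(1) by (rule c(1))
        show "z \<notin> {v, dst M k0, dst M k2, dst M k3}" using zout by blast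
        fix y assume y: "adj (dst M k0) y" "adj (dst M k2) y"
        have "y \<in> {v, dst M k1, z, dst M k3}"
          by (rule path4[OF R'' zk _ y(2,1)]) (use zout in blast)
        then show "y \<in> {v, dst M k1, dst M k3, z}" by blast
      qed
      then show False using irr by blast
    qed
    \<comment> \<open>A member of each opposite pair is within \<open>S\<close>, and two such
      members are consecutive in the cyclic order; the four rotations of the ring cover the
      cases.\<close>
    show False
      using f02 f13 no_corner[OF R na(1) _ _ z13] no_corner[OF R1 na(2) _ _ z02(2,1)]
        no_corner[OF R2 na'(1) _ _ z13(2,1)] no_corner[OF R3 na'(2) _ _ z02(1,2)] by blast
  qed
qed

lemma chord5_separates:
  assumes R: "ring v [h0, h1, h2, h3, h4]" and adj: "adj (dst M h0) (dst M h2)"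
  shows "\<not> adj (dst M h1) (dst M h3)" "\<not> adj (dst M h1) (dst M h4)"
    "adj (dst M h1) y \<Longrightarrow> adj (dst M h3) y \<Longrightarrow> y \<in> {v, dst M h0, dst M h2}"
    "adj (dst M h1) y \<Longrightarrow> adj (dst M h4) y \<Longrightarrow> y \<in> {v, dst M h0, dst M h2}"
proof -
  have r: "rot M h1 = h2" "rot M h2 = h3" "rot M h3 = h4" using R by (simp_all add: ring_def cyc_def)
  have dis: "distinct (v # map (dst M) [h0, h1, h2, h3, h4])" by (rule ring_distinct[OF R])
  have ne: "h0 \<noteq> h2" using dis by auto
  obtain S where S: "cut {v, dst M h0, dst M h2} S" "(h2 \<in> S) \<noteq> (opp M h2 \<in> S)"
    by (rule chord_side[OF R _ _ ne adj]) auto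
  have h1: "h1 \<in> darts M" using ring_darts[OF R] by auto
  let ?Z = "{v, dst M h0, dst M h2}"
  have Z: "dst M h1 \<notin> ?Z" "dst M h3 \<notin> ?Z" "dst M h4 \<notin> ?Z" using dis by auto
  note sep3 = cut_separates_rim[OF S(1) h1, unfolded r, OF S(2) disjI1[OF refl] Z(1,2)]
  note sep4 = cut_separates_rim[OF S(1) h1, unfolded r, OF S(2) disjI2[OF conjI[OF refl Z(2)]] Z(1,3)]
  show "\<not> adj (dst M h1) (dst M h3)" "\<not> adj (dst M h1) (dst M h4)" by (rule sep3(1), rule sep4(1))
  show "adj (dst M h1) y \<Longrightarrow> adj (dst M h3) y \<Longrightarrow> y \<in> ?Z" by (rule sep3(2))
  show "adj (dst M h1) y \<Longrightarrow> adj (dst M h4) y \<Longrightarrow> y \<in> ?Z" by (rule sep4(2))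
qed

lemma path5:
  assumes R: "ring v [h0, h1, h2, h3, h4]" and z: "adj (dst M h0) z" "adj (dst M h2) z"
    "z \<notin> {v, dst M h1, dst M h3, dst M h4}"
  shows "adj (dst M h1) y \<Longrightarrow> adj (dst M h3) y \<Longrightarrow> y \<in> {v, dst M h0, z, dst M h2}"
    "adj (dst M h1) y \<Longrightarrow> adj (dst M h4) y \<Longrightarrow> y \<in> {v, dst M h0, z, dst M h2}"
proof -
  have r: "rot M h1 = h2" "rot M h2 = h3" "rot M h3 = h4" using R by (simp_all add: ring_def cyc_def)
  have dis: "distinct (v # map (dst M) [h0, h1, h2, h3, h4])" by (rule ring_distinct[OF R])
  have ne: "h0 \<noteq> h2" and zv: "z \<noteq> v" using dis z(3) by auto
  let ?Z = "{v, dst M h0, z, dst M h2}"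
  obtain S where S: "cut ?Z S" "(h2 \<in> S) \<noteq> (opp M h2 \<in> S)"
    by (rule path_side[OF R _ _ ne z(1,2) zv]) auto
  have h1: "h1 \<in> darts M" using ring_darts[OF R] by auto
  have Z: "dst M h1 \<notin> ?Z" "dst M h3 \<notin> ?Z" "dst M h4 \<notin> ?Z" using dis z(3) by auto
  note sep3 = cut_separates_rim[OF S(1) h1, unfolded r, OF S(2) disjI1[OF refl] Z(1,2)]
  note sep4 = cut_separates_rim[OF S(1) h1, unfolded r, OF S(2) disjI2[OF conjI[OF refl Z(2)]] Z(1,3)]
  show "adj (dst M h1) y \<Longrightarrow> adj (dst M h3) y \<Longrightarrow> y \<in> ?Z" by (rule sep3(2))
  show "adj (dst M h1) y \<Longrightarrow> adj (dst M h4) y \<Longrightarrow> y \<in> ?Z" by (rule sep4(2))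
qed

lemma ring5_rotate: "ring v [h0, h1, h2, h3, h4] \<Longrightarrow> ring v [h1, h2, h3, h4, h0]"
  using ring_rotate[of v "[h0]" "[h1, h2, h3, h4]"] by simp

text \<open>The chord separates the end of \<open>h1\<close> from those of \<open>h3\<close> and
  \<open>h4\<close>. Merging the ends of \<open>h1\<close> and \<open>h3\<close> works unless the
  end of \<open>h0\<close> is adjacent to that of \<open>h3\<close>. In that case this second chord
  separates the end of \<open>h4\<close> from that of \<open>h2\<close>, and the ends of
  \<open>h4\<close> and \<open>h1\<close> can be merged.\<close>

lemma chord5:
  assumes R: "ring v [h0, h1, h2, h3, h4]" and adj: "adj (dst M h0) (dst M h2)"
  shows reducible
proof (cases "adj (dst M h3) (dst M h0)")
  case False
  note R1 = ring5_rotate[OF R]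
  have "\<not> adj (dst M h3) (dst M h0)" by fact
  then show ?thesis
    using reducible5[OF R1 chord5_separates(1)[OF R adj]] chord5_separates(3)[OF R adj] by blast
next
  case True
  have R3: "ring v [h3, h4, h0, h1, h2]" by (rule ring5_rotate[OF ring5_rotate[OF ring5_rotate[OF R]]])
  have R4: "ring v [h4, h0, h1, h2, h3]" by (rule ring5_rotate[OF R3])
  have "\<not> adj (dst M h4) (dst M h2)" by (rule chord5_separates(2)[OF R3 True])
  moreover have "\<not> adj (dst M h4) (dst M h1)" using chord5_separates(2)[OF R adj] adj_sym by blast
  ultimately show ?thesis
    using reducible5[OF R4] chord5_separates(4)[OF R adj] by blast
qed

lemma degree5_reducible:
  assumes min: "minimal_region T S" and vS: "v \<in> interior S" and five: "card (out v) = 5"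
  shows reducible
proof -
  have region: "region T S" using min by (simp add: minimal_region_def)
  have v: "v \<in> vs M" using vS by (simp add: interior_def)
  obtain hs where hs: "ring v hs" "length hs = 5" using ring_exists[OF v] five by metis
  then obtain h0 h1 h2 h3 h4 where R: "ring v [h0, h1, h2, h3, h4]"
    by (auto simp: numeral_eq_Suc length_Suc_conv)
  note R1 = ring5_rotate[OF R]
  note R2 = ring5_rotate[OF R1]
  note R3 = ring5_rotate[OF R2]
  note R4 = ring5_rotate[OF R3]
  let ?x0 = "dst M h0" and ?x1 = "dst M h1" and ?x2 = "dst M h2" and ?x3 = "dst M h3" and ?x4 = "dst M h4"
  have dis: "distinct [v, ?x0, ?x1, ?x2, ?x3, ?x4]" using ring_distinct[OF R] by simp
  show ?thesis
  proof (rule ccontr)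
    assume irr: "\<not> reducible"
    have na: "\<not> adj ?x0 ?x2" "\<not> adj ?x1 ?x3" "\<not> adj ?x2 ?x4" "\<not> adj ?x3 ?x0" "\<not> adj ?x4 ?x1"
      using chord5[OF R] chord5[OF R1] chord5[OF R2] chord5[OF R3] chord5[OF R4] irr by blast+
    have na': "\<not> adj ?x0 ?x3" "\<not> adj ?x4 ?x2" using na adj_sym by blast+
    obtain z where z: "adj ?x0 z" "adj ?x2 z" "z \<notin> {v, ?x1}"
      using reducible5[OF R na(1)] irr by blast
    have zx: "z \<notin> {v, ?x1, ?x3, ?x4}" using z na na' by auto
    obtain y where y: "adj ?x1 y" "adj ?x3 y" "y \<notin> {v, ?x2}"
      using reducible5[OF R1 na(2)] irr by blast
    \<comment> \<open>\<open>path5\<close> leaves only the vertices of the 4-cycle: \<open>v\<close>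
      and the end of \<open>h2\<close> are excluded by the choice of \<open>y\<close>, and the end
      of \<open>h0\<close> is not adjacent to that of \<open>h3\<close>.\<close>
    have "y = z" using path5(1)[OF R z(1,2) zx y(1,2)] y na by blast
    then have z13: "adj ?x1 z" "adj ?x3 z" using y by auto
    obtain t where t: "adj ?x4 t" "adj ?x1 t" "t \<notin> {v, ?x0}"
      using reducible5[OF R4 na(5)] irr by blast
    have "t = z" using path5(2)[OF R z(1,2) zx t(2,1)] t na' by blast
    then have z4: "adj ?x4 z" using t by auto
    have out: "out v = {h0, h1, h2, h3, h4}" using R by (simp add: ring_def)
    interpret apex M v z
    proof
      have "z \<noteq> ?x0" "z \<noteq> ?x2" using z not_adj_self by auto
      then show "z \<notin> dst M ` out v" unfolding out using zx by auto
      show "adj z (dst M h)" if "h \<in> out v" for h using that z z13 z4 adj_sym unfolding out by blast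
    qed (use v z(3) five in auto)
    have r: "rot M h0 = h1" "rot M h1 = h2" "rot M h2 = h3" "rot M h3 = h4" "rot M h4 = h0"
      using R by (simp_all add: ring_def cyc_def)
    have h: "h0 \<in> out v" "h1 \<in> out v" "h2 \<in> out v" "h3 \<in> out v" "h4 \<in> out v" unfolding out by auto
    have f0: "beyond h0 \<subset> S \<or> beyond h2 \<subset> S"
      by (rule opposite_beyond[OF region vS h(1,3)]) (use dis in \<open>auto simp: r\<close>)
    have f1: "beyond h1 \<subset> S \<or> beyond h3 \<subset> S"
      by (rule opposite_beyond[OF region vS h(2,4)]) (use dis in \<open>auto simp: r\<close>)
    have f2: "beyond h2 \<subset> S \<or> beyond h4 \<subset> S"
      by (rule opposite_beyond[OF region vS h(3,5)]) (use dis in \<open>auto simp: r\<close>)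
    have f3: "beyond h3 \<subset> S \<or> beyond h0 \<subset> S"
      by (rule opposite_beyond[OF region vS h(4,1)]) (use dis in \<open>auto simp: r\<close>)
    have f4: "beyond h4 \<subset> S \<or> beyond h1 \<subset> S"
      by (rule opposite_beyond[OF region vS h(5,2)]) (use dis in \<open>auto simp: r\<close>)
    have no_corner: False if k: "k \<in> out v" "beyond k \<subset> S" "beyond (rot M k) \<subset> S"
      "dst M k \<noteq> dst M (rot M (rot M k))" for k
      using degree4_reducible[OF min corner_interior[OF min vS k]] irr by blast
    have d: "?x0 \<noteq> ?x2" "?x1 \<noteq> ?x3" "?x2 \<noteq> ?x4" "?x3 \<noteq> ?x0" "?x4 \<noteq> ?x1" using dis by auto
    have c0: "\<not> (beyond h0 \<subset> S \<and> beyond h1 \<subset> S)"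
      using no_corner[OF h(1), unfolded r] d(1) by blast
    have c1: "\<not> (beyond h1 \<subset> S \<and> beyond h2 \<subset> S)"
      using no_corner[OF h(2), unfolded r] d(2) by blast
    have c2: "\<not> (beyond h2 \<subset> S \<and> beyond h3 \<subset> S)"
      using no_corner[OF h(3), unfolded r] d(3) by blast
    have c3: "\<not> (beyond h3 \<subset> S \<and> beyond h4 \<subset> S)"
      using no_corner[OF h(4), unfolded r] d(4) by blast
    have c4: "\<not> (beyond h4 \<subset> S \<and> beyond h0 \<subset> S)"
      using no_corner[OF h(5), unfolded r] d(5) by blast
    \<comment> \<open>Of two disjoint rim edges at least one has its far side within
      \<open>S\<close>, so at least three of the five do; but no two consecutive ones may, which
      allows at most two on a 5-cycle.\<close>
    show False using f0 f1 f2 f3 f4 c0 c1 c2 c3 c4 by blast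
  qed
qed

text \<open>A single dart at \<open>v\<close> would force a loop in its triangle. With two darts,
  the two triangles at \<open>v\<close> share all three edges and are the whole graph, which would
  have at most six darts.\<close>

lemma degree_ge_3:
  assumes n: "8 \<le> order M" and v: "v \<in> vs M"
  shows "3 \<le> card (out v)"
proof (rule ccontr)
  assume "\<not> 3 \<le> card (out v)"
  moreover obtain hs where hs: "ring v hs" "length hs = card (out v)" by (rule ring_exists[OF v])
  moreover have "hs \<noteq> []" using hs(1) by (simp add: ring_def cyc_def)
  ultimately have "length hs = Suc 0 \<or> length hs = Suc (Suc 0)"
    by (cases "length hs") auto
  then consider h where "hs = [h]" | h k where "hs = [h, k]"
    by (auto simp: length_Suc_conv)
  then show False
  proof cases
    case 1
    then have r: "rot M h = h" and h: "h \<in> darts M" using hs(1) by (auto simp: ring_def cyc_def)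
    have "face_step M (face_step M h) = opp M h" using face_step_rot[OF h] r by simp
    then show False using face_ends[OF h] h by (simp add: src_opp)
  next
    case 2
    have r: "rot M h = k" "rot M k = h" using hs(1) 2 by (simp_all add: ring_def cyc_def)
    have M: "h \<in> darts M" "k \<in> darts M" using hs(1) 2 by (auto simp: ring_def)
    have s: "face_step M (face_step M k) = opp M h" "face_step M (face_step M h) = opp M k"
      using face_step_rot[OF M(1)] face_step_rot[OF M(2)] r by simp_all
    have o: "opp M (face_step M h) = face_step M k"
    proof (rule simple_darts)
      show "src M (opp M (face_step M h)) = src M (face_step M k)"
        "dst M (opp M (face_step M h)) = dst M (face_step M k)"
        using face_ends[OF M(1)] face_ends[OF M(2)] M unfolding s by (simp_all add: src_opp dst_opp)
    qed (use M in auto)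
    then have o': "opp M (face_step M k) = face_step M h" by (metis opp_opp)
    let ?U = "face M h \<union> face M k"
    have U: "?U = {h, face_step M h, opp M k, k, face_step M k, opp M h}"
      unfolding face_eq[OF M(1)] face_eq[OF M(2)] s by auto
    have "closed_faces ?U"
      using closed_faces_face[OF M(1)] closed_faces_face[OF M(2)] by (auto simp: closed_faces_def)
    moreover have "opp M d \<in> ?U \<longleftrightarrow> d \<in> ?U" for d
    proof -
      have "opp M d \<in> ?U" if "d \<in> ?U" for d using that o o' unfolding U by auto
      from this[of d] this[of "opp M d"] show ?thesis by auto
    qed
    ultimately have "?U = {} \<or> ?U = darts M" by (rule closed_faces_opp_trivial)
    then have "darts M = ?U" using in_face_self[OF M(1)] by blast
    moreover have "card ?U \<le> card (face M h) + card (face M k)" by (rule card_Un_le)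
    ultimately have "card (darts M) \<le> 6" using card_face_darts M by simp
    then show False using euler6 n by (simp add: order_def)
  qed
qed

lemma reducible_order_ge_8:
  assumes n: "8 \<le> order M"
  shows reducible
proof -
  obtain T S where min: "minimal_region T S" by (rule minimal_region_exists[OF n])
  then have "region T S" by (simp add: minimal_region_def)
  then obtain v where v: "v \<in> interior S" "card (out v) \<le> 5" by (rule low_degree_vertex)
  then have vM: "v \<in> vs M" by (simp add: interior_def)
  then have "card (out v) = 3 \<or> card (out v) = 4 \<or> card (out v) = 5"
    using degree_ge_3[OF n vM] v(2) by linarith
  then show ?thesis
  proof (elim disjE)
    assume "card (out v) = 3"
    then obtain hs where "ring v hs" "length hs = 3" using ring_exists[OF vM] by metis
    then obtain h0 h1 h2 where "ring v [h0, h1, h2]" by (auto simp: numeral_eq_Suc length_Suc_conv)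
    then show ?thesis by (rule reducible3)
  next
    assume "card (out v) = 4"
    then show ?thesis by (rule degree4_reducible[OF min v(1)])
  next
    assume "card (out v) = 5"
    then show ?thesis by (rule degree5_reducible[OF min v(1)])
  qed
qed

end

theorem theorem4p6:
  fixes G :: "('a, 'b) embedded_graph" and n :: nat
  assumes "maximal_planar G" and "simple G" and "four_colorable G"
    and "order G = n" and "n \<ge> 8"
  shows "\<exists>H :: ('a, 'b) embedded_graph.
    maximal_planar H \<and> order H \<in> {n - 1, n - 2, n - 3} \<and>
    (extend_3wheel H G \<or>
     extend_4wheel H G \<or>
     extend_5wheel H G \<or>
     (extend_3wheel OO extend_5wheel) H G \<or>
     (extend_2wheel OO extend_5wheel) H G \<or>
     (extend_2wheel OO extend_4wheel) H G)"
proof -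
  have "triangulation G"
    using assms(1) unfolding maximal_planar_def by (intro triangulationI) auto
  moreover have "d = e" if "d \<in> darts G" "e \<in> darts G" "src G d = src G e" "dst G d = dst G e" for d e
    using assms(2) nomulti_digraph.no_multi_arcs[of "skel G" d e] that
    by (simp add: simple_def arc_to_ends_def)
  ultimately have "simple_triangulation G"
    by (simp add: simple_triangulation_def simple_triangulation_axioms_def)
  then have "simple_triangulation.reducible G"
    using assms(4,5) by (intro simple_triangulation.reducible_order_ge_8) auto
  then show ?thesis
    unfolding simple_triangulation.reducible_def[OF \<open>simple_triangulation G\<close>] using assms(4) by blast
qed

end
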